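(* Let $L^3$ be a closed Lagrangian submanifold of a strict nearly Kähler 6-manifold $(M^6,J,g)$. Let $$\hat F:\Omega^1(L^3)\oplus C_0^\infty(L^3)\to\Omega^1(L^3)\oplus C_0^\infty(L^3),\qquad \hat F(\alpha,f):=\Big( *F(\alpha)+df,\;-\tfrac13 *dF(\alpha)\Big),$$ where $F(\alpha)$ is the pull-back of the fundamental 2-form $\omega$ under the deformation of $L^3$ determined by $\alpha$. Then $(\alpha,f)$ is a solution of the equation $\hat F(\alpha,f)=0$ if and only if $\alpha$ is a solution of the equation $F(\alpha)=0$ and $f=0$.
   Context: An almost Hermitian manifold $(M,J,g)$ is nearly Kähler if $(\nabla^{LC}_XJ)X=0$ for all $X\in TM$, where $\nabla^{LC}$ is the Levi-Civita connection, and strict if moreover $\nabla^{LC}_XJ\neq0$ for all nonzero $X$. A strict nearly Kähler 6-manifold is of constant type: there is a constant $\lambda>0$ with $\|(\nabla^{LC}_XJ)Y\|^2=\lambda^2(\|X\|^2\|Y\|^2-\langle X,Y\rangle^2-\langle X,JY\rangle^2)$ for all $X,Y$. The fundamental 2-form is $\omega(X,Y):=g(JX,Y)$; $L^3$ is Lagrangian if $\omega|_{L^3}=0$. For a 1-form $\alpha$ on $L^3$ let $s_\alpha$ be the section of the normal bundle $NL^3$ with $(s_\alpha\rfloor\omega)|_{L^3}=\alpha$. Let $Exp:NL^3\to M^6$ be the normal exponential map, which identifies a neighbourhood of the zero section with a tubular neighbourhood of $L^3$, and put $F(\alpha):=(Exp\circ s_\alpha)^*(\omega)\in\Omega^2(L^3)$.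 Thus $C^1$-small Lagrangian deformations of $L^3$ correspond to $C^1$-small $\alpha$ with $F(\alpha)=0$. $C_0^\infty(L^3):=\{f\in C^\infty(L^3):\int_{L^3}f\,d\mathrm{vol}=0\}$. The Hodge star is that of the induced metric and the orientation $\mathrm{vol}_{L^3}=-\mathrm{Im}(\Phi)|_{L^3}$, with $\Phi(X,Y,Z):=\frac1{3\lambda}(d\omega(X,Y,Z)-\sqrt{-1}\,d\omega(X,Y,JZ))$.
   Formalization: "Closed" is taken to include connected: for disconnected L the claim fails (α=0 and f a nonzero locally constant function of mean zero). Also α ranges over those 1-forms for which Exp∘s_α, hence F(α), is defined. *)

theory Defs
  imports "HOL-Analysis.Analysis"
begin

section \<open>Smooth functions on open subsets of Euclidean spaces\<close>

primrec Ck_on :: "nat \<Rightarrow> 'a::euclidean_space set \<Rightarrow> ('a \<Rightarrow> 'b::real_normed_vector) \<Rightarrow> bool" where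
  "Ck_on 0 S f = continuous_on S f"
| "Ck_on (Suc k) S f =
     ((\<forall>x\<in>S. f differentiable (at x)) \<and>
      (\<forall>v. Ck_on k S (\<lambda>x. frechet_derivative f (at x) v)))"

text \<open>Only used for open sets.\<close>

definition smooth_on :: "'a::euclidean_space set \<Rightarrow> ('a \<Rightarrow> 'b::real_normed_vector) \<Rightarrow> bool" where
  "smooth_on S f \<longleftrightarrow> (\<forall>k. Ck_on k S f)"


section \<open>Smooth manifolds\<close>

text \<open>
  A chart is a pair of a domain and a coordinate map; a manifold is given by a smooth atlas.
  Its set of points is the union of the chart domains, with the subspace topology of the ambient
  type. Taking this type to be Hausdorff and second countable makes every manifold Hausdorff and
  second countable. As charts are onto open subsets of a Euclidean space, manifolds have no boundary.
\<close>

type_synonym ('m, 'e) chart = "'m set \<times> ('m \<Rightarrow> 'e)"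
type_synonym ('m, 'e) atlas = "('m, 'e) chart set"

abbreviation cdom :: "('m, 'e) chart \<Rightarrow> 'm set" where "cdom c \<equiv> fst c"
abbreviation cmap :: "('m, 'e) chart \<Rightarrow> 'm \<Rightarrow> 'e" where "cmap c \<equiv> snd c"
abbreviation cimg :: "('m, 'e) chart \<Rightarrow> 'e set" where "cimg c \<equiv> cmap c ` cdom c"

definition cinv :: "('m, 'e) chart \<Rightarrow> 'e \<Rightarrow> 'm" where
  "cinv c = inv_into (cdom c) (cmap c)"

definition points :: "('m, 'e) atlas \<Rightarrow> 'm set" where
  "points A = (\<Union>c\<in>A. cdom c)"

definition charts_at :: "('m, 'e) atlas \<Rightarrow> 'm \<Rightarrow> ('m, 'e) chart set" where
  "charts_at A p = {c \<in> A. p \<in> cdom c}"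

definition chart_at :: "('m, 'e) atlas \<Rightarrow> 'm \<Rightarrow> ('m, 'e) chart" where
  "chart_at A p = (SOME c. c \<in> charts_at A p)"

definition smooth_manifold ::
    "('m::{t2_space, second_countable_topology}, 'e::euclidean_space) atlas \<Rightarrow> bool" where
  "smooth_manifold A \<longleftrightarrow>
     (\<forall>c\<in>A. openin (top_of_set (points A)) (cdom c) \<and> open (cimg c) \<and>
            homeomorphism (cdom c) (cimg c) (cmap c) (cinv c)) \<and>
     (\<forall>c\<in>A. \<forall>d\<in>A. smooth_on (cmap c ` (cdom c \<inter> cdom d)) (cmap d \<circ> cinv c))"

definition smooth_map ::
    "('m::topological_space, 'e::euclidean_space) atlas \<Rightarrow>
     ('k::topological_space, 'f::euclidean_space) atlas \<Rightarrow> ('m \<Rightarrow> 'k) \<Rightarrow> bool" where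
  "smooth_map A B u \<longleftrightarrow>
     u ` points A \<subseteq> points B \<and> continuous_on (points A) u \<and>
     (\<forall>c\<in>A. \<forall>d\<in>B. smooth_on (cmap c ` (cdom c \<inter> u -` cdom d)) (cmap d \<circ> u \<circ> cinv c))"


section \<open>Tangent vectors\<close>

text \<open>
  A tangent vector at a point \<open>p\<close> is the family of its coordinate vectors with respect to the
  charts around \<open>p\<close>, related by the derivatives of the coordinate changes; the entries at all other
  charts are zero. Vector space operations are entrywise, and for every chart \<open>c\<close> around \<open>p\<close> the
  map \<open>v \<mapsto> v c\<close> is a linear isomorphism onto the model space with inverse \<open>tvec A c p\<close>.
\<close>

type_synonym ('m, 'e) tv = "('m, 'e) chart \<Rightarrow> 'e"

definition coord_change ::
    "('m, 'e::euclidean_space) chart \<Rightarrow> ('m, 'f::euclidean_space) chart \<Rightarrow> 'm \<Rightarrow> 'e \<Rightarrow> 'f" where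
  "coord_change c d p = frechet_derivative (cmap d \<circ> cinv c) (at (cmap c p))"

definition tangent_space ::
    "('m, 'e::euclidean_space) atlas \<Rightarrow> 'm \<Rightarrow> ('m, 'e) tv set" where
  "tangent_space A p =
     {v. (\<forall>c. c \<notin> charts_at A p \<longrightarrow> v c = 0) \<and>
         (\<forall>c\<in>charts_at A p. \<forall>d\<in>charts_at A p. v d = coord_change c d p (v c))}"

definition tvec :: "('m, 'e::euclidean_space) atlas \<Rightarrow> ('m, 'e) chart \<Rightarrow> 'm \<Rightarrow> 'e \<Rightarrow> ('m, 'e) tv" where
  "tvec A c p w = (\<lambda>d. if d \<in> charts_at A p then coord_change c d p w else 0)"

definition tzero :: "('m, 'e::euclidean_space) tv" where
  "tzero = (\<lambda>c. 0)"

definition tscale :: "real \<Rightarrow> ('m, 'e::euclidean_space) tv \<Rightarrow> ('m, 'e) tv" where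
  "tscale a v = (\<lambda>c. a *\<^sub>R v c)"

definition tadd :: "('m, 'e::euclidean_space) tv \<Rightarrow> ('m, 'e) tv \<Rightarrow> ('m, 'e) tv" where
  "tadd v w = (\<lambda>c. v c + w c)"

text \<open>The coordinate vector field of the chart \<open>c\<close> with constant coordinates \<open>w\<close>, at the point
  with coordinates \<open>x\<close>.\<close>

definition cfield :: "('m, 'e::euclidean_space) atlas \<Rightarrow> ('m, 'e) chart \<Rightarrow> 'e \<Rightarrow> 'e \<Rightarrow> ('m, 'e) tv" where
  "cfield A c w x = tvec A c (cinv c x) w"

definition differential ::
    "('m, 'e::euclidean_space) atlas \<Rightarrow> ('k, 'f::euclidean_space) atlas \<Rightarrow> ('m \<Rightarrow> 'k) \<Rightarrow>
     'm \<Rightarrow> ('m, 'e) tv \<Rightarrow> ('k, 'f) tv" where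
  "differential A B u p X =
     (let c = chart_at A p; d = chart_at B (u p)
      in tvec B d (u p) (frechet_derivative (cmap d \<circ> u \<circ> cinv c) (at (cmap c p)) (X c)))"


section \<open>Functions and differential forms\<close>

text \<open>
  Functions and forms on a manifold are total functions that vanish outside its points and
  outside its tangent spaces, so that equality of forms is equality of functions.
\<close>

type_synonym ('m, 'e) form1 = "'m \<Rightarrow> ('m, 'e) tv \<Rightarrow> real"
type_synonym ('m, 'e) form2 = "'m \<Rightarrow> ('m, 'e) tv \<Rightarrow> ('m, 'e) tv \<Rightarrow> real"
type_synonym ('m, 'e) form3 = "'m \<Rightarrow> ('m, 'e) tv \<Rightarrow> ('m, 'e) tv \<Rightarrow> ('m, 'e) tv \<Rightarrow> real"

definition ext0 :: "('m, 'e) atlas \<Rightarrow> ('m \<Rightarrow> real) \<Rightarrow> 'm \<Rightarrow> real" where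
  "ext0 A f = (\<lambda>p. if p \<in> points A then f p else 0)"

definition ext1 :: "('m, 'e::euclidean_space) atlas \<Rightarrow> ('m, 'e) form1 \<Rightarrow> ('m, 'e) form1" where
  "ext1 A a = (\<lambda>p X. if p \<in> points A \<and> X \<in> tangent_space A p then a p X else 0)"

definition ext2 :: "('m, 'e::euclidean_space) atlas \<Rightarrow> ('m, 'e) form2 \<Rightarrow> ('m, 'e) form2" where
  "ext2 A a = (\<lambda>p X Y. if p \<in> points A \<and> X \<in> tangent_space A p \<and> Y \<in> tangent_space A p
                       then a p X Y else 0)"

definition linear_on_tangent ::
    "('m, 'e::euclidean_space) atlas \<Rightarrow> 'm \<Rightarrow> (('m, 'e) tv \<Rightarrow> real) \<Rightarrow> bool" where
  "linear_on_tangent A p h \<longleftrightarrow>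
     (\<forall>X\<in>tangent_space A p. \<forall>Y\<in>tangent_space A p. h (tadd X Y) = h X + h Y) \<and>
     (\<forall>X\<in>tangent_space A p. \<forall>r. h (tscale r X) = r * h X)"

definition smooth_fun :: "('m, 'e::euclidean_space) atlas \<Rightarrow> ('m \<Rightarrow> real) \<Rightarrow> bool" where
  "smooth_fun A f \<longleftrightarrow> (\<forall>c\<in>A. smooth_on (cimg c) (\<lambda>x. f (cinv c x)))"

definition smooth_functions :: "('m, 'e::euclidean_space) atlas \<Rightarrow> ('m \<Rightarrow> real) set" where
  "smooth_functions A = {f. ext0 A f = f \<and> smooth_fun A f}"

definition one_forms :: "('m, 'e::euclidean_space) atlas \<Rightarrow> ('m, 'e) form1 set" where
  "one_forms A =
     {a. ext1 A a = a \<and> (\<forall>p\<in>points A. linear_on_tangent A p (a p)) \<and>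
         (\<forall>c\<in>A. \<forall>w. smooth_on (cimg c) (\<lambda>x. a (cinv c x) (cfield A c w x)))}"

definition d0 :: "('m, 'e::euclidean_space) atlas \<Rightarrow> ('m \<Rightarrow> real) \<Rightarrow> ('m, 'e) form1" where
  "d0 A f p X =
     (let c = chart_at A p in frechet_derivative (f \<circ> cinv c) (at (cmap c p)) (X c))"

text \<open>Normalised so that \<open>d\<eta>(X,Y,Z) = X \<eta>(Y,Z) - Y \<eta>(X,Z) + Z \<eta>(X,Y)\<close> for coordinate fields.\<close>

definition d2 :: "('m, 'e::euclidean_space) atlas \<Rightarrow> ('m, 'e) form2 \<Rightarrow> ('m, 'e) form3" where
  "d2 A \<eta> p X Y Z =
     (let c = chart_at A p;
          D = (\<lambda>u v w. frechet_derivative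
                 (\<lambda>x. \<eta> (cinv c x) (cfield A c v x) (cfield A c w x)) (at (cmap c p)) u)
      in D (X c) (Y c) (Z c) - D (Y c) (X c) (Z c) + D (Z c) (X c) (Y c))"

definition pullback2 ::
    "('m, 'e::euclidean_space) atlas \<Rightarrow> ('k, 'f::euclidean_space) atlas \<Rightarrow> ('m \<Rightarrow> 'k) \<Rightarrow>
     ('k, 'f) form2 \<Rightarrow> ('m, 'e) form2" where
  "pullback2 A B u \<eta> =
     ext2 A (\<lambda>p X Y. \<eta> (u p) (differential A B u p X) (differential A B u p Y))"


section \<open>Riemannian metrics\<close>

type_synonym ('m, 'e) metric = "'m \<Rightarrow> ('m, 'e) tv \<Rightarrow> ('m, 'e) tv \<Rightarrow> real"

definition riemannian_metric :: "('m, 'e::euclidean_space) atlas \<Rightarrow> ('m, 'e) metric \<Rightarrow> bool" where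
  "riemannian_metric A g \<longleftrightarrow>
     (\<forall>p\<in>points A. \<forall>X\<in>tangent_space A p.
        linear_on_tangent A p (g p X) \<and>
        (\<forall>Y\<in>tangent_space A p. g p X Y = g p Y X) \<and>
        (X \<noteq> tzero \<longrightarrow> g p X X > 0)) \<and>
     (\<forall>c\<in>A. \<forall>v w. smooth_on (cimg c) (\<lambda>x. g (cinv c x) (cfield A c v x) (cfield A c w x)))"

definition local_metric ::
    "('m, 'e::euclidean_space) atlas \<Rightarrow> ('m, 'e) metric \<Rightarrow> ('m, 'e) chart \<Rightarrow> 'e \<Rightarrow> 'e \<Rightarrow> 'e \<Rightarrow> real" where
  "local_metric A g c x v w = g (cinv c x) (cfield A c v x) (cfield A c w x)"

text \<open>The Levi-Civita connection in the chart \<open>c\<close> is \<open>\<nabla>\<^sub>u w = D\<^sub>u w + \<Gamma>(u,w)\<close>, where \<open>\<Gamma>\<close> is uniquely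
  determined by the conditions that the connection is torsion-free and metric.\<close>

definition christoffel ::
    "('m, 'e::euclidean_space) atlas \<Rightarrow> ('m, 'e) metric \<Rightarrow> ('m, 'e) chart \<Rightarrow> 'e \<Rightarrow> 'e \<Rightarrow> 'e \<Rightarrow> 'e" where
  "christoffel A g c x =
     (THE \<Gamma>. bilinear \<Gamma> \<and> (\<forall>u v. \<Gamma> u v = \<Gamma> v u) \<and>
        (\<forall>u v w. frechet_derivative (\<lambda>y. local_metric A g c y v w) (at x) u =
                 local_metric A g c x (\<Gamma> u v) w + local_metric A g c x v (\<Gamma> u w)))"

definition geodesic ::
    "('m::topological_space, 'e::euclidean_space) atlas \<Rightarrow> ('m, 'e) metric \<Rightarrow> (real \<Rightarrow> 'm) \<Rightarrow> bool" where
  "geodesic A g \<gamma> \<longleftrightarrow>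
     continuous_on {0..1} \<gamma> \<and> \<gamma> ` {0..1} \<subseteq> points A \<and>
     (\<forall>c\<in>A. \<exists>v. \<forall>t\<in>{0..1}. \<gamma> t \<in> cdom c \<longrightarrow>
        ((\<lambda>s. cmap c (\<gamma> s)) has_vector_derivative v t) (at t within {0..1}) \<and>
        (v has_vector_derivative - christoffel A g c (cmap c (\<gamma> t)) (v t) (v t))
          (at t within {0..1}))"

definition starts_with ::
    "('m, 'e::euclidean_space) atlas \<Rightarrow> (real \<Rightarrow> 'm) \<Rightarrow> 'm \<Rightarrow> ('m, 'e) tv \<Rightarrow> bool" where
  "starts_with A \<gamma> p v \<longleftrightarrow> \<gamma> 0 = p \<and>
     (\<forall>c\<in>charts_at A p.
        ((\<lambda>s. cmap c (\<gamma> s)) has_vector_derivative v c) (at 0 within {0..1}))"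

text \<open>
  \<open>E\<close> is the (smooth) Riemannian exponential map on the open, fibrewise star-shaped
  neighbourhood \<open>D\<close> of the zero section of the tangent bundle. On \<open>D\<close> it is uniquely determined,
  and its maximal domain of definition is an admissible choice of \<open>D\<close>. Openness in, and smoothness
  on, the tangent bundle are expressed in the coordinates \<open>(x, w)\<close> of \<open>tvec A c (cinv c x) w\<close>.
\<close>

definition exponential_map ::
    "('m::topological_space, 'e::euclidean_space) atlas \<Rightarrow> ('m, 'e) metric \<Rightarrow>
     ('m \<times> ('m, 'e) tv) set \<Rightarrow> ('m \<times> ('m, 'e) tv \<Rightarrow> 'm) \<Rightarrow> bool" where
  "exponential_map A g D E \<longleftrightarrow>
     D \<subseteq> (SIGMA p:points A. tangent_space A p) \<and>
     (\<forall>p\<in>points A. (p, tzero) \<in> D) \<and>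
     (\<forall>(p, v)\<in>D. (\<forall>t\<in>{0..1}. (p, tscale t v) \<in> D) \<and>
        geodesic A g (\<lambda>t. E (p, tscale t v)) \<and> starts_with A (\<lambda>t. E (p, tscale t v)) p v) \<and>
     (\<forall>c\<in>A.
        let Dc = {(x, w). x \<in> cimg c \<and> (cinv c x, cfield A c w x) \<in> D};
            Ec = (\<lambda>(x, w). E (cinv c x, cfield A c w x))
        in open Dc \<and>
           (\<forall>d\<in>A. open (Dc \<inter> Ec -` cdom d) \<and> smooth_on (Dc \<inter> Ec -` cdom d) (cmap d \<circ> Ec)))"

text \<open>
  The integral over a compact manifold with respect to the Riemannian volume, computed with a
  smooth partition of unity subordinate to finitely many charts (the value does not depend on it).
\<close>

definition has_volume_integral ::
    "('m::topological_space, real ^ 'n) atlas \<Rightarrow> ('m, real ^ 'n) metric \<Rightarrow> ('m \<Rightarrow> real) \<Rightarrow> real \<Rightarrow> bool" where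
  "has_volume_integral A g f I \<longleftrightarrow>
     (\<exists>(N::nat) c \<rho>.
        (\<forall>i<N. c i \<in> A \<and> smooth_fun A (\<rho> i) \<and> (\<forall>p\<in>points A. \<rho> i p \<ge> 0) \<and>
           (\<exists>K. compact K \<and> K \<subseteq> cdom (c i) \<and> (\<forall>p\<in>points A - K. \<rho> i p = 0))) \<and>
        (\<forall>p\<in>points A. (\<Sum>i<N. \<rho> i p) = 1) \<and>
        I = (\<Sum>i<N. integral (cimg (c i)) (\<lambda>x. \<rho> i (cinv (c i) x) * f (cinv (c i) x) *
               sqrt (det (\<chi> j k. local_metric A g (c i) x (axis j 1) (axis k 1))))))"

definition mean_zero_functions ::
    "('m::topological_space, real ^ 'n) atlas \<Rightarrow> ('m, real ^ 'n) metric \<Rightarrow> ('m \<Rightarrow> real) set" where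
  "mean_zero_functions A g = {f \<in> smooth_functions A. has_volume_integral A g f 0}"

text \<open>
  The Hodge star on a 3-manifold with the orientation given by a nowhere vanishing 3-form \<open>vol\<close>,
  in an oriented orthonormal frame \<open>e\<^sub>1, e\<^sub>2, e\<^sub>3\<close> with dual coframe \<open>e\<^sup>i = g(e\<^sub>i, \<cdot>)\<close>:
  \<open>*(e\<^sup>2 \<and> e\<^sup>3) = e\<^sup>1\<close> and cyclically, and \<open>*(e\<^sup>1 \<and> e\<^sup>2 \<and> e\<^sup>3) = 1\<close>.
\<close>

definition oriented_frame ::
    "('m, real ^ 3) atlas \<Rightarrow> ('m, real ^ 3) metric \<Rightarrow> ('m, real ^ 3) form3 \<Rightarrow> 'm \<Rightarrow>
     (3 \<Rightarrow> ('m, real ^ 3) tv) \<Rightarrow> bool" where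
  "oriented_frame A g vol p e \<longleftrightarrow>
     (\<forall>i. e i \<in> tangent_space A p) \<and>
     (\<forall>i j. g p (e i) (e j) = (if i = j then 1 else 0)) \<and> vol p (e 1) (e 2) (e 3) > 0"

definition hodge2 ::
    "('m, real ^ 3) atlas \<Rightarrow> ('m, real ^ 3) metric \<Rightarrow> ('m, real ^ 3) form3 \<Rightarrow>
     ('m, real ^ 3) form2 \<Rightarrow> ('m, real ^ 3) form1" where
  "hodge2 A g vol \<eta> p X =
     (let e = (SOME e. oriented_frame A g vol p e)
      in \<eta> p (e 2) (e 3) * g p (e 1) X + \<eta> p (e 3) (e 1) * g p (e 2) X +
         \<eta> p (e 1) (e 2) * g p (e 3) X)"

definition hodge3 ::
    "('m, real ^ 3) atlas \<Rightarrow> ('m, real ^ 3) metric \<Rightarrow> ('m, real ^ 3) form3 \<Rightarrow>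
     ('m, real ^ 3) form3 \<Rightarrow> 'm \<Rightarrow> real" where
  "hodge3 A g vol \<theta> p =
     (let e = (SOME e. oriented_frame A g vol p e) in \<theta> p (e 1) (e 2) (e 3))"


section \<open>Nearly Kaehler 6-manifolds\<close>

type_synonym ('m, 'e) endo = "'m \<Rightarrow> ('m, 'e) tv \<Rightarrow> ('m, 'e) tv"

definition almost_hermitian ::
    "('m::{t2_space, second_countable_topology}, 'e::euclidean_space) atlas \<Rightarrow> ('m, 'e) endo \<Rightarrow>
     ('m, 'e) metric \<Rightarrow> bool" where
  "almost_hermitian M J g \<longleftrightarrow>
     smooth_manifold M \<and> riemannian_metric M g \<and>
     (\<forall>p\<in>points M. \<forall>X\<in>tangent_space M p.
        J p X \<in> tangent_space M p \<and> J p (J p X) = tscale (-1) X \<and>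
        (\<forall>Y\<in>tangent_space M p. J p (tadd X Y) = tadd (J p X) (J p Y) \<and>
                                g p (J p X) (J p Y) = g p X Y) \<and>
        (\<forall>r. J p (tscale r X) = tscale r (J p X))) \<and>
     (\<forall>c\<in>M. \<forall>w. smooth_on (cimg c) (\<lambda>x. J (cinv c x) (cfield M c w x) c))"

text \<open>\<open>nabla_J M g J p X Y\<close> is \<open>(\<nabla>\<^sub>X J) Y = \<nabla>\<^sub>X (J Y) - J (\<nabla>\<^sub>X Y)\<close> for the Levi-Civita connection,
  where \<open>Y\<close> is extended with constant coordinates.\<close>

definition nabla_J ::
    "('m, 'e::euclidean_space) atlas \<Rightarrow> ('m, 'e) metric \<Rightarrow> ('m, 'e) endo \<Rightarrow> 'm \<Rightarrow>
     ('m, 'e) tv \<Rightarrow> ('m, 'e) tv \<Rightarrow> ('m, 'e) tv" where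
  "nabla_J M g J p X Y =
     (let c = chart_at M p; x = cmap c p; u = X c; w = Y c;
          Jc = (\<lambda>y z. J (cinv c y) (cfield M c z y) c);
          \<Gamma> = christoffel M g c x
      in tvec M c p
           (frechet_derivative (\<lambda>y. Jc y w) (at x) u + \<Gamma> u (Jc x w) - Jc x (\<Gamma> u w)))"

definition nearly_kaehler ::
    "('m::{t2_space, second_countable_topology}, 'e::euclidean_space) atlas \<Rightarrow> ('m, 'e) endo \<Rightarrow>
     ('m, 'e) metric \<Rightarrow> bool" where
  "nearly_kaehler M J g \<longleftrightarrow> almost_hermitian M J g \<and>
     (\<forall>p\<in>points M. \<forall>X\<in>tangent_space M p. nabla_J M g J p X X = tzero)"

definition strict_nearly_kaehler ::
    "('m::{t2_space, second_countable_topology}, 'e::euclidean_space) atlas \<Rightarrow> ('m, 'e) endo \<Rightarrow>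
     ('m, 'e) metric \<Rightarrow> bool" where
  "strict_nearly_kaehler M J g \<longleftrightarrow> nearly_kaehler M J g \<and>
     (\<forall>p\<in>points M. \<forall>X\<in>tangent_space M p. X \<noteq> tzero \<longrightarrow>
        (\<exists>Y\<in>tangent_space M p. nabla_J M g J p X Y \<noteq> tzero))"

definition constant_type ::
    "('m, 'e::euclidean_space) atlas \<Rightarrow> ('m, 'e) endo \<Rightarrow> ('m, 'e) metric \<Rightarrow> real \<Rightarrow> bool" where
  "constant_type M J g l \<longleftrightarrow> l > 0 \<and>
     (\<forall>p\<in>points M. \<forall>X\<in>tangent_space M p. \<forall>Y\<in>tangent_space M p.
        g p (nabla_J M g J p X Y) (nabla_J M g J p X Y) =
        l\<^sup>2 * (g p X X * g p Y Y - (g p X Y)\<^sup>2 - (g p X (J p Y))\<^sup>2))"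

definition fundamental_form :: "('m, 'e::euclidean_space) endo \<Rightarrow> ('m, 'e) metric \<Rightarrow> ('m, 'e) form2" where
  "fundamental_form J g p X Y = g p (J p X) Y"

definition Phi_form ::
    "('m, 'e::euclidean_space) atlas \<Rightarrow> ('m, 'e) endo \<Rightarrow> ('m, 'e) metric \<Rightarrow> real \<Rightarrow> 'm \<Rightarrow>
     ('m, 'e) tv \<Rightarrow> ('m, 'e) tv \<Rightarrow> ('m, 'e) tv \<Rightarrow> complex" where
  "Phi_form M J g l p X Y Z =
     1 / (3 * complex_of_real l) *
     (complex_of_real (d2 M (fundamental_form J g) p X Y Z) -
      \<i> * complex_of_real (d2 M (fundamental_form J g) p X Y (J p Z)))"


section \<open>Lagrangian submanifolds and their deformations\<close>

abbreviation incl :: "('m, 'e::euclidean_space) atlas \<Rightarrow> ('m, 'f::euclidean_space) atlas \<Rightarrow> 'm \<Rightarrow>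
     ('m, 'e) tv \<Rightarrow> ('m, 'f) tv" where
  "incl L M \<equiv> differential L M (\<lambda>p. p)"

definition submanifold ::
    "('m::{t2_space, second_countable_topology}, 'e::euclidean_space) atlas \<Rightarrow>
     ('m, 'f::euclidean_space) atlas \<Rightarrow> bool" where
  "submanifold L M \<longleftrightarrow> smooth_manifold L \<and> points L \<subseteq> points M \<and> smooth_map L M (\<lambda>p. p) \<and>
     (\<forall>p\<in>points L. \<forall>X\<in>tangent_space L p. incl L M p X = tzero \<longrightarrow> X = tzero)"

text \<open>A closed manifold is compact, connected and (like all manifolds here) without boundary.\<close>

definition closed_lagrangian ::
    "('m::{t2_space, second_countable_topology}, real ^ 3) atlas \<Rightarrow> ('m, real ^ 6) atlas \<Rightarrow>
     ('m, real ^ 6) endo \<Rightarrow> ('m, real ^ 6) metric \<Rightarrow> bool" where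
  "closed_lagrangian L M J g \<longleftrightarrow>
     submanifold L M \<and> compact (points L) \<and> connected (points L) \<and>
     (\<forall>p\<in>points L. \<forall>X\<in>tangent_space L p. \<forall>Y\<in>tangent_space L p.
        fundamental_form J g p (incl L M p X) (incl L M p Y) = 0)"

definition induced_metric ::
    "('m, real ^ 3) atlas \<Rightarrow> ('m, real ^ 6) atlas \<Rightarrow> ('m, real ^ 6) metric \<Rightarrow> ('m, real ^ 3) metric" where
  "induced_metric L M g p X Y = g p (incl L M p X) (incl L M p Y)"

definition vol_form ::
    "('m, real ^ 3) atlas \<Rightarrow> ('m, real ^ 6) atlas \<Rightarrow> ('m, real ^ 6) endo \<Rightarrow> ('m, real ^ 6) metric \<Rightarrow>
     real \<Rightarrow> ('m, real ^ 3) form3" where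
  "vol_form L M J g l p X Y Z =
     - Im (Phi_form M J g l p (incl L M p X) (incl L M p Y) (incl L M p Z))"

definition normal_space ::
    "('m, real ^ 3) atlas \<Rightarrow> ('m, real ^ 6) atlas \<Rightarrow> ('m, real ^ 6) metric \<Rightarrow> 'm \<Rightarrow>
     ('m, real ^ 6) tv set" where
  "normal_space L M g p =
     {v \<in> tangent_space M p. \<forall>X\<in>tangent_space L p. g p v (incl L M p X) = 0}"

definition normal_section ::
    "('m, real ^ 3) atlas \<Rightarrow> ('m, real ^ 6) atlas \<Rightarrow> ('m, real ^ 6) endo \<Rightarrow> ('m, real ^ 6) metric \<Rightarrow>
     ('m, real ^ 3) form1 \<Rightarrow> 'm \<Rightarrow> ('m, real ^ 6) tv" where
  "normal_section L M J g \<alpha> p =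
     (THE v. v \<in> normal_space L M g p \<and>
        (\<forall>X\<in>tangent_space L p. fundamental_form J g p v (incl L M p X) = \<alpha> p X))"

definition F_map ::
    "('m, real ^ 3) atlas \<Rightarrow> ('m, real ^ 6) atlas \<Rightarrow> ('m, real ^ 6) endo \<Rightarrow> ('m, real ^ 6) metric \<Rightarrow>
     ('m \<times> ('m, real ^ 6) tv \<Rightarrow> 'm) \<Rightarrow> ('m, real ^ 3) form1 \<Rightarrow> ('m, real ^ 3) form2" where
  "F_map L M J g E \<alpha> =
     pullback2 L M (\<lambda>p. E (p, normal_section L M J g \<alpha> p)) (fundamental_form J g)"

definition F_hat ::
    "('m, real ^ 3) atlas \<Rightarrow> ('m, real ^ 6) atlas \<Rightarrow> ('m, real ^ 6) endo \<Rightarrow> ('m, real ^ 6) metric \<Rightarrow>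
     real \<Rightarrow> ('m \<times> ('m, real ^ 6) tv \<Rightarrow> 'm) \<Rightarrow> ('m, real ^ 3) form1 \<times> ('m \<Rightarrow> real) \<Rightarrow>
     ('m, real ^ 3) form1 \<times> ('m \<Rightarrow> real)" where
  "F_hat L M J g l E = (\<lambda>(\<alpha>, f).
     (let h = induced_metric L M g; vol = vol_form L M J g l; F = F_map L M J g E \<alpha>
      in (ext1 L (\<lambda>p X. hodge2 L h vol F p X + d0 L f p X),
          ext0 L (\<lambda>p. - (1 / 3) * hodge3 L h vol (d2 L F) p))))"

end

theory Submission
  imports Defs
begin

text \<open>
  If \<open>*F = - df\<close> and \<open>*dF = 0\<close> for the 2-form \<open>F = F(\<alpha>)\<close>, then \<open>F = - vol(grad f, \<cdot>, \<cdot>)\<close> and hence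
  \<open>div grad f = 0\<close>. By Hopf's strong maximum principle, applied chart by chart, the set where \<open>f\<close> attains
  its maximum is open, so \<open>f\<close> is constant on the compact connected manifold \<open>L\<close>; having mean zero it
  vanishes, and then so does \<open>F\<close>. The nearly Kaehler structure enters only through the
  orientation: \<open>d\<omega>(X,Y,Z) = 3 g((\<nabla>\<^sub>X J)Y, Z)\<close> vanishes on \<open>L\<close> together with \<open>\<omega>\<close>, so for an orthonormal frame
  of \<open>L\<close> the vector \<open>(\<nabla>\<^bsub>e1\<^esub> J) e2\<close>, which has length \<open>\<lambda>\<close> by constant type, is a multiple of \<open>J e3\<close>.
  Therefore \<open>- Im \<Phi>\<close> restricts to a Riemannian volume form of \<open>L\<close>, and oriented frames exist.
\<close>

section \<open>Calculus of smooth functions\<close>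

text \<open>The familiar argument integrates |df|^2 by parts over L. The maximum principle takes the
  place of Stokes' theorem because it concerns a single chart; only compactness and connectedness of
  L join the charts. Two obstacles shape the chart computation. The Hodge stars use oriented frames
  picked point by point with \<open>SOME\<close>, so nothing is known about how a frame varies.
  Frames therefore enter only through their values at one point: derivatives fall on the metric, on
  the density of vol and on grad f, and the maximum principle is stated for coefficients that are
  bounded and elliptic but possibly discontinuous. The second obstacle is F itself. The deformation
  is shown to be differentiable at each point, which makes F bilinear and alternating but says
  nothing about derivatives of F, while the chart independence of \<open>d2\<close> rests on
  differentiability. The equation *F = - df repairs this: in coordinates it expresses F through the
  smooth data grad f and vol, hence F is differentiable where dF is taken.\<close>

lemma has_derivative_frechet:
  "f differentiable at x \<Longrightarrow> (f has_derivative frechet_derivative f (at x)) (at x)"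
  by (simp add: frechet_derivative_works)

lemma frechet_derivative_eqI:
  "(f has_derivative f') (at x) \<Longrightarrow> frechet_derivative f (at x) = f'"
  by (rule frechet_derivative_at[symmetric])

lemma frechet_derivative_cong_open:
  assumes "open S" "x \<in> S" "\<And>y. y \<in> S \<Longrightarrow> f y = g y"
  shows "frechet_derivative f (at x) = frechet_derivative g (at x)"
proof -
  have "(f has_derivative f') (at x) \<longleftrightarrow> (g has_derivative f') (at x)" for f'
    using assms has_derivative_transform_within_open[of f f' x UNIV S g]
      has_derivative_transform_within_open[of g f' x UNIV S f] by auto
  then show ?thesis by (simp add: frechet_derivative_def)
qed

lemma differentiable_cong_open:
  assumes "open S" "x \<in> S" "\<And>y. y \<in> S \<Longrightarrow> f y = g y"
  shows "f differentiable (at x) \<longleftrightarrow> g differentiable (at x)"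
proof -
  have "(f has_derivative f') (at x) \<longleftrightarrow> (g has_derivative f') (at x)" for f'
    using assms has_derivative_transform_within_open[of f f' x UNIV S g]
      has_derivative_transform_within_open[of g f' x UNIV S f] by auto
  then show ?thesis by (simp add: differentiable_def)
qed

section \<open>Closure properties of k times continuously differentiable maps\<close>

lemma Ck_on_cong:
  assumes "open S" "\<And>x. x \<in> S \<Longrightarrow> f x = g x"
  shows "Ck_on k S f \<longleftrightarrow> Ck_on k S g"
  using assms(2)
proof (induction k arbitrary: f g)
  case 0
  then show ?case by (simp cong: continuous_on_cong)
next
  case (Suc k)
  have "Ck_on k S (\<lambda>x. frechet_derivative f (at x) v) \<longleftrightarrow> Ck_on k S (\<lambda>x. frechet_derivative g (at x) v)" for v
    by (intro Suc.IH, subst frechet_derivative_cong_open[OF assms(1) _ Suc.prems]) auto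
  moreover have "f differentiable (at x) \<longleftrightarrow> g differentiable (at x)" if "x \<in> S" for x
    by (rule differentiable_cong_open[OF assms(1) that Suc.prems])
  ultimately show ?case by simp
qed

lemma Ck_on_subset: "Ck_on k S f \<Longrightarrow> T \<subseteq> S \<Longrightarrow> Ck_on k T f"
  by (induction k arbitrary: f) (auto intro: continuous_on_subset)

lemma Ck_on_Suc_imp: "Ck_on (Suc k) S f \<Longrightarrow> Ck_on k S f"
proof (induction k arbitrary: f)
  case 0
  then show ?case
    by (auto intro!: continuous_at_imp_continuous_on differentiable_imp_continuous_within)
next
  case (Suc k)
  then show ?case by (metis Ck_on.simps(2))
qed

lemma Ck_on_const: "Ck_on k S (\<lambda>x. c)"
  by (induction k arbitrary: c) auto

text \<open>\<open>Ck_on\<close> is phrased with \<open>frechet_derivative\<close>; here the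
  derivative may be any explicit formula \<open>f'\<close>, so that the product, chain and
  reciprocal rules feed the inductions below directly.\<close>

lemma Ck_on_SucI:
  assumes "open S" "\<And>x. x \<in> S \<Longrightarrow> (f has_derivative f' x) (at x)" "\<And>v. Ck_on k S (\<lambda>x. f' x v)"
  shows "Ck_on (Suc k) S f"
proof -
  have "Ck_on k S (\<lambda>x. frechet_derivative f (at x) v)" for v
    using assms(3)[of v] Ck_on_cong[OF assms(1), of "\<lambda>x. frechet_derivative f (at x) v" "\<lambda>x. f' x v" k]
      frechet_derivative_eqI[OF assms(2)] by simp
  then show ?thesis using assms(2) by (auto intro: differentiableI)
qed

lemma Ck_on_add:
  assumes "open S" "Ck_on k S f" "Ck_on k S g"
  shows "Ck_on k S (\<lambda>x. f x + g x)"
  using assms(2,3)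
proof (induction k arbitrary: f g)
  case 0
  then show ?case by (simp add: continuous_on_add)
next
  case (Suc k)
  then show ?case using Suc
    by (intro Ck_on_SucI[OF assms(1) has_derivative_add[OF has_derivative_frechet has_derivative_frechet]]) auto
qed

lemma Ck_on_bilinear:
  assumes "bounded_bilinear pr" "open S" "Ck_on k S f" "Ck_on k S g"
  shows "Ck_on k S (\<lambda>x. pr (f x) (g x))"
  using assms(3,4)
proof (induction k arbitrary: f g)
  case 0
  then show ?case using bounded_bilinear.continuous_on[OF assms(1)] by simp
next
  case (Suc k)
  then have d: "f differentiable (at x)" "g differentiable (at x)" if "x \<in> S" for x
    using that by auto
  have *: "((\<lambda>x. pr (f x) (g x)) has_derivative (\<lambda>v. pr (f x) (frechet_derivative g (at x) v) +
       pr (frechet_derivative f (at x) v) (g x))) (at x)" if "x \<in> S" for x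
    using bounded_bilinear.FDERIV[OF assms(1) d[OF that, THEN has_derivative_frechet]] .
  have "Ck_on k S (\<lambda>x. pr (f x) (frechet_derivative g (at x) v) +
       pr (frechet_derivative f (at x) v) (g x))" for v
    using Suc.prems Ck_on_Suc_imp[OF Suc.prems(1)] Ck_on_Suc_imp[OF Suc.prems(2)]
    by (intro Ck_on_add[OF assms(2)] Suc.IH[of f] Suc.IH[of _ g]) auto
  from Ck_on_SucI[OF assms(2) * this] show ?case .
qed

lemma Ck_on_bounded_linear:
  assumes "bounded_linear L" "open S" "Ck_on k S f"
  shows "Ck_on k S (\<lambda>x. L (f x))"
  using assms(3)
proof (induction k arbitrary: f)
  case 0
  then show ?case using bounded_linear.continuous_on[OF assms(1)] by simp
next
  case (Suc k)
  then have *: "((\<lambda>x. L (f x)) has_derivative (\<lambda>v. L (frechet_derivative f (at x) v))) (at x)"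
    if "x \<in> S" for x
    using that bounded_linear.has_derivative[OF assms(1) has_derivative_frechet] by auto
  show ?case using Suc by (intro Ck_on_SucI[OF assms(2) *]) auto
qed

lemma Ck_on_sum:
  assumes "open S" "finite I" "\<And>i. i \<in> I \<Longrightarrow> Ck_on k S (f i)"
  shows "Ck_on k S (\<lambda>x. \<Sum>i\<in>I. f i x)"
  using assms(2,3)
  by (induction I rule: finite_induct) (auto intro!: Ck_on_const Ck_on_add[OF assms(1)])

text \<open>The device for point-dependent linear maps: evaluation at a varying vector becomes a
  finite sum of products in which the map is applied to fixed basis vectors only.\<close>

lemma linear_Basis_sum:
  fixes L :: "'a::euclidean_space \<Rightarrow> 'b::real_vector"
  assumes "linear L"
  shows "L v = (\<Sum>b\<in>Basis. (v \<bullet> b) *\<^sub>R L b)"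
proof -
  have "L v = L (\<Sum>b\<in>Basis. (v \<bullet> b) *\<^sub>R b)" by (simp add: euclidean_representation)
  also have "\<dots> = (\<Sum>b\<in>Basis. (v \<bullet> b) *\<^sub>R L b)"
    using assms by (simp add: linear_sum linear_cmul)
  finally show ?thesis .
qed

lemma Ck_on_inner_const: "open S \<Longrightarrow> Ck_on k S f \<Longrightarrow> Ck_on k S (\<lambda>x. f x \<bullet> (c::'b::real_inner))"
  by (rule Ck_on_bounded_linear[OF bounded_linear_inner_left])

lemma Ck_on_compose:
  fixes f :: "'a::euclidean_space \<Rightarrow> 'b::euclidean_space"
  assumes "open S" "open T" "f ` S \<subseteq> T" "Ck_on k S f" "Ck_on k T h"
  shows "Ck_on k S (\<lambda>x. h (f x))"
  using assms(4,5)
proof (induction k arbitrary: h)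
  case 0
  then show ?case using assms(3)
    by (auto intro: continuous_on_compose2)
next
  case (Suc k)
  have *: "((\<lambda>x. h (f x)) has_derivative
     (\<lambda>v. frechet_derivative h (at (f x)) (frechet_derivative f (at x) v))) (at x)" if "x \<in> S" for x
    using that Suc.prems assms(3)
    by (intro has_derivative_compose[of f _ x UNIV h, simplified] has_derivative_frechet) auto
  \<comment> \<open>The chain rule evaluates the derivative of \<open>h\<close> in a direction that
    moves with \<open>x\<close>, whereas the induction hypothesis covers fixed directions; hence the
    expansion in the basis.\<close>
  have **: "frechet_derivative h (at (f x)) (frechet_derivative f (at x) v) =
     (\<Sum>b\<in>Basis. (frechet_derivative f (at x) v \<bullet> b) *\<^sub>R frechet_derivative h (at (f x)) b)"
    if "x \<in> S" for x v
  proof -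
    have "linear (frechet_derivative h (at (f x)))"
      using that Suc.prems assms(3) by (intro linear_frechet_derivative) auto
    from linear_Basis_sum[OF this] show ?thesis.
  qed
  have "Ck_on k S (\<lambda>x. \<Sum>b\<in>Basis. (frechet_derivative f (at x) v \<bullet> b) *\<^sub>R frechet_derivative h (at (f x)) b)" for v
    using Suc.prems Ck_on_Suc_imp[OF Suc.prems(1)]
    by (intro Ck_on_sum Ck_on_bilinear[OF bounded_bilinear_scaleR] Ck_on_inner_const assms(1) Suc.IH) auto
  then show ?case
    by (intro Ck_on_SucI[OF assms(1) *]) (use Ck_on_cong[OF assms(1) **] in auto)
qed

lemma Ck_on_inverse:
  fixes f :: "'a::euclidean_space \<Rightarrow> real"
  assumes "open S" "Ck_on k S f" "\<And>x. x \<in> S \<Longrightarrow> f x \<noteq> 0"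
  shows "Ck_on k S (\<lambda>x. inverse (f x))"
  using assms(2)
proof (induction k)
  case 0
  then show ?case using assms(3) by (auto intro: continuous_on_inverse)
next
  case (Suc k)
  have *: "((\<lambda>x. inverse (f x)) has_derivative
     (\<lambda>v. - (inverse (f x) * frechet_derivative f (at x) v * inverse (f x)))) (at x)" if "x \<in> S" for x
    using that Suc.prems assms(3)
    by (intro Deriv.has_derivative_inverse has_derivative_frechet) auto
  have "Ck_on k S (\<lambda>x. - (inverse (f x) * frechet_derivative f (at x) v * inverse (f x)))" for v
    using Suc Ck_on_Suc_imp[OF Suc.prems]
    by (intro Ck_on_bilinear[OF bounded_bilinear_mult] Suc.IH assms(1)
        Ck_on_bounded_linear[OF bounded_linear_minus[OF bounded_linear_ident]]) auto
  from Ck_on_SucI[OF assms(1) * this] show ?case .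
qed

section \<open>The same closure properties for smooth maps\<close>

lemma smooth_on_cong:
  "open S \<Longrightarrow> (\<And>x. x \<in> S \<Longrightarrow> f x = g x) \<Longrightarrow> smooth_on S f \<longleftrightarrow> smooth_on S g"
  unfolding smooth_on_def using Ck_on_cong by blast

lemma smooth_on_subset: "smooth_on S f \<Longrightarrow> T \<subseteq> S \<Longrightarrow> smooth_on T f"
  unfolding smooth_on_def using Ck_on_subset by blast

lemma smooth_on_const: "smooth_on S (\<lambda>x. c)"
  by (simp add: smooth_on_def Ck_on_const)

lemma smooth_on_add:
  "open S \<Longrightarrow> smooth_on S f \<Longrightarrow> smooth_on S g \<Longrightarrow> smooth_on S (\<lambda>x. f x + g x)"
  by (simp add: smooth_on_def Ck_on_add)

lemma smooth_on_bounded_linear: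
  "bounded_linear L \<Longrightarrow> open S \<Longrightarrow> smooth_on S f \<Longrightarrow> smooth_on S (\<lambda>x. L (f x))"
  by (simp add: smooth_on_def Ck_on_bounded_linear)

lemma smooth_on_minus: "open S \<Longrightarrow> smooth_on S f \<Longrightarrow> smooth_on S (\<lambda>x. - f x)"
  by (rule smooth_on_bounded_linear[OF bounded_linear_minus[OF bounded_linear_ident]])

lemma smooth_on_diff:
  "open S \<Longrightarrow> smooth_on S f \<Longrightarrow> smooth_on S g \<Longrightarrow> smooth_on S (\<lambda>x. f x - g x)"
  using smooth_on_add[of S f "\<lambda>x. - g x"] smooth_on_minus by auto

lemma smooth_on_mult:
  "open S \<Longrightarrow> smooth_on S f \<Longrightarrow> smooth_on S g \<Longrightarrow> smooth_on S (\<lambda>x. f x * g x :: real)"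
  by (simp add: smooth_on_def Ck_on_bilinear[OF bounded_bilinear_mult])

lemma smooth_on_scaleR:
  "open S \<Longrightarrow> smooth_on S f \<Longrightarrow> smooth_on S g \<Longrightarrow> smooth_on S (\<lambda>x. f x *\<^sub>R g x)"
  by (simp add: smooth_on_def Ck_on_bilinear[OF bounded_bilinear_scaleR])

lemma smooth_on_inner_const: "open S \<Longrightarrow> smooth_on S f \<Longrightarrow> smooth_on S (\<lambda>x. f x \<bullet> (c::'b::real_inner))"
  by (simp add: smooth_on_def Ck_on_inner_const)

lemma smooth_on_sum:
  "open S \<Longrightarrow> finite I \<Longrightarrow> (\<And>i. i \<in> I \<Longrightarrow> smooth_on S (f i)) \<Longrightarrow> smooth_on S (\<lambda>x. \<Sum>i\<in>I. f i x)"
  by (simp add: smooth_on_def Ck_on_sum)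

lemma smooth_on_compose:
  fixes f :: "'a::euclidean_space \<Rightarrow> 'b::euclidean_space"
  shows "open S \<Longrightarrow> open T \<Longrightarrow> f ` S \<subseteq> T \<Longrightarrow> smooth_on S f \<Longrightarrow> smooth_on T h \<Longrightarrow>
    smooth_on S (\<lambda>x. h (f x))"
  by (simp add: smooth_on_def Ck_on_compose)

lemma smooth_on_divide:
  fixes f :: "'a::euclidean_space \<Rightarrow> real"
  shows "open S \<Longrightarrow> smooth_on S f \<Longrightarrow> smooth_on S g \<Longrightarrow> (\<And>x. x \<in> S \<Longrightarrow> g x \<noteq> 0) \<Longrightarrow>
    smooth_on S (\<lambda>x. f x / g x)"
  by (simp add: smooth_on_def divide_inverse Ck_on_bilinear[OF bounded_bilinear_mult] Ck_on_inverse)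

lemma smooth_on_continuous: "smooth_on S f \<Longrightarrow> continuous_on S f"
  unfolding smooth_on_def by (metis Ck_on.simps(1))

lemma smooth_on_differentiable: "smooth_on S f \<Longrightarrow> x \<in> S \<Longrightarrow> f differentiable (at x)"
  unfolding smooth_on_def by (metis Ck_on.simps(2))

lemma smooth_on_has_derivative:
  "smooth_on S f \<Longrightarrow> x \<in> S \<Longrightarrow> (f has_derivative frechet_derivative f (at x)) (at x)"
  by (simp add: has_derivative_frechet smooth_on_differentiable)

lemma smooth_on_frechet: "smooth_on S f \<Longrightarrow> smooth_on S (\<lambda>x. frechet_derivative f (at x) v)"
  unfolding smooth_on_def by (metis Ck_on.simps(2))

lemma smooth_on_linear_eval:
  fixes \<psi> :: "'a::euclidean_space \<Rightarrow> 'b::euclidean_space"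
  assumes "open S" "\<And>x. x \<in> S \<Longrightarrow> linear (b x)" "\<And>v. smooth_on S (\<lambda>x. b x v)" "smooth_on S \<psi>"
  shows "smooth_on S (\<lambda>x. b x (\<psi> x))"
proof -
  have "smooth_on S (\<lambda>x. \<Sum>i\<in>Basis. (\<psi> x \<bullet> i) *\<^sub>R b x i)"
    using assms by (intro smooth_on_sum smooth_on_scaleR smooth_on_inner_const) auto
  then show ?thesis
    using smooth_on_cong[OF assms(1) linear_Basis_sum[OF assms(2)], of "\<lambda>x. x" \<psi>] by blast
qed

text \<open>Leibniz rule for the pairing of \<open>b\<close> with \<psi>. Differentiability for each
  fixed vector suffices, since linearity reduces everything to basis vectors; one half of the
  resulting sum is then recognised as the derivative with \<psi> frozen at \<open>x\<close>.\<close>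

lemma has_derivative_linear_eval:
  fixes \<psi> :: "'a::real_normed_vector \<Rightarrow> 'b::euclidean_space" and b :: "'a \<Rightarrow> 'b \<Rightarrow> 'c::real_normed_vector"
  assumes U: "open U" "x \<in> U" and lin: "\<And>y. y \<in> U \<Longrightarrow> linear (b y)"
    and diff: "\<And>v. (\<lambda>y. b y v) differentiable (at x)"
    and psi: "(\<psi> has_derivative \<psi>') (at x)"
  shows "((\<lambda>y. b y (\<psi> y)) has_derivative
     (\<lambda>h. frechet_derivative (\<lambda>y. b y (\<psi> x)) (at x) h + b x (\<psi>' h))) (at x)"
proof -
  let ?B = "\<lambda>v. frechet_derivative (\<lambda>y. b y v) (at x)"
  have B: "((\<lambda>y. b y v) has_derivative ?B v) (at x)" for v
    using diff by (simp add: has_derivative_frechet)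
  have *: "((\<lambda>y. \<Sum>i\<in>Basis. (\<psi> y \<bullet> i) *\<^sub>R b y i) has_derivative
     (\<lambda>h. \<Sum>i\<in>Basis. (\<psi> x \<bullet> i) *\<^sub>R ?B i h + (\<psi>' h \<bullet> i) *\<^sub>R b x i)) (at x)"
    by (intro has_derivative_sum has_derivative_scaleR has_derivative_inner_left psi B)
  have "((\<lambda>y. \<Sum>i\<in>Basis. (\<psi> x \<bullet> i) *\<^sub>R b y i) has_derivative
     (\<lambda>h. \<Sum>i\<in>Basis. (\<psi> x \<bullet> i) *\<^sub>R ?B i h)) (at x)"
    by (intro has_derivative_sum has_derivative_scaleR_right B)
  then have "((\<lambda>y. b y (\<psi> x)) has_derivative (\<lambda>h. \<Sum>i\<in>Basis. (\<psi> x \<bullet> i) *\<^sub>R ?B i h)) (at x)"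
    by (rule has_derivative_transform_within_open[OF _ U]) (rule linear_Basis_sum[OF lin, symmetric])
  then have "?B (\<psi> x) h = (\<Sum>i\<in>Basis. (\<psi> x \<bullet> i) *\<^sub>R ?B i h)" for h
    by (simp add: frechet_derivative_eqI)
  then have "(\<lambda>h. \<Sum>i\<in>Basis. (\<psi> x \<bullet> i) *\<^sub>R ?B i h + (\<psi>' h \<bullet> i) *\<^sub>R b x i) =
     (\<lambda>h. ?B (\<psi> x) h + b x (\<psi>' h))"
    unfolding linear_Basis_sum[OF lin[OF U(2)], of "\<psi>' _"] by (simp add: sum.distrib)
  from *[unfolded this] show ?thesis
    by (rule has_derivative_transform_within_open[OF _ U]) (rule linear_Basis_sum[OF lin, symmetric])
qed

text \<open>By the mean value theorem in direction \<open>u\<close>, the mixed difference over the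
  parallelogram with sides t u and t v is t times a difference of two values of the u-derivative.
  Differentiability of that derivative at \<open>x\<close> turns this into t^2 (A v); the two error
  terms are measured by the distances of the two points from \<open>x\<close>, whose sum is at most
  t (2|u| + |v|).\<close>

lemma second_difference_quotient:
  fixes f :: "'a::real_normed_vector \<Rightarrow> real"
  assumes S: "open S" "x \<in> S" and f: "\<And>y. y \<in> S \<Longrightarrow> f differentiable (at y)"
    and A: "((\<lambda>y. frechet_derivative f (at y) u) has_derivative A) (at x)" and "e > 0"
  shows "\<exists>d>0. \<forall>t. 0 < t \<and> t < d \<longrightarrow>
     \<bar>(f (x + t *\<^sub>R u + t *\<^sub>R v) - f (x + t *\<^sub>R u) - f (x + t *\<^sub>R v) + f x) / t\<^sup>2 - A v\<bar> \<le> e * (2 * norm u + norm v)"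
proof -
  let ?D = "\<lambda>y. frechet_derivative f (at y) u"
  have linA: "linear A" using A has_derivative_linear by blast
  obtain d1 where d1: "d1 > 0" "ball x d1 \<subseteq> S" using S openE by blast
  obtain d2 where d2: "d2 > 0" "\<And>y. norm (y - x) < d2 \<Longrightarrow>
      norm (?D y - ?D x - A (y - x)) \<le> e * norm (y - x)"
    using A[unfolded has_derivative_at_alt] \<open>e > 0\<close> by metis
  \<comment> \<open>For t < d the whole parallelogram stays within distance \<open>min d1 d2\<close>
    of \<open>x\<close>; the summand 1 keeps the denominator positive when \<open>u\<close> and
    \<open>v\<close> vanish.\<close>
  define d where "d = min d1 d2 / (norm u + norm v + 1)"
  have pos: "norm u + norm v + 1 > 0" by (simp add: add_nonneg_pos)
  have "d > 0" using d1 d2 pos by (simp add: d_def)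
  moreover have "\<bar>(f (x + t *\<^sub>R u + t *\<^sub>R v) - f (x + t *\<^sub>R u) - f (x + t *\<^sub>R v) + f x) / t\<^sup>2 - A v\<bar>
      \<le> e * (2 * norm u + norm v)" if t: "0 < t" "t < d" for t
  proof -
    have small: "norm (s *\<^sub>R u + r *\<^sub>R v) < min d1 d2" if "0 \<le> s" "s \<le> t" "0 \<le> r" "r \<le> t" for s r
    proof -
      have "norm (s *\<^sub>R u + r *\<^sub>R v) \<le> s * norm u + r * norm v"
        using that norm_triangle_ineq[of "s *\<^sub>R u" "r *\<^sub>R v"] by simp
      also have "\<dots> \<le> t * norm u + t * norm v" using that by (intro add_mono mult_right_mono) auto
      also have "\<dots> \<le> t * (norm u + norm v + 1)" using t by (simp add: algebra_simps)
      also have "\<dots> < d * (norm u + norm v + 1)" using t pos by simp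
      also have "\<dots> = min d1 d2" using pos by (simp add: d_def)
      finally show ?thesis .
    qed
    have inS: "x + (s *\<^sub>R u + r *\<^sub>R v) \<in> S" if "0 \<le> s" "s \<le> t" "0 \<le> r" "r \<le> t" for s r
    proof (rule subsetD[OF d1(2)])
      have "dist x (x + w) = norm w" for w by (simp add: dist_norm)
      then show "x + (s *\<^sub>R u + r *\<^sub>R v) \<in> ball x d1" using small[OF that] by simp
    qed
    define g where "g = (\<lambda>s. f (x + (s *\<^sub>R u + t *\<^sub>R v)) - f (x + (s *\<^sub>R u + 0 *\<^sub>R v)))"
    have der: "((\<lambda>s. f (x + (s *\<^sub>R u + r *\<^sub>R v))) has_derivative
        (\<lambda>h. h * ?D (x + (s *\<^sub>R u + r *\<^sub>R v)))) (at s)" if "0 \<le> s" "s \<le> t" "0 \<le> r" "r \<le> t" for s r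
    proof -
      have fd: "f differentiable at (x + (s *\<^sub>R u + r *\<^sub>R v))" using f inS[OF that] by blast
      have "((\<lambda>s. f (x + (s *\<^sub>R u + r *\<^sub>R v))) has_derivative
        (\<lambda>h. frechet_derivative f (at (x + (s *\<^sub>R u + r *\<^sub>R v))) (h *\<^sub>R u))) (at s)"
        by (rule has_derivative_compose[of "\<lambda>s. x + (s *\<^sub>R u + r *\<^sub>R v)" _ s UNIV f, simplified])
          (auto intro!: derivative_eq_intros has_derivative_frechet fd)
      moreover have "frechet_derivative f (at (x + (s *\<^sub>R u + r *\<^sub>R v))) (h *\<^sub>R u) =
          h * ?D (x + (s *\<^sub>R u + r *\<^sub>R v))" for h
        using linear_frechet_derivative[OF fd] by (simp add: linear_cmul)
      ultimately show ?thesis by simp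
    qed
    have "\<exists>s. 0 < s \<and> s < t \<and> g t - g 0 = (t - 0) * (?D (x + (s *\<^sub>R u + t *\<^sub>R v)) - ?D (x + (s *\<^sub>R u + 0 *\<^sub>R v)))"
    proof (rule MVT2[OF t(1)])
      fix s assume s: "0 \<le> s" "s \<le> t"
      have "(g has_derivative (\<lambda>h. h * ?D (x + (s *\<^sub>R u + t *\<^sub>R v)) - h * ?D (x + (s *\<^sub>R u + 0 *\<^sub>R v)))) (at s)"
        unfolding g_def using s t by (intro has_derivative_diff der) auto
      then show "(g has_real_derivative (?D (x + (s *\<^sub>R u + t *\<^sub>R v)) - ?D (x + (s *\<^sub>R u + 0 *\<^sub>R v)))) (at s)"
        unfolding has_field_derivative_def by (rule has_derivative_eq_rhs) (simp add: fun_eq_iff algebra_simps)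
    qed
    then obtain s where s: "0 < s" "s < t" and
      gt: "g t - g 0 = t * (?D (x + (s *\<^sub>R u + t *\<^sub>R v)) - ?D (x + (s *\<^sub>R u + 0 *\<^sub>R v)))" by auto
    let ?y1 = "s *\<^sub>R u + t *\<^sub>R v" and ?y2 = "s *\<^sub>R u + 0 *\<^sub>R v"
    have "norm ?y1 \<le> t * norm u + t * norm v"
      using norm_triangle_ineq[of "s *\<^sub>R u" "t *\<^sub>R v"] s mult_right_mono[of s t "norm u"] by simp
    then have n1: "e * norm ?y1 \<le> e * (t * norm u + t * norm v)" using \<open>e > 0\<close> by simp
    have n2: "e * norm ?y2 \<le> e * (t * norm u)" using \<open>e > 0\<close> s mult_right_mono[of s t "norm u"] by simp
    have e1: "\<bar>?D (x + ?y1) - ?D x - A ?y1\<bar> \<le> e * norm ?y1"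
      using d2(2)[of "x + ?y1"] small[of s t] s t by simp
    have e2: "\<bar>?D (x + ?y2) - ?D x - A ?y2\<bar> \<le> e * norm ?y2"
      using d2(2)[of "x + ?y2"] small[of s 0] s t by simp
    have A12: "A ?y1 - A ?y2 = t * A v" using linA by (simp add: linear_add linear_cmul)
    have "\<bar>?D (x + ?y1) - ?D (x + ?y2) - t * A v\<bar> \<le> t * (e * (2 * norm u + norm v))"
      using e1 e2 A12 n1 n2 by (simp add: algebra_simps)
    then have "t * \<bar>?D (x + ?y1) - ?D (x + ?y2) - t * A v\<bar> \<le> t * (t * (e * (2 * norm u + norm v)))"
      using t by simp
    moreover have "t * \<bar>?D (x + ?y1) - ?D (x + ?y2) - t * A v\<bar> = \<bar>g t - g 0 - t\<^sup>2 * A v\<bar>"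
    proof -
      have "g t - g 0 - t\<^sup>2 * A v = t * (?D (x + ?y1) - ?D (x + ?y2) - t * A v)"
        unfolding gt by (simp add: algebra_simps power2_eq_square)
      then show ?thesis using t by (simp add: abs_mult)
    qed
    ultimately have "\<bar>g t - g 0 - t\<^sup>2 * A v\<bar> / t\<^sup>2 \<le> e * (2 * norm u + norm v)"
      using t by (simp add: field_simps power2_eq_square)
    moreover have "\<bar>g t - g 0 - t\<^sup>2 * A v\<bar> / t\<^sup>2 = \<bar>(g t - g 0) / t\<^sup>2 - A v\<bar>"
    proof -
      have "(g t - g 0) / t\<^sup>2 - A v = (g t - g 0 - t\<^sup>2 * A v) / t\<^sup>2" using t by (simp add: field_simps)
      then show ?thesis using t by (simp add: abs_divide)
    qed
    moreover have "g t - g 0 = f (x + t *\<^sub>R u + t *\<^sub>R v) - f (x + t *\<^sub>R u) - f (x + t *\<^sub>R v) + f x"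
      by (simp add: g_def add.assoc)
    ultimately show ?thesis by simp
  qed
  ultimately show ?thesis by blast
qed

text \<open>The mixed difference is symmetric in \<open>u\<close> and \<open>v\<close>, so
  \<open>A v\<close> and \<open>B u\<close> are limits of one and the same quotient.\<close>

lemma symmetric_second_derivative_real:
  fixes f :: "'a::real_normed_vector \<Rightarrow> real"
  assumes S: "open S" "x \<in> S" and f: "\<And>y. y \<in> S \<Longrightarrow> f differentiable (at y)"
    and A: "((\<lambda>y. frechet_derivative f (at y) u) has_derivative A) (at x)"
    and B: "((\<lambda>y. frechet_derivative f (at y) v) has_derivative B) (at x)"
  shows "A v = B u"
proof (rule ccontr)
  assume "A v \<noteq> B u"
  \<comment> \<open>The two error bounds add up to e (3|u| + 3|v|), which is at most e K, and
    \<open>e\<close> is chosen to make e K half of the supposed gap.\<close>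
  define K where "K = 3 * norm u + 3 * norm v + 1"
  have K: "K > 0" by (simp add: K_def add_nonneg_pos)
  define e where "e = \<bar>A v - B u\<bar> / (2 * K)"
  have e: "e > 0" using \<open>A v \<noteq> B u\<close> K by (simp add: e_def)
  obtain d1 where d1: "d1 > 0" "\<And>t. 0 < t \<and> t < d1 \<Longrightarrow>
     \<bar>(f (x + t *\<^sub>R u + t *\<^sub>R v) - f (x + t *\<^sub>R u) - f (x + t *\<^sub>R v) + f x) / t\<^sup>2 - A v\<bar> \<le> e * (2 * norm u + norm v)"
    using second_difference_quotient[OF S f A e] by blast
  obtain d2 where d2: "d2 > 0" "\<And>t. 0 < t \<and> t < d2 \<Longrightarrow>
     \<bar>(f (x + t *\<^sub>R v + t *\<^sub>R u) - f (x + t *\<^sub>R v) - f (x + t *\<^sub>R u) + f x) / t\<^sup>2 - B u\<bar> \<le> e * (2 * norm v + norm u)"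
    using second_difference_quotient[OF S f B e] by blast
  define t where "t = min d1 d2 / 2"
  have t: "0 < t" "t < d1" "t < d2" using d1 d2 by (auto simp: t_def)
  have eq: "f (x + t *\<^sub>R v + t *\<^sub>R u) - f (x + t *\<^sub>R v) - f (x + t *\<^sub>R u) + f x
     = f (x + t *\<^sub>R u + t *\<^sub>R v) - f (x + t *\<^sub>R u) - f (x + t *\<^sub>R v) + f x"
    by (simp add: algebra_simps)
  have "\<bar>A v - B u\<bar> \<le> e * (2 * norm u + norm v) + e * (2 * norm v + norm u)"
    using d1(2)[of t] d2(2)[of t] t unfolding eq by linarith
  also have "\<dots> \<le> e * K" using e by (simp add: K_def algebra_simps)
  also have "\<dots> < \<bar>A v - B u\<bar>" using \<open>A v \<noteq> B u\<close> K by (simp add: e_def)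
  finally show False by simp
qed

lemma symmetric_second_derivative:
  fixes f :: "'a::euclidean_space \<Rightarrow> 'b::euclidean_space"
  assumes S: "open S" "x \<in> S" and f: "smooth_on S f"
  shows "frechet_derivative (\<lambda>y. frechet_derivative f (at y) u) (at x) v =
         frechet_derivative (\<lambda>y. frechet_derivative f (at y) v) (at x) u"
proof (rule euclidean_eqI)
  fix b :: 'b
  let ?f = "\<lambda>y. f y \<bullet> b"
  have d: "frechet_derivative ?f (at y) w = frechet_derivative f (at y) w \<bullet> b" if "y \<in> S" for y w
    using has_derivative_inner_left[OF smooth_on_has_derivative[OF f that], of b]
    by (simp add: frechet_derivative_eqI)
  have D: "((\<lambda>y. frechet_derivative ?f (at y) w) has_derivative
       (\<lambda>h. frechet_derivative (\<lambda>y. frechet_derivative f (at y) w) (at x) h \<bullet> b)) (at x)" for w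
    using has_derivative_inner_left[OF smooth_on_has_derivative[OF smooth_on_frechet[OF f] S(2)], of w b]
    by (rule has_derivative_transform_within_open[OF _ S]) (simp add: d)
  show "frechet_derivative (\<lambda>y. frechet_derivative f (at y) u) (at x) v \<bullet> b =
         frechet_derivative (\<lambda>y. frechet_derivative f (at y) v) (at x) u \<bullet> b"
    using f by (intro symmetric_second_derivative_real[OF S _ D D]
      smooth_on_differentiable[OF smooth_on_inner_const[OF S(1)]])
qed

section \<open>Exterior derivatives in coordinates\<close>

lemma has_derivative_bilinear_eval:
  fixes \<psi> :: "'a::real_normed_vector \<Rightarrow> 'b::euclidean_space" and \<xi> :: "'a \<Rightarrow> 'c::euclidean_space"
    and b :: "'a \<Rightarrow> 'b \<Rightarrow> 'c \<Rightarrow> 'd::real_normed_vector"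
  assumes U: "open U" "x \<in> U" and bil: "\<And>y. y \<in> U \<Longrightarrow> bilinear (b y)"
    and diff: "\<And>v w. (\<lambda>y. b y v w) differentiable (at x)"
    and psi: "(\<psi> has_derivative \<psi>') (at x)" and chi: "(\<xi> has_derivative \<xi>') (at x)"
  shows "((\<lambda>y. b y (\<psi> y) (\<xi> y)) has_derivative
     (\<lambda>h. frechet_derivative (\<lambda>y. b y (\<psi> x) (\<xi> x)) (at x) h + b x (\<psi>' h) (\<xi> x) + b x (\<psi> x) (\<xi>' h))) (at x)"
proof -
  have 1: "((\<lambda>y. b y (\<psi> y) w) has_derivative
     (\<lambda>h. frechet_derivative (\<lambda>y. b y (\<psi> x) w) (at x) h + b x (\<psi>' h) w)) (at x)" for w
    using bil diff by (intro has_derivative_linear_eval[OF U _ _ psi]) (auto simp: bilinear_def)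
  then have "((\<lambda>y. b y (\<psi> y) (\<xi> y)) has_derivative
     (\<lambda>h. frechet_derivative (\<lambda>y. b y (\<psi> y) (\<xi> x)) (at x) h + b x (\<psi> x) (\<xi>' h))) (at x)"
    using bil by (intro has_derivative_linear_eval[OF U _ _ chi]) (auto simp: bilinear_def differentiable_def)
  then show ?thesis
    by (simp add: frechet_derivative_eqI[OF 1])
qed

text \<open>The bracket of \<open>d2\<close> freed from charts, so that its behaviour under smooth
  maps can be studied in Euclidean spaces.\<close>

definition ext_deriv2 :: "('e::real_normed_vector \<Rightarrow> 'e \<Rightarrow> 'e \<Rightarrow> real) \<Rightarrow> 'e \<Rightarrow> 'e \<Rightarrow> 'e \<Rightarrow> 'e \<Rightarrow> real" where
  "ext_deriv2 b x u v w = frechet_derivative (\<lambda>y. b y v w) (at x) u -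
     frechet_derivative (\<lambda>y. b y u w) (at x) v + frechet_derivative (\<lambda>y. b y u v) (at x) w"

lemma ext_deriv2_cong_open:
  assumes "open S" "x \<in> S" "\<And>y v w. y \<in> S \<Longrightarrow> b y v w = b' y v w"
  shows "ext_deriv2 b x = ext_deriv2 b' x"
proof (intro ext)
  fix u v w
  show "ext_deriv2 b x u v w = ext_deriv2 b' x u v w"
    unfolding ext_deriv2_def
    using frechet_derivative_cong_open[OF assms(1,2), of "\<lambda>y. b y v w" "\<lambda>y. b' y v w"]
      frechet_derivative_cong_open[OF assms(1,2), of "\<lambda>y. b y u w" "\<lambda>y. b' y u w"]
      frechet_derivative_cong_open[OF assms(1,2), of "\<lambda>y. b y u v" "\<lambda>y. b' y u v"] assms(3)
    by simp
qed

text \<open>The terms with second derivatives of \<open>\<phi>\<close> cancel by symmetry.\<close>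

lemma ext_deriv2_pullback:
  fixes \<phi> :: "'a::euclidean_space \<Rightarrow> 'b::euclidean_space"
  assumes S: "open S" "x \<in> S" "smooth_on S \<phi>" and T: "\<phi> ` S \<subseteq> T"
    and bil: "\<And>y. y \<in> T \<Longrightarrow> bilinear (b y)" and alt: "\<And>y v w. y \<in> T \<Longrightarrow> b y v w = - b y w v"
    and diff: "\<And>v w. (\<lambda>y. b y v w) differentiable (at (\<phi> x))"
  shows "ext_deriv2 (\<lambda>y v w. b (\<phi> y) (frechet_derivative \<phi> (at y) v) (frechet_derivative \<phi> (at y) w)) x u v w =
     ext_deriv2 b (\<phi> x) (frechet_derivative \<phi> (at x) u) (frechet_derivative \<phi> (at x) v)
       (frechet_derivative \<phi> (at x) w)"
proof -
  let ?D = "\<lambda>y v. frechet_derivative \<phi> (at y) v"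
  let ?DD = "\<lambda>v u. frechet_derivative (\<lambda>y. ?D y v) (at x) u"
  have phi: "(\<phi> has_derivative ?D x) (at x)" using S by (simp add: smooth_on_has_derivative)
  have DD: "((\<lambda>y. ?D y v) has_derivative ?DD v) (at x)" for v
    by (rule smooth_on_has_derivative[OF smooth_on_frechet[OF S(3)] S(2)])
  have chain: "((\<lambda>y. b (\<phi> y) v w) has_derivative
      (\<lambda>h. frechet_derivative (\<lambda>y. b y v w) (at (\<phi> x)) (?D x h))) (at x)" for v w
    using has_derivative_compose[OF phi has_derivative_frechet[OF diff]] .
  have *: "frechet_derivative (\<lambda>y. b (\<phi> y) (?D y v) (?D y w)) (at x) h =
     frechet_derivative (\<lambda>y. b y (?D x v) (?D x w)) (at (\<phi> x)) (?D x h) +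
       b (\<phi> x) (?DD v h) (?D x w) + b (\<phi> x) (?D x v) (?DD w h)" for v w h
  proof -
    have "((\<lambda>y. b (\<phi> y) (?D y v) (?D y w)) has_derivative
     (\<lambda>h. frechet_derivative (\<lambda>y. b (\<phi> y) (?D x v) (?D x w)) (at x) h +
       b (\<phi> x) (?DD v h) (?D x w) + b (\<phi> x) (?D x v) (?DD w h))) (at x)"
      using T bil
      by (intro has_derivative_bilinear_eval[OF S(1,2) _ differentiableI[OF chain] DD DD]) auto
    then show ?thesis
      by (simp add: frechet_derivative_eqI frechet_derivative_eqI[OF chain])
  qed
  have "\<phi> x \<in> T" using S T by auto
  then show ?thesis
    using alt[of "\<phi> x" "?DD u w"] alt[of "\<phi> x" "?DD u v"] alt[of "\<phi> x" "?DD v w"]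
    by (simp add: ext_deriv2_def * symmetric_second_derivative[OF S, of v u]
        symmetric_second_derivative[OF S, of w u] symmetric_second_derivative[OF S, of w v])
qed

lemma smooth_on_bilinear_eval:
  fixes \<psi> :: "'a::euclidean_space \<Rightarrow> 'b::euclidean_space" and \<xi> :: "'a \<Rightarrow> 'c::euclidean_space"
  assumes S: "open S" "\<And>x. x \<in> S \<Longrightarrow> bilinear (b x)" "\<And>v w. smooth_on S (\<lambda>x. b x v w)"
    "smooth_on S \<psi>" "smooth_on S \<xi>"
  shows "smooth_on S (\<lambda>x. b x (\<psi> x) (\<xi> x))"
proof (rule smooth_on_linear_eval[OF S(1) _ _ S(5)])
  show "linear (b x (\<psi> x))" if "x \<in> S" for x using S(2)[OF that] by (simp add: bilinear_def)
  show "smooth_on S (\<lambda>x. b x (\<psi> x) w)" for w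
    using S(2,3) by (intro smooth_on_linear_eval[OF S(1) _ _ S(4), of "\<lambda>x v. b x v w"]) (auto simp: bilinear_def)
qed

section \<open>Charts, tangent vectors and forms\<close>

lemma charts_atD: "c \<in> charts_at A p \<Longrightarrow> c \<in> A \<and> p \<in> cdom c"
  by (simp add: charts_at_def)

lemma charts_at_points: "c \<in> charts_at A p \<Longrightarrow> p \<in> points A"
  by (auto simp: charts_at_def points_def)

lemma chart_at_in: "p \<in> points A \<Longrightarrow> chart_at A p \<in> charts_at A p"
  unfolding chart_at_def by (rule someI_ex) (auto simp: charts_at_def points_def)

lemma cinv_cmap: "smooth_manifold A \<Longrightarrow> c \<in> A \<Longrightarrow> p \<in> cdom c \<Longrightarrow> cinv c (cmap c p) = p"
  unfolding smooth_manifold_def homeomorphism_def by blast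

lemma cmap_cinv: "smooth_manifold A \<Longrightarrow> c \<in> A \<Longrightarrow> x \<in> cimg c \<Longrightarrow> cmap c (cinv c x) = x"
  unfolding smooth_manifold_def homeomorphism_def by blast

lemma cinv_in: "smooth_manifold A \<Longrightarrow> c \<in> A \<Longrightarrow> x \<in> cimg c \<Longrightarrow> cinv c x \<in> cdom c"
  unfolding smooth_manifold_def homeomorphism_def by blast

lemma open_cimg: "smooth_manifold A \<Longrightarrow> c \<in> A \<Longrightarrow> open (cimg c)"
  unfolding smooth_manifold_def by blast

lemma cinv_charts_at: "smooth_manifold A \<Longrightarrow> c \<in> A \<Longrightarrow> x \<in> cimg c \<Longrightarrow> c \<in> charts_at A (cinv c x)"
  by (simp add: charts_at_def cinv_in)

lemma open_cmap_image:
  assumes "smooth_manifold A" "c \<in> A" "openin (top_of_set (points A)) W"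
  shows "open (cmap c ` (cdom c \<inter> W))"
proof -
  have h: "homeomorphism (cdom c) (cimg c) (cmap c) (cinv c)" "open (cimg c)"
    using assms unfolding smooth_manifold_def by blast+
  obtain T where T: "open T" "W = points A \<inter> T" using assms(3) by (auto simp: openin_open)
  have "cdom c \<subseteq> points A" using assms(2) by (auto simp: points_def)
  then have eq: "cdom c \<inter> W = cdom c \<inter> T" using T by auto
  have "openin (top_of_set (cdom c)) (cdom c \<inter> W)" unfolding eq using T(1) by (auto simp: openin_open)
  then have "openin (top_of_set (cimg c)) (cmap c ` (cdom c \<inter> W))"
    using homeomorphism_imp_open_map[OF h(1)] by blast
  then show ?thesis using h(2) openin_open_trans by blast
qed

lemma open_overlap:
  assumes "smooth_manifold A" "c \<in> A" "d \<in> A"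
  shows "open (cmap c ` (cdom c \<inter> cdom d))"
  using assms open_cmap_image[OF assms(1,2)] unfolding smooth_manifold_def by blast

lemma smooth_transition:
  "smooth_manifold A \<Longrightarrow> c \<in> A \<Longrightarrow> d \<in> A \<Longrightarrow> smooth_on (cmap c ` (cdom c \<inter> cdom d)) (cmap d \<circ> cinv c)"
  unfolding smooth_manifold_def by blast

lemma has_derivative_transition:
  assumes "smooth_manifold A" "c \<in> charts_at A p" "d \<in> charts_at A p"
  shows "((cmap d \<circ> cinv c) has_derivative coord_change c d p) (at (cmap c p))"
  using assms smooth_on_has_derivative[OF smooth_transition[OF assms(1)], of c d "cmap c p"]
  by (auto simp: coord_change_def charts_at_def)

lemma linear_coord_change:
  assumes "smooth_manifold A" "c \<in> charts_at A p" "d \<in> charts_at A p"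
  shows "linear (coord_change c d p)"
  using has_derivative_linear[OF has_derivative_transition[OF assms]] .

lemma coord_change_self:
  assumes "smooth_manifold A" "c \<in> charts_at A p"
  shows "coord_change c c p = (\<lambda>v. v)"
proof -
  have c: "c \<in> A" "cmap c p \<in> cimg c" using assms by (auto simp: charts_at_def)
  have "frechet_derivative (cmap c \<circ> cinv c) (at (cmap c p)) = frechet_derivative (\<lambda>x. x) (at (cmap c p))"
    by (rule frechet_derivative_cong_open[OF open_cimg[OF assms(1) c(1)] c(2)])
      (simp add: cmap_cinv[OF assms(1) c(1)])
  then show ?thesis by (simp add: coord_change_def)
qed

lemma coord_change_comp:
  assumes A: "smooth_manifold A" and c: "c \<in> charts_at A p" and d: "d \<in> charts_at A p" and e: "e \<in> charts_at A p"
  shows "coord_change d e p (coord_change c d p v) = coord_change c e p v"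
proof -
  have A': "c \<in> A" "d \<in> A" "e \<in> A" "p \<in> cdom c" "p \<in> cdom d" "p \<in> cdom e"
    using c d e by (auto simp: charts_at_def)
  have "((cmap e \<circ> cinv d) has_derivative coord_change d e p) (at ((cmap d \<circ> cinv c) (cmap c p)))"
    using has_derivative_transition[OF A d e] by (simp add: cinv_cmap[OF A A'(1,4)])
  from diff_chain_at[OF has_derivative_transition[OF A c d] this]
  have "((cmap e \<circ> cinv d \<circ> (cmap d \<circ> cinv c)) has_derivative coord_change d e p \<circ> coord_change c d p)
      (at (cmap c p))" .
  moreover have "frechet_derivative (cmap e \<circ> cinv d \<circ> (cmap d \<circ> cinv c)) (at (cmap c p)) = coord_change c e p"
    unfolding coord_change_def
    by (rule frechet_derivative_cong_open[OF open_overlap[OF A A'(1,2)]])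
      (use A' in \<open>auto simp: cinv_cmap[OF A]\<close>)
  ultimately show ?thesis by (metis comp_apply frechet_derivative_eqI)
qed

section \<open>Tangent vectors and their coordinates\<close>

lemma tangent_space_change:
  "X \<in> tangent_space A p \<Longrightarrow> c \<in> charts_at A p \<Longrightarrow> d \<in> charts_at A p \<Longrightarrow> X d = coord_change c d p (X c)"
  unfolding tangent_space_def by blast

lemma tangent_space_zero: "X \<in> tangent_space A p \<Longrightarrow> c \<notin> charts_at A p \<Longrightarrow> X c = 0"
  unfolding tangent_space_def by blast

lemma tvec_apply: "smooth_manifold A \<Longrightarrow> c \<in> charts_at A p \<Longrightarrow> tvec A c p w c = w"
  by (simp add: tvec_def coord_change_self)

lemma tvec_in:
  assumes "smooth_manifold A" "c \<in> charts_at A p"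
  shows "tvec A c p w \<in> tangent_space A p"
  unfolding tangent_space_def tvec_def using coord_change_comp[OF assms] by auto

lemma tvec_of_tangent: "X \<in> tangent_space A p \<Longrightarrow> c \<in> charts_at A p \<Longrightarrow> tvec A c p (X c) = X"
  by (rule ext) (simp add: tvec_def tangent_space_change[symmetric] tangent_space_zero)

lemma tangent_eqI:
  "X \<in> tangent_space A p \<Longrightarrow> Y \<in> tangent_space A p \<Longrightarrow> c \<in> charts_at A p \<Longrightarrow> X c = Y c \<Longrightarrow> X = Y"
  by (metis tvec_of_tangent)

lemma tvec_change:
  assumes "smooth_manifold A" "c \<in> charts_at A p" "d \<in> charts_at A p"
  shows "tvec A d p (coord_change c d p v) = tvec A c p v"
  unfolding tvec_def using coord_change_comp[OF assms] by auto

lemma tvec_add: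
  assumes "smooth_manifold A" "c \<in> charts_at A p"
  shows "tvec A c p (v + w) = tadd (tvec A c p v) (tvec A c p w)"
  using linear_coord_change[OF assms] by (auto simp: tvec_def tadd_def linear_add)

lemma tvec_scale:
  assumes "smooth_manifold A" "c \<in> charts_at A p"
  shows "tvec A c p (r *\<^sub>R v) = tscale r (tvec A c p v)"
  using linear_coord_change[OF assms] by (auto simp: tvec_def tscale_def linear_cmul)

lemma tvec_zero: "smooth_manifold A \<Longrightarrow> c \<in> charts_at A p \<Longrightarrow> tvec A c p 0 = tzero"
  using linear_coord_change[of A c p] by (auto simp: tvec_def tzero_def linear_0)

lemma tvec_eq_tzero: "smooth_manifold A \<Longrightarrow> c \<in> charts_at A p \<Longrightarrow> tvec A c p v = tzero \<longleftrightarrow> v = 0"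
  by (metis tvec_apply tvec_zero tzero_def)

lemma tadd_in:
  assumes "smooth_manifold A" "c \<in> charts_at A p" "X \<in> tangent_space A p" "Y \<in> tangent_space A p"
  shows "tadd X Y \<in> tangent_space A p"
  using tvec_in[OF assms(1,2), of "X c + Y c"]
  by (simp add: tvec_add[OF assms(1,2)] tvec_of_tangent[OF assms(3,2)] tvec_of_tangent[OF assms(4,2)])

lemma tscale_in:
  assumes "smooth_manifold A" "c \<in> charts_at A p" "X \<in> tangent_space A p"
  shows "tscale r X \<in> tangent_space A p"
  using tvec_in[OF assms(1,2), of "r *\<^sub>R X c"]
  by (simp add: tvec_scale[OF assms(1,2)] tvec_of_tangent[OF assms(3,2)])

lemma tadd_apply [simp]: "tadd X Y c = X c + Y c" by (simp add: tadd_def)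
lemma tscale_apply [simp]: "tscale r X c = r *\<^sub>R X c" by (simp add: tscale_def)
lemma tzero_apply [simp]: "tzero c = 0" by (simp add: tzero_def)

lemma cfield_in: "smooth_manifold A \<Longrightarrow> c \<in> A \<Longrightarrow> x \<in> cimg c \<Longrightarrow> cfield A c v x \<in> tangent_space A (cinv c x)"
  by (simp add: cfield_def tvec_in cinv_charts_at)

lemma cfield_apply: "smooth_manifold A \<Longrightarrow> c \<in> A \<Longrightarrow> x \<in> cimg c \<Longrightarrow> cfield A c v x c = v"
  by (simp add: cfield_def tvec_apply cinv_charts_at)

lemma cfield_cmap:
  "smooth_manifold A \<Longrightarrow> c \<in> charts_at A p \<Longrightarrow> cfield A c v (cmap c p) = tvec A c p v"
  by (auto simp: cfield_def cinv_cmap charts_at_def)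

text \<open>Differentiability at one point, in all pairs of charts. The neighbourhood
  \<open>N\<close> stands in for continuity of \<open>u\<close>: it is what allows charts of the
  target to be exchanged near the point. The deformation of L is handled at this level.\<close>

definition mdifferentiable ::
    "('m, 'e::euclidean_space) atlas \<Rightarrow> ('k, 'f::euclidean_space) atlas \<Rightarrow> ('m \<Rightarrow> 'k) \<Rightarrow> 'm \<Rightarrow> bool" where
  "mdifferentiable A B u p \<longleftrightarrow> p \<in> points A \<and> u p \<in> points B \<and>
     (\<forall>c\<in>charts_at A p. \<forall>d\<in>charts_at B (u p).
        (\<exists>N. open N \<and> cmap c p \<in> N \<and> N \<subseteq> cimg c \<and> (\<forall>x\<in>N. u (cinv c x) \<in> cdom d)) \<and>
        (cmap d \<circ> u \<circ> cinv c) differentiable (at (cmap c p)))"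

lemma mdifferentiable_nhd:
  assumes "mdifferentiable A B u p" "c \<in> charts_at A p" "d \<in> charts_at B (u p)"
  obtains N where "open N" "cmap c p \<in> N" "N \<subseteq> cimg c" "\<And>x. x \<in> N \<Longrightarrow> u (cinv c x) \<in> cdom d"
proof -
  have "\<exists>N. open N \<and> cmap c p \<in> N \<and> N \<subseteq> cimg c \<and> (\<forall>x\<in>N. u (cinv c x) \<in> cdom d)"
    using assms by (simp add: mdifferentiable_def)
  then show ?thesis using that by metis
qed

text \<open>\<open>differential\<close> uses the charts picked by \<open>chart_at\<close>. Composing
  the coordinate representation with transition maps on both sides and applying the chain rule shows
  that every other pair of charts yields the same vector.\<close>

lemma differential_eq:
  assumes A: "smooth_manifold A" and B: "smooth_manifold B" and u: "mdifferentiable A B u p"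
    and c: "c \<in> charts_at A p" and d: "d \<in> charts_at B (u p)" and X: "X \<in> tangent_space A p"
  shows "differential A B u p X =
    tvec B d (u p) (frechet_derivative (cmap d \<circ> u \<circ> cinv c) (at (cmap c p)) (X c))"
proof -
  define c0 d0 where "c0 = chart_at A p" and "d0 = chart_at B (u p)"
  have c0: "c0 \<in> charts_at A p" and d0: "d0 \<in> charts_at B (u p)"
    using u by (simp_all add: c0_def d0_def chart_at_in mdifferentiable_def)
  note cs = charts_atD[OF c] charts_atD[OF c0] charts_atD[OF d] charts_atD[OF d0]
  obtain N where N: "open N" "cmap c p \<in> N" "N \<subseteq> cimg c" "\<And>x. x \<in> N \<Longrightarrow> u (cinv c x) \<in> cdom d0"
    using mdifferentiable_nhd[OF u c d0] by metis
  let ?q = "cmap d0 \<circ> u \<circ> cinv c0" and ?r = "cmap d \<circ> u \<circ> cinv c"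
  let ?t = "cmap c0 \<circ> cinv c" and ?s = "cmap d \<circ> cinv d0"
  have tp: "?t (cmap c p) = cmap c0 p" using cs by (simp add: cinv_cmap[OF A])
  have rp: "?q (cmap c0 p) = cmap d0 (u p)" using cs by (simp add: cinv_cmap[OF A])
  have "?q differentiable (at (cmap c0 p))" using u c0 d0 by (simp add: mdifferentiable_def)
  then have r0: "(?q has_derivative frechet_derivative ?q (at (cmap c0 p))) (at (?t (cmap c p)))"
    unfolding tp by (rule has_derivative_frechet)
  from diff_chain_at[OF has_derivative_transition[OF A c c0] r0]
  have 1: "((?q \<circ> ?t) has_derivative (frechet_derivative ?q (at (cmap c0 p)) \<circ> coord_change c c0 p)) (at (cmap c p))" .
  have "(?s has_derivative coord_change d0 d (u p)) (at ((?q \<circ> ?t) (cmap c p)))"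
    using has_derivative_transition[OF B d0 d] tp rp by (simp only: comp_apply)
  from diff_chain_at[OF 1 this]
  have 2: "((?s \<circ> (?q \<circ> ?t)) has_derivative (coord_change d0 d (u p) \<circ>
      (frechet_derivative ?q (at (cmap c0 p)) \<circ> coord_change c c0 p))) (at (cmap c p))" .
  have "(?r has_derivative (coord_change d0 d (u p) \<circ>
      (frechet_derivative ?q (at (cmap c0 p)) \<circ> coord_change c c0 p))) (at (cmap c p))"
  proof (rule has_derivative_transform_within_open[OF 2, of "N \<inter> cmap c ` (cdom c \<inter> cdom c0)"])
    show "open (N \<inter> cmap c ` (cdom c \<inter> cdom c0))"
      using N open_overlap[OF A, of c c0] cs by auto
    show "cmap c p \<in> N \<inter> cmap c ` (cdom c \<inter> cdom c0)" using N cs by auto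
    fix x assume "x \<in> N \<inter> cmap c ` (cdom c \<inter> cdom c0)"
    then have "cinv c x \<in> cdom c0" "u (cinv c x) \<in> cdom d0" using N cs by (auto simp: cinv_cmap[OF A])
    then show "(?s \<circ> (?q \<circ> ?t)) x = ?r x" using cs by (simp add: cinv_cmap[OF A] cinv_cmap[OF B])
  qed
  from frechet_derivative_eqI[OF this] have "frechet_derivative ?r (at (cmap c p)) (X c) =
      coord_change d0 d (u p) (frechet_derivative ?q (at (cmap c0 p)) (X c0))"
    by (simp only: comp_apply tangent_space_change[OF X c c0])
  then show ?thesis
    by (simp add: differential_def Let_def c0_def[symmetric] d0_def[symmetric] tvec_change[OF B d0 d])
qed

lemma differential_in:
  assumes "smooth_manifold B" "u p \<in> points B"
  shows "differential A B u p X \<in> tangent_space B (u p)"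
  unfolding differential_def Let_def by (intro tvec_in assms chart_at_in)

lemma linear_rep:
  assumes "mdifferentiable A B u p" "c \<in> charts_at A p" "d \<in> charts_at B (u p)"
  shows "linear (frechet_derivative (cmap d \<circ> u \<circ> cinv c) (at (cmap c p)))"
  using assms by (auto intro: linear_frechet_derivative simp: mdifferentiable_def)

lemma differential_add:
  assumes "smooth_manifold A" "smooth_manifold B" "mdifferentiable A B u p"
    "X \<in> tangent_space A p" "Y \<in> tangent_space A p"
  shows "differential A B u p (tadd X Y) = tadd (differential A B u p X) (differential A B u p Y)"
proof -
  have c: "chart_at A p \<in> charts_at A p" "chart_at B (u p) \<in> charts_at B (u p)"
    using assms(3) by (auto simp: chart_at_in mdifferentiable_def)
  show ?thesis
    using assms by (simp add: differential_eq[OF assms(1-3) c] tadd_in[OF assms(1) c(1)]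
        linear_add[OF linear_rep[OF assms(3) c]] tvec_add[OF assms(2) c(2)])
qed

lemma differential_scale:
  assumes "smooth_manifold A" "smooth_manifold B" "mdifferentiable A B u p" "X \<in> tangent_space A p"
  shows "differential A B u p (tscale r X) = tscale r (differential A B u p X)"
proof -
  have c: "chart_at A p \<in> charts_at A p" "chart_at B (u p) \<in> charts_at B (u p)"
    using assms(3) by (auto simp: chart_at_in mdifferentiable_def)
  show ?thesis
    using assms by (simp add: differential_eq[OF assms(1-3) c] tscale_in[OF assms(1) c(1)]
        linear_cmul[OF linear_rep[OF assms(3) c]] tvec_scale[OF assms(2) c(2)])
qed

lemma smooth_map_open:
  assumes "smooth_manifold A" "smooth_manifold B" "smooth_map A B u" "c \<in> A" "d \<in> B"
  shows "open (cmap c ` (cdom c \<inter> u -` cdom d))"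
proof -
  have u: "u ` points A \<subseteq> points B" "continuous_on (points A) u"
    using assms(3) by (auto simp: smooth_map_def)
  have "openin (top_of_set (points B)) (cdom d)" using assms by (auto simp: smooth_manifold_def)
  then have "openin (top_of_set (points A)) (points A \<inter> u -` cdom d)"
    using u continuous_on_open_gen by (metis funcset_image image_subset_iff_funcset continuous_on_open_gen)
  from open_cmap_image[OF assms(1,4) this]
  have "open (cmap c ` (cdom c \<inter> (points A \<inter> u -` cdom d)))" .
  moreover have "cdom c \<inter> (points A \<inter> u -` cdom d) = cdom c \<inter> u -` cdom d"
    using assms(4) by (auto simp: points_def)
  ultimately show ?thesis by simp
qed

lemma smooth_map_mdifferentiable:
  assumes A: "smooth_manifold A" and B: "smooth_manifold B" and u: "smooth_map A B u" and p: "p \<in> points A"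
  shows "mdifferentiable A B u p"
  unfolding mdifferentiable_def
proof (intro conjI ballI p)
  show "u p \<in> points B" using u p by (auto simp: smooth_map_def)
  fix c d assume c: "c \<in> charts_at A p" and d: "d \<in> charts_at B (u p)"
  let ?N = "cmap c ` (cdom c \<inter> u -` cdom d)"
  note cs = charts_atD[OF c] charts_atD[OF d]
  have N: "cmap c p \<in> ?N" using cs by auto
  show "\<exists>N. open N \<and> cmap c p \<in> N \<and> N \<subseteq> cimg c \<and> (\<forall>x\<in>N. u (cinv c x) \<in> cdom d)"
    using N smooth_map_open[OF A B u, of c d] cs by (intro exI[of _ ?N]) (auto simp: cinv_cmap[OF A])
  show "(cmap d \<circ> u \<circ> cinv c) differentiable (at (cmap c p))"
    using u cs N by (intro smooth_on_differentiable[of ?N]) (auto simp: smooth_map_def)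
qed

text \<open>The coordinate representation \<open>local_metric\<close> is used for arbitrary covariant 2-tensors.\<close>

lemma local_metric_change:
  assumes A: "smooth_manifold A" and c: "c \<in> A" and d: "d \<in> A" and x: "x \<in> cmap c ` (cdom c \<inter> cdom d)"
  shows "local_metric A \<eta> c x v w = local_metric A \<eta> d ((cmap d \<circ> cinv c) x)
     (frechet_derivative (cmap d \<circ> cinv c) (at x) v) (frechet_derivative (cmap d \<circ> cinv c) (at x) w)"
proof -
  obtain p where p: "p \<in> cdom c" "p \<in> cdom d" "x = cmap c p" using x by auto
  have cd: "c \<in> charts_at A p" "d \<in> charts_at A p" using p c d by (auto simp: charts_at_def)
  show ?thesis
    unfolding local_metric_def
    using p c d by (simp add: cinv_cmap[OF A] cfield_cmap[OF A] cd
        tvec_change[OF A cd, unfolded coord_change_def])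
qed

lemma differential_cfield:
  assumes A: "smooth_manifold A" and B: "smooth_manifold B" and c: "c \<in> A" and d: "d \<in> B"
    and x: "x \<in> cimg c" and u: "mdifferentiable A B u (cinv c x)" and ux: "u (cinv c x) \<in> cdom d"
  shows "differential A B u (cinv c x) (cfield A c v x) =
     cfield B d (frechet_derivative (cmap d \<circ> u \<circ> cinv c) (at x) v) ((cmap d \<circ> u \<circ> cinv c) x)"
proof -
  have cd: "c \<in> charts_at A (cinv c x)" "d \<in> charts_at B (u (cinv c x))"
    using c d x ux by (auto simp: charts_at_def cinv_in[OF A])
  show ?thesis
    using cinv_cmap[OF B d ux]
    by (simp add: differential_eq[OF A B u cd] cfield_in[OF A c x] cfield_apply[OF A c x]
        cmap_cinv[OF A c x] cfield_def[of B])
qed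

definition bilinear_form_at :: "('m, 'e::euclidean_space) atlas \<Rightarrow> ('m, 'e) form2 \<Rightarrow> 'm \<Rightarrow> bool" where
  "bilinear_form_at A \<eta> p \<longleftrightarrow> (\<forall>X\<in>tangent_space A p. linear_on_tangent A p (\<eta> p X) \<and>
     linear_on_tangent A p (\<lambda>Y. \<eta> p Y X))"

lemma bilinear_local_metric:
  assumes A: "smooth_manifold A" and c: "c \<in> A" and x: "x \<in> cimg c" and \<eta>: "bilinear_form_at A \<eta> (cinv c x)"
  shows "bilinear (local_metric A \<eta> c x)"
proof -
  have ca: "c \<in> charts_at A (cinv c x)" by (rule cinv_charts_at[OF A c x])
  show ?thesis
    unfolding bilinear_def local_metric_def cfield_def linear_iff
    using \<eta> tvec_in[OF A ca]
    by (auto simp: bilinear_form_at_def linear_on_tangent_def tvec_add[OF A ca] tvec_scale[OF A ca])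
qed

text \<open>The transition map pulls the form in the chart \<open>c\<close> back to the form in the
  chart picked by \<open>chart_at\<close>, and exterior differentiation commutes with pull-back.
  Differentiability is demanded in \<open>c\<close> and at the single point only, which is what can
  be supplied for F(\<alpha>).\<close>

lemma d2_chart:
  assumes A: "smooth_manifold A" and c: "c \<in> charts_at A p"
    and X: "X \<in> tangent_space A p" and Y: "Y \<in> tangent_space A p" and Z: "Z \<in> tangent_space A p"
    and bil: "\<And>q. q \<in> points A \<Longrightarrow> bilinear_form_at A \<eta> q"
    and alt: "\<And>q V W. q \<in> points A \<Longrightarrow> V \<in> tangent_space A q \<Longrightarrow> W \<in> tangent_space A q \<Longrightarrow> \<eta> q V W = - \<eta> q W V"
    and diff: "\<And>v w. (\<lambda>y. local_metric A \<eta> c y v w) differentiable (at (cmap c p))"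
  shows "d2 A \<eta> p X Y Z = ext_deriv2 (local_metric A \<eta> c) (cmap c p) (X c) (Y c) (Z c)"
proof -
  define c0 where "c0 = chart_at A p"
  have c0: "c0 \<in> charts_at A p" using c charts_at_points c0_def chart_at_in by metis
  note cs = charts_atD[OF c] charts_atD[OF c0]
  let ?S = "cmap c0 ` (cdom c0 \<inter> cdom c)" and ?phi = "cmap c \<circ> cinv c0"
  have S: "open ?S" "cmap c0 p \<in> ?S" "smooth_on ?S ?phi"
    using cs by (auto intro: open_overlap[OF A] smooth_transition[OF A])
  have phi: "?phi ` ?S \<subseteq> cimg c" "?phi (cmap c0 p) = cmap c p" using cs by (auto simp: cinv_cmap[OF A])
  have "d2 A \<eta> p X Y Z = ext_deriv2 (local_metric A \<eta> c0) (cmap c0 p) (X c0) (Y c0) (Z c0)"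
    by (simp add: d2_def Let_def ext_deriv2_def local_metric_def c0_def)
  also have "ext_deriv2 (local_metric A \<eta> c0) (cmap c0 p) =
     ext_deriv2 (\<lambda>y v w. local_metric A \<eta> c (?phi y) (frechet_derivative ?phi (at y) v)
        (frechet_derivative ?phi (at y) w)) (cmap c0 p)"
    using cs by (intro ext_deriv2_cong_open[OF S(1,2)] local_metric_change[OF A])
       blast+
  also have "\<dots> (X c0) (Y c0) (Z c0) = ext_deriv2 (local_metric A \<eta> c) (?phi (cmap c0 p))
      (frechet_derivative ?phi (at (cmap c0 p)) (X c0)) (frechet_derivative ?phi (at (cmap c0 p)) (Y c0))
      (frechet_derivative ?phi (at (cmap c0 p)) (Z c0))"
  proof (rule ext_deriv2_pullback[OF S phi(1)])
    fix y assume y: "y \<in> cimg c"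
    have "cinv c y \<in> cdom c" using cinv_in[OF A _ y] cs by simp
    then have "cinv c y \<in> points A" using cs unfolding points_def by blast
    then show "bilinear (local_metric A \<eta> c y)"
      using cs y bil by (intro bilinear_local_metric[OF A]) auto
    show "local_metric A \<eta> c y v w = - local_metric A \<eta> c y w v" for v w
      unfolding local_metric_def using cs \<open>cinv c y \<in> points A\<close> y by (intro alt cfield_in[OF A]) auto
  qed (simp only: phi diff)
  finally show ?thesis
    using tangent_space_change[OF X c0 c] tangent_space_change[OF Y c0 c] tangent_space_change[OF Z c0 c]
    unfolding phi(2) by (simp add: coord_change_def)
qed

section \<open>The strong maximum principle\<close>

text \<open>At the maximum the first derivative vanishes. Were \<open>H v\<close> positive, the
  derivative along the ray in direction \<open>v\<close> would be positive just after the start, and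
  \<open>w\<close> would increase strictly. Differentiability of the first derivative at
  \<open>y\<close> is enough for this.\<close>

lemma interior_max_second_derivative:
  fixes w :: "'a::real_normed_vector \<Rightarrow> real"
  assumes S: "open S" "y \<in> S" and W: "\<And>z. z \<in> S \<Longrightarrow> (w has_derivative W z) (at z)"
    and H: "((\<lambda>z. W z v) has_derivative H) (at y)" and max: "\<And>z. z \<in> S \<Longrightarrow> w z \<le> w y"
  shows "H v \<le> 0"
proof (rule ccontr)
  assume "\<not> H v \<le> 0"
  then have Hv: "H v > 0" by simp
  have "W y = (\<lambda>v. 0)"
    using differential_zero_maxmin[OF S(2,1) W[OF S(2)]] max by blast
  then have W0: "W y v = 0" by simp
  obtain d0 where d0: "d0 > 0" "ball y d0 \<subseteq> S" using S openE by blast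
  have der: "((\<lambda>t. w (y + t *\<^sub>R v)) has_real_derivative W (y + t *\<^sub>R v) v) (at t)" if "y + t *\<^sub>R v \<in> S" for t
  proof -
    have "((\<lambda>t. w (y + t *\<^sub>R v)) has_derivative (\<lambda>h. W (y + t *\<^sub>R v) (h *\<^sub>R v))) (at t)"
      by (rule has_derivative_compose[of "\<lambda>t. y + t *\<^sub>R v" _ t UNIV w, simplified])
        (auto intro!: derivative_eq_intros W that)
    moreover have "W (y + t *\<^sub>R v) (h *\<^sub>R v) = W (y + t *\<^sub>R v) v * h" for h
      using has_derivative_linear[OF W[OF that]] by (simp add: linear_cmul)
    ultimately show ?thesis by (simp add: has_field_derivative_def)
  qed
  have "((\<lambda>t. W (y + t *\<^sub>R v) v) has_derivative (\<lambda>h. H (h *\<^sub>R v))) (at 0)"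
    by (rule has_derivative_compose[of "\<lambda>t. y + t *\<^sub>R v" _ 0 UNIV "\<lambda>z. W z v", simplified])
      (auto intro!: derivative_eq_intros H)
  moreover have "H (h *\<^sub>R v) = H v * h" for h
    using has_derivative_linear[OF H] by (simp add: linear_cmul)
  ultimately have "((\<lambda>t. W (y + t *\<^sub>R v) v) has_real_derivative H v) (at 0)"
    by (simp add: has_field_derivative_def)
  from DERIV_pos_inc_right[OF this Hv] obtain d1 where
    d1: "d1 > 0" "\<And>h. 0 < h \<Longrightarrow> h < d1 \<Longrightarrow> W (y + h *\<^sub>R v) v > 0"
    using W0 by auto
  \<comment> \<open>Small enough for the derivative to be positive up to \<open>t\<close> and for
    the segment to stay inside the ball \<open>ball y d0\<close>.\<close>
  define t where "t = min (d1 / 2) (d0 / (2 * (norm v + 1)))"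
  have nv: "norm v + 1 > 0" by (simp add: add_nonneg_pos)
  have t: "0 < t" "t < d1" "t * (norm v + 1) < d0"
  proof -
    show "0 < t" using d0 d1 nv by (simp add: t_def)
    show "t < d1" using d1 by (simp add: t_def)
    have "t * (norm v + 1) \<le> d0 / (2 * (norm v + 1)) * (norm v + 1)"
      using nv by (intro mult_right_mono) (auto simp: t_def)
    also have "\<dots> = d0 / 2"
    proof -
      have "d0 / (2 * n) * n = d0 / 2" if "n > 0" for n :: real using that by simp
      from this[OF nv] show ?thesis .
    qed
    also have "\<dots> < d0" using d0 by simp
    finally show "t * (norm v + 1) < d0" .
  qed
  have inS: "y + s *\<^sub>R v \<in> S" if "0 \<le> s" "s \<le> t" for s
  proof (rule subsetD[OF d0(2)])
    have "s * norm v \<le> t * norm v" using that by (intro mult_right_mono) auto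
    also have "\<dots> \<le> t * (norm v + 1)" using t by simp
    finally show "y + s *\<^sub>R v \<in> ball y d0" using t that by (simp add: dist_norm)
  qed
  have "w (y + 0 *\<^sub>R v) < w (y + t *\<^sub>R v)"
  proof (rule DERIV_pos_imp_increasing_open[OF t(1)])
    fix s assume "0 < s" "s < t"
    then show "\<exists>l. ((\<lambda>t. w (y + t *\<^sub>R v)) has_real_derivative l) (at s) \<and> l > 0"
      using der[of s] inS[of s] d1(2)[of s] t by auto
  next
    show "continuous_on {0..t} (\<lambda>t. w (y + t *\<^sub>R v))"
      using der inS by (intro continuous_at_imp_continuous_on ballI DERIV_isCont) auto
  qed
  moreover have "w (y + t *\<^sub>R v) \<le> w y" using max inS[of t] t by simp
  ultimately show False by simp
qed

lemma barrier_derivative: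
  fixes y :: "'a::real_inner"
  shows "((\<lambda>x. exp (- k * ((x - y) \<bullet> (x - y)))) has_derivative
      (\<lambda>u. - 2 * k * ((x - y) \<bullet> u) * exp (- k * ((x - y) \<bullet> (x - y))))) (at x)"
proof -
  have "((\<lambda>x. (x - y) \<bullet> (x - y)) has_derivative (\<lambda>h. 2 * ((x - y) \<bullet> h))) (at x)"
    by (auto intro!: derivative_eq_intros simp: inner_commute)
  from has_derivative_exp[OF has_derivative_mult_right[OF this, of "- k"]]
  show ?thesis by (rule has_derivative_eq_rhs) (simp add: fun_eq_iff)
qed

lemma barrier_second_derivative:
  fixes y :: "'a::real_inner"
  shows "((\<lambda>x. - 2 * k * ((x - y) \<bullet> u) * exp (- k * ((x - y) \<bullet> (x - y)))) has_derivative
      (\<lambda>v. (4 * k\<^sup>2 * ((x - y) \<bullet> u) * ((x - y) \<bullet> v) - 2 * k * (v \<bullet> u)) * exp (- k * ((x - y) \<bullet> (x - y))))) (at x)"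
proof -
  have 1: "((\<lambda>x. - 2 * k * ((x - y) \<bullet> u)) has_derivative (\<lambda>h. - 2 * k * (h \<bullet> u))) (at x)"
    by (auto intro!: derivative_eq_intros)
  have alg: "- 2 * k * a * (- 2 * k * b * e) + - 2 * k * c * e = (4 * k\<^sup>2 * a * b - 2 * k * c) * e" for a b c e
    by (simp add: algebra_simps power2_eq_square)
  from has_derivative_mult[OF 1 barrier_derivative]
  show ?thesis by (rule has_derivative_eq_rhs) (simp only: alg)
qed

text \<open>Hopf's argument: near a boundary point \<open>x1\<close> of a ball \<open>B(y, \<rho>)\<close> inside \<open>{f < M}\<close> the barrier
  \<open>exp (- k |x - y|\<^sup>2) - exp (- k \<rho>\<^sup>2)\<close> is a strict subsolution for large \<open>k\<close>, so that a small multiple of it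
  added to \<open>f\<close> produces an interior maximum.\<close>

lemma strong_maximum_principle_local:
  fixes f :: "'a::euclidean_space \<Rightarrow> real" and e :: "'a \<Rightarrow> 'i \<Rightarrow> 'a"
  assumes S: "open S" "x0 \<in> S" and f: "smooth_on S f" and I: "finite I"
    and eq: "\<And>x. x \<in> S \<Longrightarrow> (\<Sum>i\<in>I. frechet_derivative (\<lambda>y. frechet_derivative f (at y) (e x i)) (at x) (e x i)) +
        frechet_derivative f (at x) (\<beta> x) = 0"
    and theta: "\<theta> > 0" "\<And>x v. x \<in> S \<Longrightarrow> \<theta> * (norm v)\<^sup>2 \<le> (\<Sum>i\<in>I. (v \<bullet> e x i)\<^sup>2)"
    and bd: "\<And>x i. x \<in> S \<Longrightarrow> i \<in> I \<Longrightarrow> norm (e x i) \<le> C" "\<And>x. x \<in> S \<Longrightarrow> norm (\<beta> x) \<le> C"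
    and max: "\<And>x. x \<in> S \<Longrightarrow> f x \<le> f x0"
  shows "\<exists>r>0. \<forall>x\<in>ball x0 r. x \<in> S \<and> f x = f x0"
proof -
  let ?M = "f x0"
  obtain r' where r': "r' > 0" "cball x0 r' \<subseteq> S" using S open_contains_cball by blast
  \<comment> \<open>Half the radius: a ball of radius less than \<open>r\<close> around a point of
    \<open>ball x0 r\<close> still lies in \<open>cball x0 (2 * r)\<close>.\<close>
  define r where "r = r' / 2"
  have r: "r > 0" "cball x0 (2 * r) \<subseteq> S" using r' by (auto simp: r_def)
  have cont: "continuous_on S f" by (rule smooth_on_continuous[OF f])
  have "f z = ?M" if z: "z \<in> ball x0 r" for z
  proof (rule ccontr)
    assume "f z \<noteq> ?M"
    define K where "K = {x \<in> cball x0 (2 * r). f x = ?M}"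
    have "closed K"
      unfolding K_def
      by (intro continuous_closed_preimage_constant continuous_on_subset[OF cont r(2)]) auto
    moreover have x0K: "x0 \<in> K" using r by (simp add: K_def)
    ultimately obtain x1 where x1: "x1 \<in> K" "\<And>x. x \<in> K \<Longrightarrow> dist z x1 \<le> dist z x"
      using distance_attains_inf[of K z] by blast
    define \<rho> where "\<rho> = dist z x1"
    have rho: "\<rho> > 0" "\<rho> < r"
    proof -
      show "\<rho> > 0" using \<open>f z \<noteq> ?M\<close> x1 by (auto simp: \<rho>_def K_def)
      show "\<rho> < r" using x1(2)[OF x0K] z by (simp add: \<rho>_def dist_commute)
    qed
    have inner_ball: "x \<in> S \<and> f x < ?M" if "dist z x < \<rho>" for x
    proof -
      have "dist x0 x \<le> 2 * r" using that rho z dist_triangle[of x0 x z] by simp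
      then have "x \<in> cball x0 (2 * r)" by simp
      moreover have "f x \<noteq> ?M" using x1(2)[of x] that calculation by (auto simp: K_def \<rho>_def)
      ultimately show ?thesis using r(2) max[of x] by force
    qed
    have x1S: "x1 \<in> S" "f x1 = ?M" using x1 r(2) by (auto simp: K_def)
    \<comment> \<open>The ball around the midpoint with half the radius touches the ball around
      \<open>z\<close> from inside at \<open>x1\<close> alone. On its closure f therefore stays
      below the maximum except at \<open>x1\<close>.\<close>
    define y where "y = (1/2) *\<^sub>R (z + x1)"
    define q where "q = \<rho> / 2"
    have q: "q > 0" using rho by (simp add: q_def)
    have xy: "x1 - y = (1/2) *\<^sub>R (x1 - z)" "y - z = (1/2) *\<^sub>R (x1 - z)"
      by (simp_all add: y_def algebra_simps flip: scaleR_add_left)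
    have nxy: "norm (x1 - y) = q"
      unfolding xy(1) by (simp add: q_def \<rho>_def dist_norm norm_minus_commute)
    have touch: "f x < ?M" if "norm (x - y) \<le> q" "x \<noteq> x1" for x
    proof -
      let ?a = "x - y" and ?b = "x1 - y"
      have "?a - ?b \<noteq> 0" using that by simp
      then have "(?a - ?b) \<bullet> (?a - ?b) > 0" using inner_gt_zero_iff by blast
      \<comment> \<open>Parallelogram law with |a - b| > 0; the sum a + b is x - z.\<close>
      then have "(?a + ?b) \<bullet> (?a + ?b) < 2 * (?a \<bullet> ?a) + 2 * (?b \<bullet> ?b)"
        unfolding inner_diff_left inner_diff_right inner_add_left inner_add_right
        by (simp add: inner_commute)
      also have "\<dots> \<le> 2 * q\<^sup>2 + 2 * q\<^sup>2"
        using that nxy by (simp add: power_mono flip: power2_norm_eq_inner)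
      also have "\<dots> = \<rho>\<^sup>2" by (simp add: q_def power2_eq_square)
      finally have "norm (?a + ?b) < \<rho>"
        using rho by (intro power2_less_imp_less[of "norm (?a + ?b)" \<rho>]) (auto simp only: power2_norm_eq_inner)
      moreover have "?a + ?b = x - z"
      proof -
        have "?b = y - z" using xy by simp
        then show ?thesis by (simp only: diff_add_cancel add_diff_eq)
      qed
      ultimately show ?thesis using inner_ball[of x] by (simp add: dist_norm norm_minus_commute)
    qed
    obtain \<delta>' where d': "\<delta>' > 0" "cball x1 \<delta>' \<subseteq> S" using S x1S open_contains_cball by blast
    \<comment> \<open>The bound q / 2 keeps the small ball around \<open>x1\<close> away from the
      centre \<open>y\<close>, so that ellipticity gives a definite lower bound there.\<close>
    define \<delta> where "\<delta> = min \<delta>' (q / 2)"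
    have d: "\<delta> > 0" "cball x1 \<delta> \<subseteq> S" "\<delta> \<le> q / 2" using d' q by (auto simp: \<delta>_def)
    have dist_y: "q / 2 \<le> norm (x - y)" "norm (x - y) \<le> 2 * q" if "x \<in> cball x1 \<delta>" for x
    proof -
      have "norm (x1 - x) \<le> q / 2" using that d by (simp add: dist_norm)
      then show "q / 2 \<le> norm (x - y)" "norm (x - y) \<le> 2 * q"
        using norm_triangle_ineq[of "x1 - x" "x - y"] norm_triangle_ineq[of "x - x1" "x1 - y"] nxy
        by (auto simp: norm_minus_commute)
    qed
    \<comment> \<open>On the part of the sphere inside the touching ball f misses the maximum by a
      fixed amount, by compactness. If that part is empty, any positive number will do.\<close>
    obtain \<epsilon> where eps: "\<epsilon> > 0" "\<And>x. x \<in> sphere x1 \<delta> \<inter> cball y q \<Longrightarrow> f x + \<epsilon> \<le> ?M"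
    proof (cases "sphere x1 \<delta> \<inter> cball y q = {}")
      case True
      then show ?thesis using that[of 1] by auto
    next
      case False
      have "compact (sphere x1 \<delta> \<inter> cball y q)" by (simp add: compact_Int)
      moreover have "continuous_on (sphere x1 \<delta> \<inter> cball y q) f"
        using d(2) by (intro continuous_on_subset[OF cont]) auto
      ultimately obtain xm where xm: "xm \<in> sphere x1 \<delta> \<inter> cball y q"
        "\<And>x. x \<in> sphere x1 \<delta> \<inter> cball y q \<Longrightarrow> f x \<le> f xm"
        using continuous_attains_sup[OF _ False] by blast
      have "f xm < ?M" using xm(1) d(1) by (intro touch) (auto simp: dist_norm norm_minus_commute)
      then show ?thesis using that[of "?M - f xm"] xm(2) by force
    qed
    define C' where "C' = max C 0"
    have C': "C' \<ge> 0" "\<And>x i. x \<in> S \<Longrightarrow> i \<in> I \<Longrightarrow> norm (e x i) \<le> C'" "\<And>x. x \<in> S \<Longrightarrow> norm (\<beta> x) \<le> C'"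
      using bd by (fastforce simp: C'_def max.coboundedI1)+
    \<comment> \<open>Chosen so that the quadratic term 2 k \<theta> (q/2)^2 exceeds by exactly 1
      the sum of the bounds card I C'^2 for the trace term and 2 q C' for the first order
      term.\<close>
    define k where "k = (card I * C'\<^sup>2 + 2 * q * C' + 1) / (2 * \<theta> * (q / 2)\<^sup>2)"
    have k: "k > 0" "2 * k * \<theta> * (q / 2)\<^sup>2 = card I * C'\<^sup>2 + 2 * q * C' + 1"
      using theta q C' by (auto simp: k_def add_nonneg_pos)
    let ?E = "\<lambda>x. exp (- k * ((x - y) \<bullet> (x - y)))"
    let ?V = "\<lambda>x u. - 2 * k * ((x - y) \<bullet> u) * ?E x"
    let ?V2 = "\<lambda>x u v. (4 * k\<^sup>2 * ((x - y) \<bullet> u) * ((x - y) \<bullet> v) - 2 * k * (v \<bullet> u)) * ?E x"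
    define w where "w = (\<lambda>x. f x + \<epsilon> * (?E x - exp (- k * q\<^sup>2)))"
    have LV: "(\<Sum>i\<in>I. ?V2 x (e x i) (e x i)) + ?V x (\<beta> x) > 0" if x: "x \<in> cball x1 \<delta>" for x
    proof -
      have xS: "x \<in> S" using x d by auto
      let ?s = "\<Sum>i\<in>I. ((x - y) \<bullet> e x i)\<^sup>2" and ?n = "\<Sum>i\<in>I. (e x i) \<bullet> (e x i)"
      have eq1: "(\<Sum>i\<in>I. ?V2 x (e x i) (e x i)) + ?V x (\<beta> x) =
          2 * k * (2 * k * ?s - ?n - (x - y) \<bullet> \<beta> x) * ?E x"
      proof -
        have "(\<Sum>i\<in>I. (4 * k\<^sup>2 * a i * a i - 2 * k * b i) * c) =
            (4 * k\<^sup>2 * (\<Sum>i\<in>I. (a i)\<^sup>2) - 2 * k * (\<Sum>i\<in>I. b i)) * c" for a b :: "'i \<Rightarrow> real" and c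
          unfolding sum_distrib_right[symmetric] sum_subtractf sum_distrib_left
          by (simp add: power2_eq_square mult.assoc)
        moreover have "(4 * k\<^sup>2 * s - 2 * k * n) * c + - 2 * k * b * c = 2 * k * (2 * k * s - n - b) * c"
          for s n b c :: real by (simp add: algebra_simps power2_eq_square)
        ultimately show ?thesis by (simp only:)
      qed
      have "\<theta> * (q / 2)\<^sup>2 \<le> \<theta> * (norm (x - y))\<^sup>2"
        using theta q dist_y[OF x] by (intro mult_left_mono power_mono) auto
      also have "\<dots> \<le> ?s" by (rule theta(2)[OF xS])
      finally have "2 * k * (\<theta> * (q / 2)\<^sup>2) \<le> 2 * k * ?s" using k by (intro mult_left_mono) auto
      then have 1: "card I * C'\<^sup>2 + 2 * q * C' + 1 \<le> 2 * k * ?s" using k(2) by (simp add: mult.assoc)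
      have "?n \<le> (\<Sum>i\<in>I. C'\<^sup>2)"
        using C'(2)[OF xS] by (intro sum_mono) (simp add: power_mono flip: power2_norm_eq_inner)
      then have 2: "?n \<le> card I * C'\<^sup>2" by simp
      have "(x - y) \<bullet> \<beta> x \<le> norm (x - y) * norm (\<beta> x)" by (rule norm_cauchy_schwarz)
      also have "\<dots> \<le> 2 * q * C'" using dist_y[OF x] C'(3)[OF xS] q by (intro mult_mono) auto
      finally have "2 * k * ?s - ?n - (x - y) \<bullet> \<beta> x > 0" using 1 2 by linarith
      then show ?thesis unfolding eq1 using k by simp
    qed
    have "continuous_on (cball x1 \<delta>) w"
      unfolding w_def by (intro continuous_intros continuous_on_subset[OF cont d(2)])
    then obtain t where t: "t \<in> cball x1 \<delta>" "\<And>x. x \<in> cball x1 \<delta> \<Longrightarrow> w x \<le> w t"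
      using continuous_attains_sup[of "cball x1 \<delta>" w] d(1) by auto
    have wx1: "w x1 = ?M" using x1S nxy by (simp add: w_def power2_norm_eq_inner[symmetric])
    \<comment> \<open>On the boundary sphere the two cases complement each other: inside the
      touching ball f is smaller by \<epsilon> and the barrier adds less than \<epsilon>; outside it
      the barrier is negative.\<close>
    have "w x < ?M" if x: "x \<in> sphere x1 \<delta>" for x
    proof (cases "norm (x - y) \<le> q")
      case True
      then have "f x + \<epsilon> \<le> ?M" using eps(2)[of x] x by (simp add: dist_norm norm_minus_commute)
      moreover have "?E x - exp (- k * q\<^sup>2) < 1"
      proof -
        have "?E x \<le> 1" using k by simp
        then show ?thesis using exp_gt_zero[of "- k * q\<^sup>2"] by linarith
      qed
      then have "\<epsilon> * (?E x - exp (- k * q\<^sup>2)) < \<epsilon>" using eps(1) by simp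
      ultimately show ?thesis by (simp add: w_def)
    next
      case False
      then have "q\<^sup>2 < (norm (x - y))\<^sup>2" using q by (intro power_strict_mono) auto
      then have "?E x < exp (- k * q\<^sup>2)" using k by (simp add: power2_norm_eq_inner)
      then have "\<epsilon> * (?E x - exp (- k * q\<^sup>2)) < 0" using eps(1) by (simp add: mult_less_0_iff)
      moreover have "f x \<le> ?M" using x d(2) by (intro max) auto
      ultimately show ?thesis by (simp add: w_def)
    qed
    then have tb: "t \<in> ball x1 \<delta>"
      using t(1) t(2)[of x1] wx1 d(1) by (force simp: less_le)
    have bS: "x \<in> S" if "x \<in> ball x1 \<delta>" for x using that d(2) by auto
    \<comment> \<open>The subtracted 0 is the derivative of the constant in the barrier; it keeps
      the terms in the shape that the derivative rules produce.\<close>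
    define W where "W = (\<lambda>x u. frechet_derivative f (at x) u + \<epsilon> * (?V x u - 0))"
    define H where "H = (\<lambda>u v. frechet_derivative (\<lambda>x. frechet_derivative f (at x) u) (at t) v + \<epsilon> * (?V2 t u v - 0))"
    have W: "(w has_derivative W x) (at x)" if "x \<in> ball x1 \<delta>" for x
      unfolding w_def W_def
      by (intro has_derivative_add has_derivative_mult_right has_derivative_diff has_derivative_const
        barrier_derivative smooth_on_has_derivative[OF f bS[OF that]])
    have W2: "((\<lambda>x. W x u) has_derivative H u) (at t)" for u
      unfolding W_def H_def
      by (intro has_derivative_add has_derivative_mult_right has_derivative_diff has_derivative_const
        barrier_second_derivative smooth_on_has_derivative[OF smooth_on_frechet[OF f] bS[OF tb]])
    have tmax: "w x \<le> w t" if "x \<in> ball x1 \<delta>" for x using that t(2) by auto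
    have "W t = (\<lambda>v. 0)"
      using differential_zero_maxmin[OF tb open_ball W[OF tb]] tmax by blast
    then have W0: "W t (\<beta> t) = 0" by simp
    \<comment> \<open>At an interior maximum of \<open>w\<close> the operator applied to
      \<open>w\<close> is nonpositive. As f solves the equation, it also equals \<epsilon> times the
      positive quantity of \<open>LV\<close>.\<close>
    have "(\<Sum>i\<in>I. H (e t i) (e t i)) \<le> 0"
      by (intro sum_nonpos interior_max_second_derivative[OF open_ball tb W W2 tmax])
    with W0 have "(\<Sum>i\<in>I. H (e t i) (e t i)) + W t (\<beta> t) \<le> 0" by simp
    moreover have "(\<Sum>i\<in>I. H (e t i) (e t i)) + W t (\<beta> t) =
        ((\<Sum>i\<in>I. frechet_derivative (\<lambda>y. frechet_derivative f (at y) (e t i)) (at t) (e t i)) +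
        frechet_derivative f (at t) (\<beta> t)) + \<epsilon> * ((\<Sum>i\<in>I. ?V2 t (e t i) (e t i)) + ?V t (\<beta> t))"
      unfolding H_def W_def diff_zero sum.distrib sum_distrib_left[symmetric] by argo
    ultimately have "\<epsilon> * ((\<Sum>i\<in>I. ?V2 t (e t i) (e t i)) + ?V t (\<beta> t)) \<le> 0"
      unfolding eq[OF bS[OF tb]] add_0_left by (rule back_subst[where P = "\<lambda>s. s \<le> 0"])
    with mult_pos_pos[OF eps(1) LV[OF t(1)]] show False by (meson not_less)
  qed
  moreover have "x \<in> S" if "x \<in> ball x0 r" for x using that r by (intro subsetD[OF r(2)]) auto
  ultimately show ?thesis using r(1) by blast
qed

section \<open>Metrics and Christoffel symbols in a chart\<close>

lemma linear_frechet_param: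
  fixes b :: "'a::real_normed_vector \<Rightarrow> 'b::real_vector \<Rightarrow> 'c::real_normed_vector"
  assumes U: "open U" "x \<in> U" and lin: "\<And>y. y \<in> U \<Longrightarrow> linear (b y)"
    and diff: "\<And>v. (\<lambda>y. b y v) differentiable (at x)"
  shows "linear (\<lambda>v. frechet_derivative (\<lambda>y. b y v) (at x) u)"
proof (rule linearI)
  let ?B = "\<lambda>v. frechet_derivative (\<lambda>y. b y v) (at x)"
  have B: "((\<lambda>y. b y v) has_derivative ?B v) (at x)" for v
    using diff by (simp add: has_derivative_frechet)
  have 1: "((\<lambda>y. b y (v + w)) has_derivative (\<lambda>h. ?B v h + ?B w h)) (at x)" for v w
    by (rule has_derivative_transform_within_open[OF has_derivative_add[OF B B] U])
      (simp add: linear_add[OF lin])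
  show "?B (v + w) u = ?B v u + ?B w u" for v w
    by (simp add: frechet_derivative_eqI[OF 1])
  have 2: "((\<lambda>y. b y (r *\<^sub>R v)) has_derivative (\<lambda>h. r *\<^sub>R ?B v h)) (at x)" for r v
    by (rule has_derivative_transform_within_open[OF has_derivative_scaleR_right[OF B] U])
      (simp add: linear_cmul[OF lin])
  show "?B (r *\<^sub>R v) u = r *\<^sub>R ?B v u" for r v
    by (simp add: frechet_derivative_eqI[OF 2])
qed

text \<open>Riesz representation: the map \<open>S\<close> that lists the coordinates of B(z, .) is
  injective by positivity, hence surjective by dimension.\<close>

lemma bilinear_representation:
  fixes B :: "'a::euclidean_space \<Rightarrow> 'a \<Rightarrow> real"
  assumes B: "bilinear B" and pos: "\<And>v. v \<noteq> 0 \<Longrightarrow> B v v > 0" and phi: "linear \<phi>"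
  shows "\<exists>!z. \<forall>w. B z w = \<phi> w"
proof -
  have l1: "linear (\<lambda>z. B z w)" and l2: "linear (B z)" for z w using B by (auto simp: bilinear_def)
  define S where "S = (\<lambda>z. \<Sum>b\<in>Basis. B z b *\<^sub>R b)"
  have "linear S"
    unfolding S_def by (intro linear_compose_sum ballI linear_compose[OF l1, unfolded o_def] linearI)
      (auto simp: algebra_simps)
  have ext: "(\<forall>w. B z w = \<psi> w) \<longleftrightarrow> (\<forall>b\<in>Basis. B z b = \<psi> b)" if "linear \<psi>" for z \<psi>
  proof
    assume h: "\<forall>b\<in>Basis. B z b = \<psi> b"
    show "\<forall>w. B z w = \<psi> w"
    proof
      fix w show "B z w = \<psi> w"
        unfolding linear_Basis_sum[OF l2, of z w] linear_Basis_sum[OF that, of w] using h by simp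
    qed
  qed simp
  have Sb: "S z \<bullet> b = B z b" if "b \<in> Basis" for z b
    using that by (simp add: S_def inner_sum_left inner_Basis if_distrib cong: if_cong)
  have uniq: "z = z'" if "\<forall>w. B z w = \<psi> w" "\<forall>w. B z' w = \<psi> w" for z z' \<psi>
  proof (rule ccontr)
    assume "z \<noteq> z'"
    then have "B (z - z') (z - z') > 0" by (intro pos) simp
    then show False using that linear_diff[OF l1, of z z'] by simp
  qed
  have "inj S"
  proof (rule injI)
    fix z z' assume "S z = S z'"
    then have "\<forall>b\<in>Basis. B z b = B z' b" using Sb by metis
    then show "z = z'" using ext[OF l2, of z z'] uniq by blast
  qed
  then have "surj S" using \<open>linear S\<close> linear_injective_imp_surjective by blast
  then obtain z where "S z = (\<Sum>b\<in>Basis. \<phi> b *\<^sub>R b)" by (metis surjD)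
  then have "B z b = \<phi> b" if "b \<in> Basis" for b
    using Sb[OF that, of z] that by (simp add: inner_sum_left inner_Basis if_distrib cong: if_cong)
  then have "\<forall>w. B z w = \<phi> w" using ext[OF phi] by blast
  then show ?thesis using uniq by blast
qed

text \<open>\<open>D u v w\<close> stands for the derivative of the metric coefficient g(v, w) in
  direction \<open>u\<close>. The brackets of constant fields vanish, so Koszul's formula reduces to
  \<open>K\<close>; the Riesz representation turns \<open>K\<close> into the connection, and
  substituting the metric equation into \<open>K\<close> gives uniqueness.\<close>

lemma koszul:
  fixes B :: "'a::euclidean_space \<Rightarrow> 'a \<Rightarrow> real"
  assumes B: "bilinear B" and sym: "\<And>v w. B v w = B w v" and pos: "\<And>v. v \<noteq> 0 \<Longrightarrow> B v v > 0"
    and D1: "\<And>v w. linear (\<lambda>u. D u v w)" and D2: "\<And>u w. linear (\<lambda>v. D u v w)"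
    and Dsym: "\<And>u v w. D u v w = D u w v"
  shows "\<exists>!\<Gamma>. bilinear \<Gamma> \<and> (\<forall>u v. \<Gamma> u v = \<Gamma> v u) \<and> (\<forall>u v w. D u v w = B (\<Gamma> u v) w + B v (\<Gamma> u w))"
proof -
  have l1: "linear (\<lambda>z. B z w)" for w using B by (auto simp: bilinear_def)
  define K where "K = (\<lambda>u v w. (D u v w + D v u w - D w u v) / 2)"
  have D3: "linear (D u v)" for u v
  proof -
    have "D u v = (\<lambda>w. D u w v)" using Dsym by blast
    then show ?thesis using D2[of u v] by simp
  qed
  have lK3: "linear (K u v)" for u v
    unfolding K_def using D1 D3 D2 by (auto simp: linear_iff algebra_simps add_divide_distrib diff_divide_distrib)
  have lK2: "linear (\<lambda>v. K u v w)" for u w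
    unfolding K_def using D1 D3 D2 by (auto simp: linear_iff algebra_simps add_divide_distrib diff_divide_distrib)
  have Ksym: "K u v w = K v u w" for u v w
    unfolding K_def using Dsym[of w u v] by simp
  define G where "G = (\<lambda>u v. THE z. \<forall>w. B z w = K u v w)"
  have G: "B (G u v) w = K u v w" for u v w
    unfolding G_def using theI'[OF bilinear_representation[OF B pos lK3, of u v]] by blast
  have Gu: "z = G u v" if "\<And>w. B z w = K u v w" for z u v
    using bilinear_representation[OF B pos lK3, of u v] G that by blast
  have Gsym: "G u v = G v u" for u v by (rule Gu) (simp add: G Ksym[of u v])
  have "linear (G u)" for u
  proof (rule linearI)
    show "G u (v + w) = G u v + G u w" for v w
      by (rule Gu[symmetric]) (simp add: linear_add[OF l1] G linear_add[OF lK2])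
    show "G u (r *\<^sub>R v) = r *\<^sub>R G u v" for r v
      by (rule Gu[symmetric]) (simp add: linear_cmul[OF l1] G linear_cmul[OF lK2])
  qed
  then have "bilinear G" unfolding bilinear_def using Gsym by (metis (no_types, lifting) ext)
  moreover have "D u v w = B (G u v) w + B v (G u w)" for u v w
    unfolding sym[of v] G K_def using Dsym[of u v w] Dsym[of w u v] Dsym[of v u w] by (simp add: field_simps)
  moreover have "\<Gamma> = G" if "bilinear \<Gamma>" "\<forall>u v. \<Gamma> u v = \<Gamma> v u"
    "\<forall>u v w. D u v w = B (\<Gamma> u v) w + B v (\<Gamma> u w)" for \<Gamma>
  proof (intro ext Gu)
    fix u v w
    have s: "\<Gamma> v u = \<Gamma> u v" "\<Gamma> w u = \<Gamma> u w" "\<Gamma> w v = \<Gamma> v w" using that(2) by metis+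
    show "B (\<Gamma> u v) w = K u v w"
      unfolding K_def that(3)[rule_format] s sym[of u "\<Gamma> v w"] sym[of v "\<Gamma> u w"] by simp
  qed
  ultimately show ?thesis using Gsym by (intro ex1I[of _ G]) blast+
qed

lemma riemannian_sym:
  "riemannian_metric A g \<Longrightarrow> p \<in> points A \<Longrightarrow> X \<in> tangent_space A p \<Longrightarrow> Y \<in> tangent_space A p \<Longrightarrow>
    g p X Y = g p Y X"
  unfolding riemannian_metric_def by blast

lemma riemannian_linear:
  "riemannian_metric A g \<Longrightarrow> p \<in> points A \<Longrightarrow> X \<in> tangent_space A p \<Longrightarrow> linear_on_tangent A p (g p X)"
  unfolding riemannian_metric_def by blast

lemma riemannian_bilinear:
  assumes A: "smooth_manifold A" and g: "riemannian_metric A g" and p: "p \<in> points A"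
  shows "bilinear_form_at A g p"
proof -
  note [simp] = tadd_in[OF A chart_at_in[OF p]] tscale_in[OF A chart_at_in[OF p]]
  have lin: "g p X (tadd Y Z) = g p X Y + g p X Z" "g p X (tscale r Y) = r * g p X Y"
    if "X \<in> tangent_space A p" "Y \<in> tangent_space A p" "Z \<in> tangent_space A p" for X Y Z r
    using riemannian_linear[OF g p that(1)] that by (auto simp: linear_on_tangent_def)
  have "g p (tadd Y Z) X = g p Y X + g p Z X" "g p (tscale r Y) X = r * g p Y X"
    if "X \<in> tangent_space A p" "Y \<in> tangent_space A p" "Z \<in> tangent_space A p" for X Y Z r
    using that lin[OF that] riemannian_sym[OF g p that(1)] by simp_all
  with lin show ?thesis
    unfolding bilinear_form_at_def linear_on_tangent_def by blast
qed

locale metric_chart =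
  fixes A :: "('m::{t2_space, second_countable_topology}, 'e::euclidean_space) atlas"
    and g :: "('m, 'e) metric" and c :: "('m, 'e) chart"
  assumes A: "smooth_manifold A" and g: "riemannian_metric A g" and c: "c \<in> A"
begin

abbreviation "G \<equiv> local_metric A g c"

lemma op: "open (cimg c)" by (rule open_cimg[OF A c])

lemma pt: "x \<in> cimg c \<Longrightarrow> cinv c x \<in> points A"
  using cinv_in[OF A c] c by (auto simp: points_def)

lemma G_bilinear: "x \<in> cimg c \<Longrightarrow> bilinear (G x)"
  by (intro bilinear_local_metric[OF A c] riemannian_bilinear[OF A g] pt)

lemma G_sym: "x \<in> cimg c \<Longrightarrow> G x v w = G x w v"
  using g pt cfield_in[OF A c] unfolding local_metric_def riemannian_metric_def by blast

lemma G_pos: "x \<in> cimg c \<Longrightarrow> v \<noteq> 0 \<Longrightarrow> G x v v > 0"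
  using g pt[of x] cfield_in[OF A c, of x v] tvec_eq_tzero[OF A cinv_charts_at[OF A c], of x v]
  unfolding local_metric_def riemannian_metric_def cfield_def by blast

lemma G_smooth: "smooth_on (cimg c) (\<lambda>x. G x v w)"
  using g c unfolding riemannian_metric_def local_metric_def by blast

lemma G_differentiable: "x \<in> cimg c \<Longrightarrow> (\<lambda>y. G y v w) differentiable (at x)"
  by (rule smooth_on_differentiable[OF G_smooth])

lemma G_derivative_linear:
  assumes x: "x \<in> cimg c"
  shows "linear (\<lambda>u. frechet_derivative (\<lambda>y. G y v w) (at x) u)"
    and "linear (\<lambda>v. frechet_derivative (\<lambda>y. G y v w) (at x) u)"
    and "frechet_derivative (\<lambda>y. G y v w) (at x) u = frechet_derivative (\<lambda>y. G y w v) (at x) u"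
proof -
  show "linear (\<lambda>u. frechet_derivative (\<lambda>y. G y v w) (at x) u)"
    by (rule linear_frechet_derivative[OF G_differentiable[OF x]])
  show "linear (\<lambda>v. frechet_derivative (\<lambda>y. G y v w) (at x) u)"
    using G_bilinear by (intro linear_frechet_param[OF op x] G_differentiable[OF x]) (auto simp: bilinear_def)
  show "frechet_derivative (\<lambda>y. G y v w) (at x) u = frechet_derivative (\<lambda>y. G y w v) (at x) u"
    by (subst frechet_derivative_cong_open[OF op x G_sym]) auto
qed

lemma christoffel:
  assumes x: "x \<in> cimg c"
  shows "bilinear (christoffel A g c x)" "christoffel A g c x u v = christoffel A g c x v u"
    "frechet_derivative (\<lambda>y. G y v w) (at x) u = G x (christoffel A g c x u v) w + G x v (christoffel A g c x u w)"
proof -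
  let ?D = "\<lambda>u v w. frechet_derivative (\<lambda>y. G y v w) (at x) u"
  have "\<exists>!\<Gamma>. bilinear \<Gamma> \<and> (\<forall>u v. \<Gamma> u v = \<Gamma> v u) \<and> (\<forall>u v w. ?D u v w = G x (\<Gamma> u v) w + G x v (\<Gamma> u w))"
    by (rule koszul[OF G_bilinear[OF x] G_sym[OF x] G_pos[OF x]]) (use G_derivative_linear[OF x] in blast)+
  from theI'[OF this]
  show "bilinear (christoffel A g c x)" "christoffel A g c x u v = christoffel A g c x v u"
    "?D u v w = G x (christoffel A g c x u v) w + G x v (christoffel A g c x u w)"
    unfolding christoffel_def by blast+
qed

end

section \<open>Nearly Kaehler manifolds\<close>

lemma local_metric_apply:
  assumes "smooth_manifold A" "c \<in> charts_at A p" "X \<in> tangent_space A p" "Y \<in> tangent_space A p"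
  shows "local_metric A \<eta> c (cmap c p) (X c) (Y c) = \<eta> p X Y"
  using charts_atD[OF assms(2)]
  by (simp add: local_metric_def cfield_cmap[OF assms(1,2)] cinv_cmap[OF assms(1)]
      tvec_of_tangent[OF assms(3,2)] tvec_of_tangent[OF assms(4,2)])

locale almost_hermitian_mfd =
  fixes M :: "('m::{t2_space, second_countable_topology}, 'e::euclidean_space) atlas"
    and J :: "('m, 'e) endo" and g :: "('m, 'e) metric"
  assumes ah: "almost_hermitian M J g"
begin

abbreviation "\<omega> \<equiv> fundamental_form J g"

lemma M: "smooth_manifold M" and g: "riemannian_metric M g"
  using ah by (auto simp: almost_hermitian_def)

context
  fixes p assumes p: "p \<in> points M"
begin

lemma J_in: "X \<in> tangent_space M p \<Longrightarrow> J p X \<in> tangent_space M p"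
  using ah p unfolding almost_hermitian_def by blast

lemma J_J: "X \<in> tangent_space M p \<Longrightarrow> J p (J p X) = tscale (-1) X"
  using ah p unfolding almost_hermitian_def by blast

lemma J_add: "X \<in> tangent_space M p \<Longrightarrow> Y \<in> tangent_space M p \<Longrightarrow> J p (tadd X Y) = tadd (J p X) (J p Y)"
  using ah p unfolding almost_hermitian_def by blast

lemma J_scale: "X \<in> tangent_space M p \<Longrightarrow> J p (tscale r X) = tscale r (J p X)"
  using ah p unfolding almost_hermitian_def by blast

lemma J_iso: "X \<in> tangent_space M p \<Longrightarrow> Y \<in> tangent_space M p \<Longrightarrow> g p (J p X) (J p Y) = g p X Y"
  using ah p unfolding almost_hermitian_def by blast

lemma tangent_add: "X \<in> tangent_space M p \<Longrightarrow> Y \<in> tangent_space M p \<Longrightarrow> tadd X Y \<in> tangent_space M p"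
  by (rule tadd_in[OF M chart_at_in[OF p]])

lemma tangent_scale: "X \<in> tangent_space M p \<Longrightarrow> tscale r X \<in> tangent_space M p"
  by (rule tscale_in[OF M chart_at_in[OF p]])

lemma g_sym: "X \<in> tangent_space M p \<Longrightarrow> Y \<in> tangent_space M p \<Longrightarrow> g p X Y = g p Y X"
  by (rule riemannian_sym[OF g p])

lemma g_add:
  assumes "X \<in> tangent_space M p" "Y \<in> tangent_space M p" "Z \<in> tangent_space M p"
  shows "g p X (tadd Y Z) = g p X Y + g p X Z" "g p (tadd Y Z) X = g p Y X + g p Z X"
  using riemannian_bilinear[OF M g p] assms
  by (auto simp: bilinear_form_at_def linear_on_tangent_def)

lemma g_scale:
  assumes "X \<in> tangent_space M p" "Y \<in> tangent_space M p"
  shows "g p X (tscale r Y) = r * g p X Y" "g p (tscale r Y) X = r * g p Y X"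
  using riemannian_bilinear[OF M g p] assms
  by (auto simp: bilinear_form_at_def linear_on_tangent_def)

lemma g_pos: "X \<in> tangent_space M p \<Longrightarrow> X \<noteq> tzero \<Longrightarrow> g p X X > 0"
  using g p unfolding riemannian_metric_def by blast

lemma J_skew:
  assumes "X \<in> tangent_space M p" "Y \<in> tangent_space M p"
  shows "g p (J p X) Y = - g p X (J p Y)"
  using J_iso[OF J_in[OF assms(1)] assms(2)] J_J[OF assms(1)] g_scale(2)[OF J_in[OF assms(2)] assms(1), of "-1"]
  by simp

lemma omega_alt:
  assumes "X \<in> tangent_space M p" "Y \<in> tangent_space M p"
  shows "\<omega> p X Y = - \<omega> p Y X"
  using J_skew[OF assms] g_sym[OF assms(1) J_in[OF assms(2)]] by (simp add: fundamental_form_def)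

lemma omega_bilinear: "bilinear_form_at M \<omega> p"
  unfolding bilinear_form_at_def linear_on_tangent_def fundamental_form_def
  by (auto simp: g_add g_scale J_in J_add J_scale tangent_add tangent_scale)

end

end

locale almost_hermitian_chart = almost_hermitian_mfd M J g
  for M :: "('m::{t2_space, second_countable_topology}, 'e::euclidean_space) atlas" and J g +
  fixes c :: "('m, 'e) chart"
  assumes c: "c \<in> M"

sublocale almost_hermitian_chart \<subseteq> metric_chart M g c
  using c M g by unfold_locales

context almost_hermitian_chart
begin

definition Jc :: "'e \<Rightarrow> 'e \<Rightarrow> 'e" where
  "Jc x v = J (cinv c x) (cfield M c v x) c"

abbreviation "Om \<equiv> local_metric M \<omega> c"

lemma cf: "x \<in> cimg c \<Longrightarrow> cfield M c v x \<in> tangent_space M (cinv c x)"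
  by (rule cfield_in[OF M c])

lemma ca: "x \<in> cimg c \<Longrightarrow> c \<in> charts_at M (cinv c x)"
  by (rule cinv_charts_at[OF M c])

lemma cfield_eq: "x \<in> cimg c \<Longrightarrow> X \<in> tangent_space M (cinv c x) \<Longrightarrow> cfield M c (X c) x = X"
  unfolding cfield_def by (rule tvec_of_tangent[OF _ ca])

lemma J_cfield: "x \<in> cimg c \<Longrightarrow> J (cinv c x) (cfield M c v x) = cfield M c (Jc x v) x"
  unfolding Jc_def by (rule cfield_eq[symmetric]) (auto intro: J_in pt cf)

lemma cfield_add: "x \<in> cimg c \<Longrightarrow> cfield M c (v + w) x = tadd (cfield M c v x) (cfield M c w x)"
  unfolding cfield_def by (rule tvec_add[OF M ca])

lemma cfield_scale: "x \<in> cimg c \<Longrightarrow> cfield M c (r *\<^sub>R v) x = tscale r (cfield M c v x)"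
  unfolding cfield_def by (rule tvec_scale[OF M ca])

lemma Jc_linear: assumes x: "x \<in> cimg c" shows "linear (Jc x)"
  unfolding Jc_def
  by (rule linearI) (simp_all add: x cfield_add cfield_scale J_add[OF pt] J_scale[OF pt] cf)

lemma Jc_smooth: "smooth_on (cimg c) (\<lambda>x. Jc x v)"
  unfolding Jc_def using ah c unfolding almost_hermitian_def by blast

lemma Om_eq: "x \<in> cimg c \<Longrightarrow> Om x v w = G x (Jc x v) w"
  by (simp add: local_metric_def fundamental_form_def J_cfield)

lemma Om_alt: "x \<in> cimg c \<Longrightarrow> Om x v w = - Om x w v"
  unfolding local_metric_def by (intro omega_alt pt cf)

lemma Om_bilinear: "x \<in> cimg c \<Longrightarrow> bilinear (Om x)"
  by (intro bilinear_local_metric[OF M c] omega_bilinear pt)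

lemma Om_smooth: "smooth_on (cimg c) (\<lambda>x. Om x v w)"
proof -
  have "smooth_on (cimg c) (\<lambda>x. G x (Jc x v) w)"
    using G_bilinear
    by (intro smooth_on_linear_eval[OF op _ _ Jc_smooth, of "\<lambda>x v. G x v w"] G_smooth) (auto simp: bilinear_def)
  then show ?thesis
    using smooth_on_cong[OF op, of "\<lambda>x. Om x v w" "\<lambda>x. G x (Jc x v) w"] Om_eq by blast
qed

text \<open>The coordinates of (nabla_u J) v, with v extended as a constant field;
  \<open>nabla_J\<close> is this expression in the chart \<open>chart_at\<close>.\<close>

definition Nc :: "'e \<Rightarrow> 'e \<Rightarrow> 'e \<Rightarrow> 'e" where
  "Nc x u v = frechet_derivative (\<lambda>y. Jc y v) (at x) u + christoffel M g c x u (Jc x v) -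
     Jc x (christoffel M g c x u v)"

lemma Nc_linear:
  assumes x: "x \<in> cimg c"
  shows "linear (\<lambda>u. Nc x u v)" "linear (Nc x u)"
proof -
  note chr = christoffel(1)[OF x, unfolded bilinear_def]
  have 1: "linear (\<lambda>u. frechet_derivative (\<lambda>y. Jc y v) (at x) u)" for v
    by (rule linear_frechet_derivative[OF smooth_on_differentiable[OF Jc_smooth x]])
  have 2: "linear (\<lambda>v. frechet_derivative (\<lambda>y. Jc y v) (at x) u)" for u
    by (rule linear_frechet_param[OF op x Jc_linear smooth_on_differentiable[OF Jc_smooth x]])
  show "linear (\<lambda>u. Nc x u v)" "linear (Nc x u)"
    unfolding Nc_def using 1[of v] 2[of u] chr Jc_linear[OF x]
    by (auto simp: linear_iff algebra_simps)
qed

text \<open>This is (nabla_u \<omega>)(v, w) = g((nabla_u J) v, w) with the covariant derivative of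
  \<omega> spelled out; it comes from the Leibniz rule for g(Jv, w) and metric
  compatibility.\<close>

lemma Om_derivative:
  assumes x: "x \<in> cimg c"
  shows "frechet_derivative (\<lambda>y. Om y v w) (at x) u =
     G x (Nc x u v) w + Om x (christoffel M g c x u v) w + Om x v (christoffel M g c x u w)"
proof -
  have b: "linear (\<lambda>v. G x v w)" for w using G_bilinear[OF x] by (simp add: bilinear_def)
  have "((\<lambda>y. G y (Jc y v) w) has_derivative (\<lambda>h. frechet_derivative (\<lambda>y. G y (Jc x v) w) (at x) h +
      G x (frechet_derivative (\<lambda>y. Jc y v) (at x) h) w)) (at x)"
    using G_bilinear
    by (intro has_derivative_linear_eval[OF op x, of "\<lambda>x v. G x v w"] G_differentiable[OF x]
        smooth_on_has_derivative[OF Jc_smooth x]) (auto simp: bilinear_def)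
  moreover have "frechet_derivative (\<lambda>y. Om y v w) (at x) = frechet_derivative (\<lambda>y. G y (Jc y v) w) (at x)"
    by (rule frechet_derivative_cong_open[OF op x Om_eq])
  ultimately have "frechet_derivative (\<lambda>y. Om y v w) (at x) =
      (\<lambda>h. frechet_derivative (\<lambda>y. G y (Jc x v) w) (at x) h +
      G x (frechet_derivative (\<lambda>y. Jc y v) (at x) h) w)"
    using frechet_derivative_eqI by (simp only:)
  then show ?thesis
    by (simp add: Nc_def christoffel(3)[OF x] linear_add[OF b] linear_diff[OF b] Om_eq[OF x])
qed

text \<open>The alternation of nabla \<omega>: the Christoffel terms cancel because the connection
  is torsion-free and \<omega> is alternating.\<close>

lemma Om_ext_deriv:
  assumes x: "x \<in> cimg c"
  shows "ext_deriv2 Om x u v w = G x (Nc x u v) w - G x (Nc x v u) w + G x (Nc x w u) v"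
  unfolding ext_deriv2_def Om_derivative[OF x]
  using Om_alt[OF x, of "christoffel M g c x v w" u] Om_alt[OF x, of "christoffel M g c x u w" v]
  by (simp add: christoffel(2)[OF x, of v u] christoffel(2)[OF x, of w u] christoffel(2)[OF x, of w v]
      Om_alt[OF x, of u])

text \<open>Differentiating the alternation of \<omega>: the Christoffel terms on the two sides
  match.\<close>

lemma Nc_skew:
  assumes x: "x \<in> cimg c"
  shows "G x (Nc x u v) w = - G x (Nc x u w) v"
proof -
  have "frechet_derivative (\<lambda>y. Om y v w) (at x) = frechet_derivative (\<lambda>y. - Om y w v) (at x)"
    by (rule frechet_derivative_cong_open[OF op x Om_alt])
  also have "\<dots> = (\<lambda>u. - frechet_derivative (\<lambda>y. Om y w v) (at x) u)"
    by (rule frechet_derivative_eqI[OF has_derivative_minus[OF smooth_on_has_derivative[OF Om_smooth x]]])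
  finally have "frechet_derivative (\<lambda>y. Om y v w) (at x) u = - frechet_derivative (\<lambda>y. Om y w v) (at x) u"
    by (rule fun_cong)
  then show ?thesis
    unfolding Om_derivative[OF x]
    using Om_alt[OF x, of "christoffel M g c x u w" v] Om_alt[OF x, of "christoffel M g c x u v" w] by simp
qed

end

context almost_hermitian_mfd
begin

context
  fixes p assumes p: "p \<in> points M"
begin

interpretation ch: almost_hermitian_chart M J g "chart_at M p"
  using charts_atD[OF chart_at_in[OF p]] by unfold_locales simp

abbreviation "coord \<equiv> cmap (chart_at M p) p"

lemma coord: "coord \<in> cimg (chart_at M p)" "cinv (chart_at M p) coord = p"
  using charts_atD[OF chart_at_in[OF p]] by (auto simp: cinv_cmap[OF M])

lemma nabla_J_eq: "nabla_J M g J p X Y = tvec M (chart_at M p) p (ch.Nc coord (X (chart_at M p)) (Y (chart_at M p)))"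
  unfolding nabla_J_def ch.Nc_def ch.Jc_def by (simp add: Let_def)

lemma nabla_J_in: "nabla_J M g J p X Y \<in> tangent_space M p"
  unfolding nabla_J_eq by (rule tvec_in[OF M chart_at_in[OF p]])

lemma g_nabla_J:
  assumes "Z \<in> tangent_space M p"
  shows "g p (nabla_J M g J p X Y) Z =
     ch.G coord (ch.Nc coord (X (chart_at M p)) (Y (chart_at M p))) (Z (chart_at M p))"
  using local_metric_apply[OF M chart_at_in[OF p] nabla_J_in assms, of g X Y]
  by (simp add: nabla_J_eq tvec_apply[OF M chart_at_in[OF p]])

lemma nabla_J_skew:
  assumes "Y \<in> tangent_space M p" "Z \<in> tangent_space M p"
  shows "g p (nabla_J M g J p X Y) Z = - g p (nabla_J M g J p X Z) Y"
  unfolding g_nabla_J[OF assms(1)] g_nabla_J[OF assms(2)] by (rule ch.Nc_skew[OF coord(1)])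

lemma d2_omega:
  assumes "X \<in> tangent_space M p" "Y \<in> tangent_space M p" "Z \<in> tangent_space M p"
  shows "d2 M \<omega> p X Y Z = g p (nabla_J M g J p X Y) Z - g p (nabla_J M g J p Y X) Z + g p (nabla_J M g J p Z X) Y"
  unfolding g_nabla_J[OF assms(3)] g_nabla_J[OF assms(2)] ch.Om_ext_deriv[OF coord(1), symmetric]
  by (rule d2_chart[OF M chart_at_in[OF p] assms omega_bilinear omega_alt
      smooth_on_differentiable[OF ch.Om_smooth coord(1)]])

text \<open>Polarisation of (nabla_V J) V = 0 at V = X + Y.\<close>

lemma nabla_J_antisym:
  assumes nk: "nearly_kaehler M J g" and X: "X \<in> tangent_space M p" and Y: "Y \<in> tangent_space M p"
    and Z: "Z \<in> tangent_space M p"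
  shows "g p (nabla_J M g J p X Y) Z = - g p (nabla_J M g J p Y X) Z"
proof -
  let ?c = "chart_at M p"
  have "ch.Nc coord (V ?c) (V ?c) = 0" if "V \<in> tangent_space M p" for V
  proof -
    have "nabla_J M g J p V V = tzero" using nk p that by (simp add: nearly_kaehler_def)
    then show ?thesis unfolding nabla_J_eq using tvec_eq_tzero[OF M chart_at_in[OF p]] by blast
  qed
  from this[OF tangent_add[OF p X Y]] this[OF X] this[OF Y]
  have "ch.Nc coord (X ?c) (Y ?c) + ch.Nc coord (Y ?c) (X ?c) = 0"
    by (simp add: add.commute linear_add[OF ch.Nc_linear(1)[OF coord(1)]] linear_add[OF ch.Nc_linear(2)[OF coord(1)]])
  then have "ch.Nc coord (X ?c) (Y ?c) = - ch.Nc coord (Y ?c) (X ?c)" by (simp add: eq_neg_iff_add_eq_0)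
  then show ?thesis
    unfolding g_nabla_J[OF Z]
    using linear_neg[of "\<lambda>v. ch.G coord v (Z ?c)"] ch.G_bilinear[OF coord(1)] by (simp add: bilinear_def)
qed

text \<open>The form g((nabla_X J) Y, Z) is skew in both adjacent pairs of arguments, so the three
  terms of \<open>d2_omega\<close> coincide.\<close>

lemma d2_omega_nearly_kaehler:
  assumes nk: "nearly_kaehler M J g" and X: "X \<in> tangent_space M p" and Y: "Y \<in> tangent_space M p"
    and Z: "Z \<in> tangent_space M p"
  shows "d2 M \<omega> p X Y Z = 3 * g p (nabla_J M g J p X Y) Z"
  unfolding d2_omega[OF X Y Z]
  using nabla_J_antisym[OF nk X Y Z] nabla_J_antisym[OF nk Z X Y] nabla_J_skew[OF Z Y, of X] by simp

text \<open>With \<open>Y = JX\<close> the constant type condition gives \<open>(\<nabla>\<^sub>X J) JX = 0\<close>, without differentiating \<open>J\<^sup>2 = -1\<close>.\<close>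

lemma nabla_J_J:
  assumes ct: "constant_type M J g l" and X: "X \<in> tangent_space M p"
  shows "nabla_J M g J p X (J p X) = tzero"
proof -
  have "g p (nabla_J M g J p X (J p X)) (nabla_J M g J p X (J p X)) =
      l\<^sup>2 * (g p X X * g p (J p X) (J p X) - (g p X (J p X))\<^sup>2 - (g p X (J p (J p X)))\<^sup>2)"
    using ct p X J_in[OF p X] unfolding constant_type_def by blast
  moreover have "g p X (J p X) = 0"
    using J_skew[OF p X X] g_sym[OF p X J_in[OF p X]] by simp
  ultimately have "g p (nabla_J M g J p X (J p X)) (nabla_J M g J p X (J p X)) = 0"
    using J_iso[OF p X X] J_J[OF p X] g_scale(1)[OF p X X, of "-1"] by (simp add: power2_eq_square)
  then show ?thesis using g_pos[OF p nabla_J_in] by fastforce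
qed

end

end

section \<open>Linear algebra in three dimensions\<close>

text \<open>An orthonormal family of the right size is independent and hence spans; the difference
  of both sides is orthogonal to the span and so to itself. The free index set admits three frame
  vectors on L as well as the index type \<open>bool \<times> 3\<close> on M.\<close>

lemma orthonormal_expansion:
  fixes B :: "'a::euclidean_space \<Rightarrow> 'a \<Rightarrow> real" and E :: "'i \<Rightarrow> 'a"
  assumes B: "bilinear B" and pos: "\<And>v. v \<noteq> 0 \<Longrightarrow> B v v > 0"
    and I: "finite I" "card I = DIM('a)"
    and E: "\<And>i j. i \<in> I \<Longrightarrow> j \<in> I \<Longrightarrow> B (E i) (E j) = (if i = j then 1 else 0)"
  shows "v = (\<Sum>i\<in>I. B v (E i) *\<^sub>R E i)"
proof -
  have l1: "linear (\<lambda>z. B z w)" and l2: "linear (B z)" for z w using B by (auto simp: bilinear_def)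
  have sum1: "B (\<Sum>i\<in>I. a i *\<^sub>R E i) (E j) = a j" if "j \<in> I" for a j
  proof -
    have "B (\<Sum>i\<in>I. a i *\<^sub>R E i) (E j) = (\<Sum>i\<in>I. a i * B (E i) (E j))"
      by (simp add: linear_sum[OF l1] linear_cmul[OF l1])
    also have "\<dots> = (\<Sum>i\<in>I. if i = j then a i else 0)" using E that by (intro sum.cong) auto
    finally show ?thesis using I that by simp
  qed
  have inj: "inj_on E I"
  proof (rule inj_onI)
    fix i j assume "i \<in> I" "j \<in> I" "E i = E j"
    then show "i = j" using E[of i i] E[of i j] by (auto split: if_splits)
  qed
  have "independent (E ` I)"
  proof (rule independent_if_scalars_zero)
    fix f x assume s: "(\<Sum>x\<in>E ` I. f x *\<^sub>R x) = 0" and "x \<in> E ` I"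
    then obtain j where j: "j \<in> I" "x = E j" by blast
    have "(\<Sum>i\<in>I. f (E i) *\<^sub>R E i) = 0" using s inj by (simp add: sum.reindex)
    then show "f x = 0" using sum1[OF j(1), of "\<lambda>i. f (E i)"] j linear_0[OF l1] by simp
  qed (use I in simp)
  moreover have "card (E ` I) = DIM('a)" using inj I by (simp add: card_image)
  ultimately have "span (E ` I) = UNIV"
    using card_ge_dim_independent[of "E ` I" UNIV] by auto
  define r where "r = v - (\<Sum>i\<in>I. B v (E i) *\<^sub>R E i)"
  have rE: "B r (E j) = 0" if "j \<in> I" for j
    unfolding r_def by (simp add: linear_diff[OF l1] sum1[OF that])
  have "B r w = 0" if "w \<in> span (E ` I)" for w
    using that by (induction rule: span_induct_alt)
      (auto simp: linear_0[OF l2] linear_add[OF l2] linear_cmul[OF l2] rE)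
  then have "B r r = 0" using \<open>span (E ` I) = UNIV\<close> by blast
  then have "r = 0" using pos by force
  then show ?thesis by (simp add: r_def)
qed

lemma orthonormal_parseval:
  fixes B :: "'a::euclidean_space \<Rightarrow> 'a \<Rightarrow> real" and E :: "'i \<Rightarrow> 'a"
  assumes B: "bilinear B" and pos: "\<And>v. v \<noteq> 0 \<Longrightarrow> B v v > 0"
    and I: "finite I" "card I = DIM('a)"
    and E: "\<And>i j. i \<in> I \<Longrightarrow> j \<in> I \<Longrightarrow> B (E i) (E j) = (if i = j then 1 else 0)"
  shows "B v w = (\<Sum>i\<in>I. B v (E i) * B w (E i))"
proof -
  have l2: "linear (B z)" for z using B by (auto simp: bilinear_def)
  have sum2: "B z (\<Sum>i\<in>I. a i *\<^sub>R E i) = (\<Sum>i\<in>I. a i * B z (E i))" for a z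
    by (simp add: linear_sum[OF l2] linear_cmul[OF l2])
  have "B v w = B v (\<Sum>i\<in>I. B w (E i) *\<^sub>R E i)"
    using orthonormal_expansion[OF B pos I E, of w] by simp
  then show ?thesis by (simp add: sum2 mult.commute)
qed

lemma gram_schmidt_3:
  fixes B :: "real ^ 3 \<Rightarrow> real ^ 3 \<Rightarrow> real"
  assumes B: "bilinear B" and sym: "\<And>v w. B v w = B w v" and pos: "\<And>v. v \<noteq> 0 \<Longrightarrow> B v v > 0"
  shows "\<exists>e :: 3 \<Rightarrow> real ^ 3. \<forall>i j. B (e i) (e j) = (if i = j then 1 else 0)"
proof -
  have l1: "linear (\<lambda>z. B z w)" and l2: "linear (B z)" for z w using B by (auto simp: bilinear_def)
  note lin = linear_diff[OF l1] linear_diff[OF l2] linear_cmul[OF l1] linear_cmul[OF l2]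
  define u1 :: "real ^ 3" where "u1 = axis 1 1"
  define u2 where "u2 = axis 2 1 - (B u1 (axis 2 1) / B u1 u1) *\<^sub>R u1"
  define u3 where "u3 = axis 3 1 - (B u1 (axis 3 1) / B u1 u1) *\<^sub>R u1 - (B u2 (axis 3 1) / B u2 u2) *\<^sub>R u2"
  \<comment> \<open>Subtracting multiples of earlier vectors leaves the k-th coordinate of the k-th
    vector equal to 1, which makes it nonzero.\<close>
  have "u1 $ 1 = 1" by (simp add: u1_def)
  then have "u1 \<noteq> 0" by auto
  have "u2 $ 2 = 1" by (simp add: u1_def u2_def axis_def)
  then have "u2 \<noteq> 0" by auto
  have "u3 $ 3 = 1" by (simp add: u1_def u2_def u3_def axis_def)
  then have "u3 \<noteq> 0" by auto
  have p: "B u1 u1 > 0" "B u2 u2 > 0" "B u3 u3 > 0" using pos \<open>u1 \<noteq> 0\<close> \<open>u2 \<noteq> 0\<close> \<open>u3 \<noteq> 0\<close> by auto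
  have "B u1 u2 = B u1 (axis 2 1) - (B u1 (axis 2 1) / B u1 u1) * B u1 u1" by (simp add: u2_def lin)
  then have o12: "B u1 u2 = 0" using p by simp
  have "B u1 u3 = B u1 (axis 3 1) - (B u1 (axis 3 1) / B u1 u1) * B u1 u1 - (B u2 (axis 3 1) / B u2 u2) * B u1 u2"
    by (simp add: u3_def lin)
  then have o13: "B u1 u3 = 0" using p o12 by simp
  have "B u2 u3 = B u2 (axis 3 1) - (B u1 (axis 3 1) / B u1 u1) * B u2 u1 - (B u2 (axis 3 1) / B u2 u2) * B u2 u2"
    by (simp add: u3_def lin)
  then have o23: "B u2 u3 = 0" using p o12 sym[of u2 u1] by simp
  define e :: "3 \<Rightarrow> real ^ 3" where "e = (\<lambda>i. if i = 1 then (1 / sqrt (B u1 u1)) *\<^sub>R u1 else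
      if i = 2 then (1 / sqrt (B u2 u2)) *\<^sub>R u2 else (1 / sqrt (B u3 u3)) *\<^sub>R u3)"
  have "\<forall>i j. B (e i) (e j) = (if i = j then 1 else 0)"
    unfolding forall_3 e_def using p o12 o13 o23 sym[of u2 u1] sym[of u3 u1] sym[of u3 u2]
    by (simp add: lin)
  then show ?thesis by blast
qed

text \<open>Linearity is asked for in the first slot; the two adjacent transpositions carry it to
  the others. This fits vol, where the third slot involves J.\<close>

locale alternating3 =
  fixes T :: "'a::real_vector \<Rightarrow> 'a \<Rightarrow> 'a \<Rightarrow> real"
  assumes add1: "T (u + u') v w = T u v w + T u' v w" and scale1: "T (r *\<^sub>R u) v w = r * T u v w"
    and alt12: "T u v w = - T v u w" and alt23: "T u v w = - T u w v"
begin

lemma add2: "T u (v + v') w = T u v w + T u v' w"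
  using alt12[of u "v + v'" w] alt12[of u v w] alt12[of u v' w] add1[of v v' u w] by simp

lemma scale2: "T u (r *\<^sub>R v) w = r * T u v w"
  using alt12[of u "r *\<^sub>R v" w] alt12[of u v w] scale1[of r v u w] by simp

lemma add3: "T u v (w + w') = T u v w + T u v w'"
  using alt23[of u v "w + w'"] alt23[of u v w] alt23[of u v w'] add2[of u w w' v] by simp

lemma scale3: "T u v (r *\<^sub>R w) = r * T u v w"
  using alt23[of u v "r *\<^sub>R w"] alt23[of u v w] scale2[of u r w v] by simp

lemma same [simp]: "T u u w = 0" "T u w w = 0" "T u w u = 0"
  using alt12[of u u w] alt23[of u w w] alt23[of u w u] alt12[of u u w] by auto

text \<open>Cramer's rule: putting \<open>Z\<close> in place of one frame vector isolates its
  coefficient, and the cyclic order avoids signs.\<close>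

lemma frame:
  fixes e :: "3 \<Rightarrow> 'a"
  assumes "Z = a 1 *\<^sub>R e 1 + a 2 *\<^sub>R e 2 + a 3 *\<^sub>R e 3"
  shows "T Z (e 2) (e 3) = a 1 * T (e 1) (e 2) (e 3)" "T Z (e 3) (e 1) = a 2 * T (e 1) (e 2) (e 3)"
    "T Z (e 1) (e 2) = a 3 * T (e 1) (e 2) (e 3)"
  unfolding assms add1 scale1
  using alt12[of "e 2" "e 3" "e 1"] alt23[of "e 3" "e 2" "e 1"] alt12[of "e 3" "e 1" "e 2"] 
    alt23[of "e 1" "e 3" "e 2"] alt12[of "e 2" "e 1" "e 3"] alt23[of "e 2" "e 3" "e 1"] by simp_all

end

definition vdet :: "real ^ 3 \<Rightarrow> real ^ 3 \<Rightarrow> real ^ 3 \<Rightarrow> real" where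
  "vdet u v w = u $ 1 * (v $ 2 * w $ 3 - v $ 3 * w $ 2) - u $ 2 * (v $ 1 * w $ 3 - v $ 3 * w $ 1) +
     u $ 3 * (v $ 1 * w $ 2 - v $ 2 * w $ 1)"

interpretation vdet: alternating3 vdet
  by unfold_locales (simp_all add: vdet_def algebra_simps)

lemma axis_expansion_3: "(u::real ^ 3) = u $ 1 *\<^sub>R axis 1 1 + u $ 2 *\<^sub>R axis 2 1 + u $ 3 *\<^sub>R axis 3 1"
  by (simp add: vec_eq_iff forall_3 axis_def)

lemma alternating3_eq_vdet:
  assumes "alternating3 T"
  shows "T u v w = T (axis 1 1) (axis 2 1) (axis 3 1) * vdet u v w"
proof -
  interpret alternating3 T by fact
  let ?a = "axis 1 1 :: real ^ 3" and ?b = "axis 2 1 :: real ^ 3" and ?c = "axis 3 1 :: real ^ 3"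
  have p: "T ?b ?c ?a = T ?a ?b ?c" "T ?c ?a ?b = T ?a ?b ?c" "T ?a ?c ?b = - T ?a ?b ?c"
    "T ?b ?a ?c = - T ?a ?b ?c" "T ?c ?b ?a = - T ?a ?b ?c"
    using alt12[of ?b ?c ?a] alt23[of ?c ?b ?a] alt12[of ?c ?a ?b] alt23[of ?a ?c ?b] alt12[of ?b ?a ?c]
      alt23[of ?b ?c ?a] by simp_all
  have "T u v w = T (u $ 1 *\<^sub>R ?a + u $ 2 *\<^sub>R ?b + u $ 3 *\<^sub>R ?c) (v $ 1 *\<^sub>R ?a + v $ 2 *\<^sub>R ?b + v $ 3 *\<^sub>R ?c)
      (w $ 1 *\<^sub>R ?a + w $ 2 *\<^sub>R ?b + w $ 3 *\<^sub>R ?c)"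
    using axis_expansion_3 by metis
  also have "\<dots> = T ?a ?b ?c * vdet u v w"
    unfolding add1 add2 add3 scale1 scale2 scale3 p same vdet_def by (simp add: algebra_simps)
  finally show ?thesis .
qed

section \<open>Lagrangian submanifolds\<close>

text \<open>Smoothness is local. This is used because the domain of a chart of L need not lie in a
  single chart of M.\<close>

lemma Ck_on_local:
  assumes "\<And>x. x \<in> S \<Longrightarrow> \<exists>U. open U \<and> x \<in> U \<and> Ck_on k U f"
  shows "Ck_on k S f"
  using assms
proof (induction k arbitrary: f)
  case 0
  then have "isCont f x" if "x \<in> S" for x
    using that continuous_on_eq_continuous_at by (metis Ck_on.simps(1))
  then show ?case by (simp add: continuous_at_imp_continuous_on)
next
  case (Suc k)
  have "Ck_on k S (\<lambda>x. frechet_derivative f (at x) v)" for v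
  proof (rule Suc.IH)
    fix x assume "x \<in> S"
    then obtain U where "open U" "x \<in> U" "Ck_on (Suc k) U f" using Suc.prems by blast
    then show "\<exists>U. open U \<and> x \<in> U \<and> Ck_on k U (\<lambda>x. frechet_derivative f (at x) v)" by auto
  qed
  moreover have "f differentiable (at x)" if "x \<in> S" for x using Suc.prems[OF that] by auto
  ultimately show ?case by simp
qed

lemma smooth_on_local:
  assumes "\<And>x. x \<in> S \<Longrightarrow> \<exists>U. open U \<and> x \<in> U \<and> smooth_on U f"
  shows "smooth_on S f"
  unfolding smooth_on_def
proof
  fix k show "Ck_on k S f"
    by (rule Ck_on_local) (use assms in \<open>meson smooth_on_def\<close>)
qed

lemma smooth_on_trilinear_eval:
  fixes \<alpha> :: "'a::euclidean_space \<Rightarrow> 'b::euclidean_space" and \<beta> :: "'a \<Rightarrow> 'c::euclidean_space"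
    and \<gamma> :: "'a \<Rightarrow> 'd::euclidean_space"
  assumes S: "open S" and l1: "\<And>x v w. x \<in> S \<Longrightarrow> linear (\<lambda>u. b x u v w)"
    and l2: "\<And>x u w. x \<in> S \<Longrightarrow> linear (\<lambda>v. b x u v w)" and l3: "\<And>x u v. x \<in> S \<Longrightarrow> linear (\<lambda>w. b x u v w)"
    and sm: "\<And>u v w. smooth_on S (\<lambda>x. b x u v w)" "smooth_on S \<alpha>" "smooth_on S \<beta>" "smooth_on S \<gamma>"
  shows "smooth_on S (\<lambda>x. b x (\<alpha> x) (\<beta> x) (\<gamma> x))"
proof -
  have 1: "smooth_on S (\<lambda>x. b x (\<alpha> x) v w)" for v w
    by (rule smooth_on_linear_eval[OF S l1 sm(1,2)])
  have 2: "smooth_on S (\<lambda>x. b x (\<alpha> x) (\<beta> x) w)" for w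
    by (rule smooth_on_linear_eval[OF S l2 1 sm(3)])
  show ?thesis by (rule smooth_on_linear_eval[OF S l3 2 sm(4)])
qed

lemma (in almost_hermitian_chart) Om_ext_deriv_linear:
  assumes x: "x \<in> cimg c"
  shows "linear (\<lambda>u. ext_deriv2 Om x u v w)" "linear (\<lambda>v. ext_deriv2 Om x u v w)" "linear (ext_deriv2 Om x u v)"
proof -
  have l1: "linear (\<lambda>z. G x z w)" and l2: "linear (G x z)" for z w
    using G_bilinear[OF x] by (auto simp: bilinear_def)
  note lin = linear_add[OF l1] linear_add[OF l2] linear_cmul[OF l1] linear_cmul[OF l2]
    linear_add[OF Nc_linear(1)[OF x]] linear_add[OF Nc_linear(2)[OF x]]
    linear_cmul[OF Nc_linear(1)[OF x]] linear_cmul[OF Nc_linear(2)[OF x]]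
  show "linear (\<lambda>u. ext_deriv2 Om x u v w)" "linear (\<lambda>v. ext_deriv2 Om x u v w)" "linear (ext_deriv2 Om x u v)"
    unfolding Om_ext_deriv[OF x] by (rule linearI; simp add: lin Om_ext_deriv[OF x] algebra_simps)+
qed

lemma (in almost_hermitian_chart) Om_ext_deriv_smooth:
  "smooth_on (cimg c) (\<lambda>x. ext_deriv2 Om x u v w)"
  unfolding ext_deriv2_def by (intro smooth_on_add smooth_on_diff op smooth_on_frechet Om_smooth)

section \<open>The inclusion of L: induced metric and restriction of d\<omega>\<close>

locale lagrangian = almost_hermitian_mfd M J g
  for M :: "('m::{t2_space, second_countable_topology}, real ^ 6) atlas" and J g +
  fixes L :: "('m, real ^ 3) atlas" and l :: real
  assumes nk: "nearly_kaehler M J g" and ct: "constant_type M J g l"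
    and lag: "closed_lagrangian L M J g"
begin

abbreviation "h \<equiv> induced_metric L M g"
abbreviation "vol \<equiv> vol_form L M J g l"

lemma L: "smooth_manifold L" and LM: "points L \<subseteq> points M" and incl_smooth: "smooth_map L M (\<lambda>p. p)"
  and L_compact: "compact (points L)" and L_connected: "connected (points L)"
  using lag by (auto simp: closed_lagrangian_def submanifold_def)

lemma l_pos: "l > 0" using ct by (simp add: constant_type_def)

lemma incl_mdiff: "p \<in> points L \<Longrightarrow> mdifferentiable L M (\<lambda>p. p) p"
  by (rule smooth_map_mdifferentiable[OF L M incl_smooth])

lemma incl_in: "p \<in> points L \<Longrightarrow> incl L M p X \<in> tangent_space M p"
  using differential_in[OF M, of "\<lambda>p. p"] LM by blast

lemma omega_incl:
  "p \<in> points L \<Longrightarrow> X \<in> tangent_space L p \<Longrightarrow> Y \<in> tangent_space L p \<Longrightarrow> \<omega> p (incl L M p X) (incl L M p Y) = 0"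
  using lag by (simp add: closed_lagrangian_def)

lemma incl_inj: "p \<in> points L \<Longrightarrow> X \<in> tangent_space L p \<Longrightarrow> incl L M p X = tzero \<Longrightarrow> X = tzero"
  using lag unfolding closed_lagrangian_def submanifold_def by blast

lemmas incl_add = differential_add[OF L M incl_mdiff]
lemmas incl_scale = differential_scale[OF L M incl_mdiff]

lemma L_add: "p \<in> points L \<Longrightarrow> X \<in> tangent_space L p \<Longrightarrow> Y \<in> tangent_space L p \<Longrightarrow> tadd X Y \<in> tangent_space L p"
  by (rule tadd_in[OF L chart_at_in])

lemma L_scale: "p \<in> points L \<Longrightarrow> X \<in> tangent_space L p \<Longrightarrow> tscale r X \<in> tangent_space L p"
  by (rule tscale_in[OF L chart_at_in])

definition overlap :: "('m, real ^ 3) chart \<Rightarrow> ('m, real ^ 6) chart \<Rightarrow> (real ^ 3) set" where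
  "overlap c d = cmap c ` (cdom c \<inter> cdom d)"

text \<open>The inclusion in coordinates. The identity map is kept in the composite so that the term
  matches \<open>smooth_map\<close> and \<open>differential\<close> literally.\<close>

definition emb :: "('m, real ^ 3) chart \<Rightarrow> ('m, real ^ 6) chart \<Rightarrow> real ^ 3 \<Rightarrow> real ^ 6" where
  "emb c d = cmap d \<circ> (\<lambda>p. p) \<circ> cinv c"

lemma overlap_open: "c \<in> L \<Longrightarrow> d \<in> M \<Longrightarrow> open (overlap c d)"
  using smooth_map_open[OF L M incl_smooth, of c d] by (simp add: overlap_def)

lemma overlapD:
  assumes "c \<in> L" "d \<in> M" "x \<in> overlap c d"
  shows "x \<in> cimg c" "cinv c x \<in> cdom c" "cinv c x \<in> cdom d" "emb c d x \<in> cimg d" "cinv d (emb c d x) = cinv c x"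
    "cinv c x \<in> points L" "cmap c (cinv c x) = x"
  using assms by (auto simp: overlap_def emb_def cinv_cmap[OF L] cinv_cmap[OF M] points_def)

lemma emb_image: "c \<in> L \<Longrightarrow> d \<in> M \<Longrightarrow> emb c d ` overlap c d \<subseteq> cimg d"
  using overlapD(4) by blast

lemma emb_smooth: "c \<in> L \<Longrightarrow> d \<in> M \<Longrightarrow> smooth_on (overlap c d) (emb c d)"
  using incl_smooth by (simp add: smooth_map_def overlap_def emb_def)

lemma overlap_cover:
  assumes "c \<in> L" "x \<in> cimg c"
  obtains d where "d \<in> M" "x \<in> overlap c d"
proof -
  have q: "cinv c x \<in> cdom c" "cmap c (cinv c x) = x" using assms by (auto simp: cinv_in[OF L] cmap_cinv[OF L])
  then have "cinv c x \<in> points M" using LM assms by (auto simp: points_def)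
  then obtain d where "d \<in> M" "cinv c x \<in> cdom d" by (auto simp: points_def)
  then show ?thesis using that q by (metis IntI imageI overlap_def)
qed

lemma incl_cfield:
  assumes "c \<in> L" "d \<in> M" "x \<in> overlap c d"
  shows "incl L M (cinv c x) (cfield L c v x) = cfield M d (frechet_derivative (emb c d) (at x) v) (emb c d x)"
  using differential_cfield[OF L M assms(1,2) overlapD(1)[OF assms] incl_mdiff[OF overlapD(6)[OF assms]] overlapD(3)[OF assms]]
  by (simp add: emb_def)

lemma h_local:
  assumes "c \<in> L" "d \<in> M" "x \<in> overlap c d"
  shows "local_metric L h c x v w = local_metric M g d (emb c d x) (frechet_derivative (emb c d) (at x) v)
     (frechet_derivative (emb c d) (at x) w)"
  unfolding local_metric_def induced_metric_def incl_cfield[OF assms] overlapD(5)[OF assms] ..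

lemma h_riemannian: "riemannian_metric L h"
  unfolding riemannian_metric_def
proof (intro conjI ballI allI impI)
  fix p X assume p: "p \<in> points L" and X: "X \<in> tangent_space L p"
  have pM: "p \<in> points M" using p LM by blast
  note in_M = incl_in[OF p]
  show "linear_on_tangent L p (h p X)"
    unfolding linear_on_tangent_def induced_metric_def
    by (simp add: incl_add[OF p] incl_scale[OF p] g_add[OF pM in_M in_M in_M] g_scale[OF pM in_M in_M])
  show "h p X Y = h p Y X" if "Y \<in> tangent_space L p" for Y
    unfolding induced_metric_def by (rule g_sym[OF pM in_M in_M])
  show "h p X X > 0" if "X \<noteq> tzero"
    unfolding induced_metric_def using incl_inj[OF p X] that by (intro g_pos[OF pM in_M]) blast
next
  fix c v w assume c: "c \<in> L"
  have "smooth_on (cimg c) (\<lambda>x. local_metric L h c x v w)"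
  proof (rule smooth_on_local)
    fix x assume "x \<in> cimg c"
    then obtain d where d: "d \<in> M" and x: "x \<in> overlap c d" using overlap_cover[OF c] by blast
    interpret chart: metric_chart M g d using M g d by unfold_locales
    note op = overlap_open[OF c d]
    have sm: "smooth_on (overlap c d) (\<lambda>x. chart.G (emb c d x) (frechet_derivative (emb c d) (at x) v)
       (frechet_derivative (emb c d) (at x) w))"
    proof (rule smooth_on_bilinear_eval[OF op _ _ smooth_on_frechet[OF emb_smooth[OF c d]] smooth_on_frechet[OF emb_smooth[OF c d]]])
      show "bilinear (chart.G (emb c d x))" if "x \<in> overlap c d" for x
        by (rule chart.G_bilinear[OF overlapD(4)[OF c d that]])
      show "smooth_on (overlap c d) (\<lambda>x. chart.G (emb c d x) v w)" for v w
        by (rule smooth_on_compose[OF op chart.op emb_image[OF c d] emb_smooth[OF c d] chart.G_smooth])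
    qed
    have "smooth_on (overlap c d) (\<lambda>x. local_metric L h c x v w)"
      using smooth_on_cong[OF op, of "\<lambda>x. local_metric L h c x v w"
        "\<lambda>x. chart.G (emb c d x) (frechet_derivative (emb c d) (at x) v) (frechet_derivative (emb c d) (at x) w)"]
        h_local[OF c d] sm by blast
    then show "\<exists>U. open U \<and> x \<in> U \<and> smooth_on U (\<lambda>x. local_metric L h c x v w)"
      using op x by blast
  qed
  then show "smooth_on (cimg c) (\<lambda>x. h (cinv c x) (cfield L c v x) (cfield L c w x))"
    by (simp add: local_metric_def)
qed

lemma h_chart: "c \<in> L \<Longrightarrow> metric_chart L h c"
  by unfold_locales (rule L h_riemannian | assumption)+

text \<open>The pull-back of \<open>\<omega>\<close> vanishes, hence so does that of \<open>d\<omega>\<close>.\<close>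

lemma d2_omega_incl:
  assumes p: "p \<in> points L" and X: "X \<in> tangent_space L p" and Y: "Y \<in> tangent_space L p" and Z: "Z \<in> tangent_space L p"
  shows "d2 M \<omega> p (incl L M p X) (incl L M p Y) (incl L M p Z) = 0"
proof -
  define c d where "c = chart_at L p" and "d = chart_at M p"
  have cp: "c \<in> charts_at L p" and dp: "d \<in> charts_at M p"
    using p LM by (auto simp: c_def d_def intro: chart_at_in)
  note c = charts_atD[OF cp] and d = charts_atD[OF dp]
  interpret chart: almost_hermitian_chart M J g d using d by unfold_locales simp
  let ?x = "cmap c p"
  have x: "?x \<in> overlap c d" using c d by (auto simp: overlap_def)
  have cx: "cinv c ?x = p" using c by (simp add: cinv_cmap[OF L])
  have ex: "emb c d ?x = cmap d p" using cx by (simp add: emb_def)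
  have inc: "incl L M p V d = frechet_derivative (emb c d) (at ?x) (V c)" if "V \<in> tangent_space L p" for V
    by (simp add: differential_eq[OF L M incl_mdiff[OF p] cp dp that] tvec_apply[OF M dp] emb_def)
  have "ext_deriv2 (\<lambda>y v w. chart.Om (emb c d y) (frechet_derivative (emb c d) (at y) v)
      (frechet_derivative (emb c d) (at y) w)) ?x = ext_deriv2 (\<lambda>y v w. 0) ?x"
  proof (rule ext_deriv2_cong_open[OF overlap_open x])
    fix y v w assume y: "y \<in> overlap c d"
    have q: "cinv c y \<in> points L" using y c d by (auto simp: overlapD)
    show "chart.Om (emb c d y) (frechet_derivative (emb c d) (at y) v) (frechet_derivative (emb c d) (at y) w) = 0"
      using omega_incl[OF q] cfield_in[OF L _ overlapD(1)[OF _ _ y]] c d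
      by (simp add: local_metric_def overlapD(5)[OF _ _ y] flip: incl_cfield[OF _ _ y])
  qed (use c d in auto)
  moreover have "ext_deriv2 (\<lambda>y v w. chart.Om (emb c d y) (frechet_derivative (emb c d) (at y) v)
      (frechet_derivative (emb c d) (at y) w)) ?x (X c) (Y c) (Z c) =
     ext_deriv2 chart.Om (emb c d ?x) (frechet_derivative (emb c d) (at ?x) (X c))
       (frechet_derivative (emb c d) (at ?x) (Y c)) (frechet_derivative (emb c d) (at ?x) (Z c))"
  proof (rule ext_deriv2_pullback[OF overlap_open x emb_smooth emb_image])
    show "(\<lambda>y. chart.Om y v w) differentiable (at (emb c d ?x))" for v w
      using d by (intro smooth_on_differentiable[OF chart.Om_smooth]) (simp add: ex)
  qed (use c d chart.Om_bilinear chart.Om_alt in blast)+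
  moreover have "d2 M \<omega> p (incl L M p X) (incl L M p Y) (incl L M p Z) =
     ext_deriv2 chart.Om (cmap d p) (incl L M p X d) (incl L M p Y d) (incl L M p Z d)"
    using d by (intro d2_chart[OF M dp incl_in[OF p] incl_in[OF p] incl_in[OF p] omega_bilinear omega_alt
      smooth_on_differentiable[OF chart.Om_smooth]]) auto
  ultimately show ?thesis
    by (simp add: inc[OF X] inc[OF Y] inc[OF Z] ex) (simp add: ext_deriv2_def)
qed

end

lemma (in almost_hermitian_chart) d2_omega_cfield:
  assumes x: "x \<in> cimg c"
  shows "d2 M \<omega> (cinv c x) (cfield M c u x) (cfield M c v x) (cfield M c w x) = ext_deriv2 Om x u v w"
proof -
  have "d2 M \<omega> (cinv c x) (cfield M c u x) (cfield M c v x) (cfield M c w x) =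
      ext_deriv2 Om (cmap c (cinv c x)) (cfield M c u x c) (cfield M c v x c) (cfield M c w x c)"
    by (intro d2_chart[OF M ca[OF x] cf[OF x] cf[OF x] cf[OF x] omega_bilinear omega_alt
      smooth_on_differentiable[OF Om_smooth]]) (simp_all add: cmap_cinv[OF M c x] x)
  then show ?thesis by (simp add: cmap_cinv[OF M c x] cfield_apply[OF M c x])
qed

context lagrangian
begin

text \<open>One third of d\<omega> at points of M, by \<open>d2_omega_nearly_kaehler\<close>. The
  lemmas that follow make it, and its variant with J in the last slot, alternating.\<close>

definition tau :: "'m \<Rightarrow> ('m, real ^ 6) tv \<Rightarrow> ('m, real ^ 6) tv \<Rightarrow> ('m, real ^ 6) tv \<Rightarrow> real" where
  "tau p X Y Z = g p (nabla_J M g J p X Y) Z"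

section \<open>Symmetries of g((nabla_X J) Y, Z) and of its composite with J\<close>

context
  fixes p assumes pM: "p \<in> points M"
begin

lemma tau_skew23: "Y \<in> tangent_space M p \<Longrightarrow> Z \<in> tangent_space M p \<Longrightarrow> tau p X Y Z = - tau p X Z Y"
  unfolding tau_def by (rule nabla_J_skew[OF pM])

lemma tau_skew12: "X \<in> tangent_space M p \<Longrightarrow> Y \<in> tangent_space M p \<Longrightarrow> Z \<in> tangent_space M p \<Longrightarrow>
    tau p X Y Z = - tau p Y X Z"
  unfolding tau_def by (rule nabla_J_antisym[OF pM nk])

lemma tau_skew13:
  assumes "X \<in> tangent_space M p" "Y \<in> tangent_space M p" "Z \<in> tangent_space M p"
  shows "tau p X Y Z = - tau p Z Y X"
  using tau_skew12[OF assms] tau_skew23[OF assms(1,3), of Y] tau_skew12[OF assms(2,3,1)] by simp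

lemma tau_add3: "Y \<in> tangent_space M p \<Longrightarrow> Z \<in> tangent_space M p \<Longrightarrow>
    tau p X V (tadd Y Z) = tau p X V Y + tau p X V Z"
  unfolding tau_def by (rule g_add(1)[OF pM nabla_J_in[OF pM]])

lemma tau_scale3: "Y \<in> tangent_space M p \<Longrightarrow> tau p X V (tscale r Y) = r * tau p X V Y"
  unfolding tau_def by (rule g_scale(1)[OF pM nabla_J_in[OF pM]])

lemma tau_add2: "V \<in> tangent_space M p \<Longrightarrow> Y \<in> tangent_space M p \<Longrightarrow> Z \<in> tangent_space M p \<Longrightarrow>
    tau p X (tadd Y Z) V = tau p X Y V + tau p X Z V"
  using tau_skew23[of "tadd Y Z" V X] tau_skew23[of Y V X] tau_skew23[of Z V X] tau_add3[of Y Z X V]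
  by (simp add: tangent_add[OF pM])

lemma tau_add1: "X \<in> tangent_space M p \<Longrightarrow> V \<in> tangent_space M p \<Longrightarrow> Y \<in> tangent_space M p \<Longrightarrow> Z \<in> tangent_space M p \<Longrightarrow>
    tau p (tadd Y Z) X V = tau p Y X V + tau p Z X V"
  using tau_skew13[of "tadd Y Z" X V] tau_skew13[of Y X V] tau_skew13[of Z X V] tau_add3[of Y Z V X]
  by (simp add: tangent_add[OF pM])

lemma tau_scale1: "X \<in> tangent_space M p \<Longrightarrow> V \<in> tangent_space M p \<Longrightarrow> Y \<in> tangent_space M p \<Longrightarrow>
    tau p (tscale r Y) X V = r * tau p Y X V"
  using tau_skew13[of "tscale r Y" X V] tau_skew13[of Y X V] tau_scale3[of Y V X r]
  by (simp add: tangent_scale[OF pM])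

lemma g_tzero: "X \<in> tangent_space M p \<Longrightarrow> g p tzero X = 0"
  using g_scale(2)[OF pM, of X X 0] by (simp add: tscale_def tzero_def)

lemma tau_J: "X \<in> tangent_space M p \<Longrightarrow> W \<in> tangent_space M p \<Longrightarrow> tau p X (J p X) W = 0"
  unfolding tau_def using nabla_J_J[OF pM ct] g_tzero by simp

lemma tau_J_polarized:
  assumes X: "X \<in> tangent_space M p" and Y: "Y \<in> tangent_space M p" and W: "W \<in> tangent_space M p"
  shows "tau p X (J p Y) W = - tau p Y (J p X) W"
proof -
  note JX = J_in[OF pM X] and JY = J_in[OF pM Y]
  have "tau p (tadd X Y) (tadd (J p X) (J p Y)) W = 0"
    using tau_J[OF tangent_add[OF pM X Y] W] J_add[OF pM X Y] by simp
  then show ?thesis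
    using tau_J[OF X W] tau_J[OF Y W]
    by (simp add: tau_add2[OF W JX JY] tau_add1[OF JX W X Y] tau_add1[OF JY W X Y])
qed

text \<open>J is moved between slots by \<open>tau_J_polarized\<close>, alternating with the
  skewness of \<open>tau\<close>. Together with \<open>tau_skew12\<close> this makes the form tau(X,
  Y, JZ), that is the volume form up to the factor \<lambda>, alternating.\<close>

lemma tau_J_skew23:
  assumes X: "X \<in> tangent_space M p" and Y: "Y \<in> tangent_space M p" and Z: "Z \<in> tangent_space M p"
  shows "tau p X Y (J p Z) = - tau p X Z (J p Y)"
proof -
  note JX = J_in[OF pM X] and JY = J_in[OF pM Y] and JZ = J_in[OF pM Z]
  have "tau p X Y (J p Z) = - tau p X (J p Z) Y" by (rule tau_skew23[OF Y JZ])
  also have "\<dots> = tau p Z (J p X) Y" using tau_J_polarized[OF X Z Y] by simp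
  also have "\<dots> = - tau p Y (J p X) Z" by (rule tau_skew13[OF Z JX Y])
  also have "\<dots> = tau p X (J p Y) Z" using tau_J_polarized[OF X Y Z] by simp
  also have "\<dots> = - tau p X Z (J p Y)" by (rule tau_skew23[OF JY Z])
  finally show ?thesis .
qed

end

lemma vol_d2: "vol p X Y Z = d2 M \<omega> p (incl L M p X) (incl L M p Y) (J p (incl L M p Z)) / (3 * l)"
proof -
  have "1 / (3 * complex_of_real l) = complex_of_real (1 / (3 * l))" by simp
  moreover have "Im (complex_of_real r * z) = r * Im z" for r z by simp
  ultimately show ?thesis unfolding vol_form_def Phi_form_def by simp
qed

section \<open>The volume form of L and adapted orthonormal frames\<close>

context
  fixes p assumes p: "p \<in> points L"
begin

lemma p_in_M: "p \<in> points M" using p LM by blast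

lemma vol_tau: "vol p X Y Z = tau p (incl L M p X) (incl L M p Y) (J p (incl L M p Z)) / l"
proof -
  have "d2 M \<omega> p (incl L M p X) (incl L M p Y) (J p (incl L M p Z)) =
      3 * tau p (incl L M p X) (incl L M p Y) (J p (incl L M p Z))"
    unfolding tau_def by (intro d2_omega_nearly_kaehler[OF p_in_M nk] incl_in[OF p] J_in[OF p_in_M])
  then show ?thesis unfolding vol_d2 using l_pos by simp
qed

lemma vol_alt:
  "vol p X Y Z = - vol p Y X Z" "vol p X Y Z = - vol p X Z Y"
  unfolding vol_tau
  using tau_skew12[OF p_in_M incl_in[OF p] incl_in[OF p] J_in[OF p_in_M incl_in[OF p]], of X Y Z]
    tau_J_skew23[OF p_in_M incl_in[OF p] incl_in[OF p] incl_in[OF p], of X Y Z] by simp_all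

lemma vol_add: "X \<in> tangent_space L p \<Longrightarrow> X' \<in> tangent_space L p \<Longrightarrow>
    vol p (tadd X X') Y Z = vol p X Y Z + vol p X' Y Z"
  unfolding vol_tau
  by (simp add: incl_add[OF p] tau_add1[OF p_in_M] incl_in[OF p] J_in[OF p_in_M] add_divide_distrib)

lemma vol_scale: "X \<in> tangent_space L p \<Longrightarrow> vol p (tscale r X) Y Z = r * vol p X Y Z"
  unfolding vol_tau
  by (simp add: incl_scale[OF p] tau_scale1[OF p_in_M] incl_in[OF p] J_in[OF p_in_M])

context
  fixes X :: "3 \<Rightarrow> ('m, real ^ 3) tv"
  assumes X: "\<And>i. X i \<in> tangent_space L p" and on: "\<And>i j. h p (X i) (X j) = (if i = j then 1 else 0)"
begin

text \<open>The adapted frame of the tangent space of M: an orthonormal frame of L and its image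
  under J, told apart by the flag. The Lagrangian condition makes the two halves orthogonal, and the
  six indices match the dimension.\<close>

definition E6 :: "bool \<times> 3 \<Rightarrow> ('m, real ^ 6) tv" where
  "E6 a = (if fst a then J p (incl L M p (X (snd a))) else incl L M p (X (snd a)))"

lemma E6_in: "E6 a \<in> tangent_space M p"
  by (simp add: E6_def incl_in[OF p] J_in[OF p_in_M])

lemma E6_orthonormal: "g p (E6 a) (E6 b) = (if a = b then 1 else 0)"
proof -
  note i = incl_in[OF p] and Ji = J_in[OF p_in_M incl_in[OF p]]
  have 1: "g p (incl L M p (X i)) (incl L M p (X j)) = (if i = j then 1 else 0)" for i j
    using on[of i j] by (simp add: induced_metric_def)
  have 2: "g p (J p (incl L M p (X i))) (incl L M p (X j)) = 0" for i j
    using omega_incl[OF p X X, of i j] by (simp add: fundamental_form_def)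
  then have 3: "g p (incl L M p (X i)) (J p (incl L M p (X j))) = 0" for i j
    using g_sym[OF p_in_M i Ji, of "X i" "X j"] by simp
  show ?thesis
    unfolding E6_def using 1 2 3 by (auto simp: J_iso[OF p_in_M i i] prod_eq_iff)
qed

lemma E6_parseval:
  assumes V: "V \<in> tangent_space M p" and W: "W \<in> tangent_space M p"
  shows "g p V W = (\<Sum>a\<in>UNIV. g p V (E6 a) * g p W (E6 a))"
    and "(\<And>a. g p V (E6 a) = g p W (E6 a)) \<Longrightarrow> V = W"
proof -
  define d where "d = chart_at M p"
  have dp: "d \<in> charts_at M p" using p_in_M by (simp add: d_def chart_at_in)
  note d = charts_atD[OF dp]
  interpret chart: metric_chart M g d using M g d by unfold_locales auto
  have x: "cmap d p \<in> cimg d" using d by simp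
  note app = local_metric_apply[OF M dp, of _ _ g]
  have E: "chart.G (cmap d p) (E6 a d) (E6 b d) = (if a = b then 1 else 0)" for a b
    by (simp add: app E6_in E6_orthonormal)
  have card: "card (UNIV :: (bool \<times> 3) set) = DIM(real ^ 6)" by simp
  show "g p V W = (\<Sum>a\<in>UNIV. g p V (E6 a) * g p W (E6 a))"
    using orthonormal_parseval[OF chart.G_bilinear[OF x] chart.G_pos[OF x] finite card E, of "V d" "W d"]
    by (simp add: app E6_in V W)
  assume "\<And>a. g p V (E6 a) = g p W (E6 a)"
  then have "V d = W d"
    using orthonormal_expansion[OF chart.G_bilinear[OF x] chart.G_pos[OF x] finite card E, of "V d"]
      orthonormal_expansion[OF chart.G_bilinear[OF x] chart.G_pos[OF x] finite card E, of "W d"]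
    by (simp add: app E6_in V W)
  then show "V = W" by (rule tangent_eqI[OF V W dp])
qed

lemma vol_orthonormal: "(vol p (X 1) (X 2) (X 3))\<^sup>2 = 1"
proof -
  define N where "N = nabla_J M g J p (incl L M p (X 1)) (incl L M p (X 2))"
  note i = incl_in[OF p] and Ji = J_in[OF p_in_M incl_in[OF p]]
  have N: "N \<in> tangent_space M p" unfolding N_def by (rule nabla_J_in[OF p_in_M])
  have tau: "g p N Z = tau p (incl L M p (X 1)) (incl L M p (X 2)) Z" for Z by (simp add: N_def tau_def)
  \<comment> \<open>Five of the six components of \<open>N\<close> vanish: the first two by skewness
    of \<open>tau\<close>, the third because d\<omega> restricts to zero on L, the fourth and fifth
    because tau(X, Y, JZ) is alternating. Hence |N|^2 is the square of the remaining component
    \<lambda> vol, and constant type gives |N|^2 = \<lambda>^2.\<close>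
  have 1: "g p N (incl L M p (X 1)) = 0" unfolding tau using tau_skew13[OF p_in_M i i i, of "X 1" "X 2" "X 1"] by simp
  have 2: "g p N (incl L M p (X 2)) = 0" unfolding tau using tau_skew23[OF p_in_M incl_in[OF p, of "X 2"] incl_in[OF p, of "X 2"], of "incl L M p (X 1)"] by simp
  have 3: "g p N (incl L M p (X 3)) = 0"
    using d2_omega_incl[OF p X X X] d2_omega_nearly_kaehler[OF p_in_M nk i i i, of "X 1" "X 2" "X 3"]
    by (simp add: N_def)
  have 4: "g p N (J p (incl L M p (X 2))) = 0"
    unfolding tau using tau_J_skew23[OF p_in_M i i i, of "X 1" "X 2" "X 2"] by simp
  have 5: "g p N (J p (incl L M p (X 1))) = 0"
    unfolding tau
    using tau_skew12[OF p_in_M i i Ji, of "X 1" "X 2" "X 1"] tau_J_skew23[OF p_in_M i i i, of "X 2" "X 1" "X 1"] by simp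
  have "g p N N = (\<Sum>a\<in>UNIV \<times> UNIV. (g p N (E6 a))\<^sup>2)"
    using E6_parseval(1)[OF N N] by (simp add: power2_eq_square)
  also have "\<dots> = (\<Sum>b\<in>UNIV. \<Sum>i\<in>UNIV. (g p N (E6 (b, i)))\<^sup>2)"
    by (simp add: sum.cartesian_product)
  also have "\<dots> = (g p N (J p (incl L M p (X 3))))\<^sup>2"
    by (simp add: UNIV_bool sum_3 E6_def 1 2 3 4 5)
  finally have "g p N N = (l * vol p (X 1) (X 2) (X 3))\<^sup>2"
    unfolding vol_tau tau using l_pos by simp
  moreover have "g p N N = l\<^sup>2 * (g p (incl L M p (X 1)) (incl L M p (X 1)) * g p (incl L M p (X 2)) (incl L M p (X 2)) -
      (g p (incl L M p (X 1)) (incl L M p (X 2)))\<^sup>2 - (g p (incl L M p (X 1)) (J p (incl L M p (X 2))))\<^sup>2)"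
    unfolding N_def using ct p_in_M i by (simp add: constant_type_def)
  moreover have "\<dots> = l\<^sup>2"
    using E6_orthonormal[of "(False, 1)" "(False, 1)"] E6_orthonormal[of "(False, 2)" "(False, 2)"]
      E6_orthonormal[of "(False, 1)" "(False, 2)"] E6_orthonormal[of "(False, 1)" "(True, 2)"]
    by (simp add: E6_def)
  ultimately show ?thesis using l_pos by (simp add: power_mult_distrib)
qed

end

lemma oriented_frame_exists: "\<exists>e. oriented_frame L h vol p e"
proof -
  define c where "c = chart_at L p"
  have cp: "c \<in> charts_at L p" using p by (simp add: c_def chart_at_in)
  note c = charts_atD[OF cp]
  interpret chart: metric_chart L h c using h_chart c by blast
  have x: "cmap c p \<in> cimg c" using c by simp
  obtain e :: "3 \<Rightarrow> real ^ 3" where "\<forall>i j. chart.G (cmap c p) (e i) (e j) = (if i = j then 1 else 0)"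
    using gram_schmidt_3[OF chart.G_bilinear[OF x] chart.G_sym[OF x] chart.G_pos[OF x]] ..
  then have e: "chart.G (cmap c p) (e i) (e j) = (if i = j then 1 else 0)" for i j by blast
  define X where "X = (\<lambda>i. tvec L c p (e i))"
  have X: "X i \<in> tangent_space L p" and Xc: "X i c = e i" for i
    by (simp_all add: X_def tvec_in[OF L cp] tvec_apply[OF L cp])
  have on: "h p (X i) (X j) = (if i = j then 1 else 0)" for i j
    using local_metric_apply[OF L cp X X, of h i j] unfolding Xc e by (rule sym)
  have hlin: "h p (tscale r V) W = r * h p V W" "h p W (tscale r V) = r * h p W V"
    if "V \<in> tangent_space L p" "W \<in> tangent_space L p" for r V W
    using riemannian_bilinear[OF L h_riemannian p] that
    by (auto simp: bilinear_form_at_def linear_on_tangent_def)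
  consider "vol p (X 1) (X 2) (X 3) = 1" | "vol p (X 1) (X 2) (X 3) = -1"
    using vol_orthonormal[OF X on] by (auto simp: power2_eq_1_iff)
  then show ?thesis
  proof cases
    case 1
    then have "oriented_frame L h vol p X" by (simp add: oriented_frame_def X on)
    then show ?thesis by blast
  next
    case 2
    \<comment> \<open>Reversing one vector keeps the frame orthonormal and changes the sign of
      vol.\<close>
    define X' where "X' = X(1 := tscale (-1) (X 1))"
    have "X' i \<in> tangent_space L p" for i by (simp add: X'_def X L_scale[OF p])
    moreover have "h p (X' i) (X' j) = (if i = j then 1 else 0)" for i j
      by (simp add: X'_def hlin X L_scale[OF p] on)
    moreover have "vol p (X' 1) (X' 2) (X' 3) = 1"
      using 2 by (simp add: X'_def vol_scale[OF X])
    ultimately have "oriented_frame L h vol p X'" by (simp add: oriented_frame_def)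
    then show ?thesis by blast
  qed
qed

lemma oriented_frame_vol:
  assumes "oriented_frame L h vol p e"
  shows "vol p (e 1) (e 2) (e 3) = 1"
  using vol_orthonormal[of e] assms by (simp add: oriented_frame_def power2_eq_1_iff)

end

text \<open>The coefficient of vol against the coordinate determinant \<open>vdet\<close>. Its sign
  is left open, as the charts of L are not assumed to be oriented.\<close>

definition kappa :: "('m, real ^ 3) chart \<Rightarrow> real ^ 3 \<Rightarrow> real" where
  "kappa c x = vol (cinv c x) (cfield L c (axis 1 1) x) (cfield L c (axis 2 1) x) (cfield L c (axis 3 1) x)"

context
  fixes c assumes c: "c \<in> L"
begin

lemma L_pt: "x \<in> cimg c \<Longrightarrow> cinv c x \<in> points L"
  using cinv_in[OF L c] c by (auto simp: points_def)

lemma vol_chart: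
  assumes x: "x \<in> cimg c"
  shows "vol (cinv c x) (cfield L c u x) (cfield L c v x) (cfield L c w x) = kappa c x * vdet u v w"
proof -
  note q = L_pt[OF x] and cq = cinv_charts_at[OF L c x]
  have "alternating3 (\<lambda>u v w. vol (cinv c x) (cfield L c u x) (cfield L c v x) (cfield L c w x))"
  proof
    show "vol (cinv c x) (cfield L c (u + u') x) (cfield L c v x) (cfield L c w x) =
       vol (cinv c x) (cfield L c u x) (cfield L c v x) (cfield L c w x) +
       vol (cinv c x) (cfield L c u' x) (cfield L c v x) (cfield L c w x)" for u u' v w
      unfolding cfield_def tvec_add[OF L cq] by (intro vol_add[OF q] tvec_in[OF L cq])
    show "vol (cinv c x) (cfield L c (r *\<^sub>R u) x) (cfield L c v x) (cfield L c w x) =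
       r * vol (cinv c x) (cfield L c u x) (cfield L c v x) (cfield L c w x)" for r u v w
      unfolding cfield_def tvec_scale[OF L cq] by (intro vol_scale[OF q] tvec_in[OF L cq])
  qed (rule vol_alt[OF q])+
  from alternating3_eq_vdet[OF this] show ?thesis unfolding kappa_def .
qed

text \<open>The orthonormal frames are not known to vary smoothly, so smoothness is taken from
  d\<omega> in charts of M, evaluated on the derivative of the embedding and on J.\<close>

lemma kappa_smooth: "smooth_on (cimg c) (kappa c)"
proof (rule smooth_on_local)
  fix x assume "x \<in> cimg c"
  then obtain d where d: "d \<in> M" and x: "x \<in> overlap c d" using overlap_cover[OF c] by blast
  interpret chart: almost_hermitian_chart M J g d using d by unfold_locales
  note op = overlap_open[OF c d] and sm = emb_smooth[OF c d] and im = emb_image[OF c d]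
  let ?D = "\<lambda>v x. frechet_derivative (emb c d) (at x) v"
  let ?K = "\<lambda>x. ext_deriv2 chart.Om (emb c d x) (?D (axis 1 1) x) (?D (axis 2 1) x)
     (chart.Jc (emb c d x) (?D (axis 3 1) x))"
  have Dsm: "smooth_on (overlap c d) (?D v)" for v by (rule smooth_on_frechet[OF sm])
  have Jsm: "smooth_on (overlap c d) (\<lambda>x. chart.Jc (emb c d x) (?D v x))" for v
  proof (rule smooth_on_linear_eval[OF op _ _ Dsm])
    show "linear (chart.Jc (emb c d x))" if "x \<in> overlap c d" for x
      by (rule chart.Jc_linear[OF overlapD(4)[OF c d that]])
    show "smooth_on (overlap c d) (\<lambda>x. chart.Jc (emb c d x) v)" for v
      by (rule smooth_on_compose[OF op chart.op im sm chart.Jc_smooth])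
  qed
  have Ksm: "smooth_on (overlap c d) ?K"
  proof (rule smooth_on_trilinear_eval[OF op _ _ _ _ Dsm Dsm Jsm])
    fix x u v w assume "x \<in> overlap c d"
    from chart.Om_ext_deriv_linear[OF overlapD(4)[OF c d this]]
    show "linear (\<lambda>u. ext_deriv2 chart.Om (emb c d x) u v w)" "linear (\<lambda>v. ext_deriv2 chart.Om (emb c d x) u v w)"
      "linear (ext_deriv2 chart.Om (emb c d x) u v)" by blast+
  next
    show "smooth_on (overlap c d) (\<lambda>x. ext_deriv2 chart.Om (emb c d x) u v w)" for u v w
      by (rule smooth_on_compose[OF op chart.op im sm chart.Om_ext_deriv_smooth])
  qed
  have eq: "kappa c x = ?K x / (3 * l)" if x: "x \<in> overlap c d" for x
  proof -
    note e = overlapD(4)[OF c d x]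
    have J: "J (cinv c x) (cfield M d w (emb c d x)) = cfield M d (chart.Jc (emb c d x) w) (emb c d x)" for w
      using chart.J_cfield[OF e] by (simp add: overlapD(5)[OF c d x])
    show ?thesis
      unfolding kappa_def vol_d2 incl_cfield[OF c d x] J
      using chart.d2_omega_cfield[OF e] by (simp add: overlapD(5)[OF c d x])
  qed
  have "smooth_on (overlap c d) (\<lambda>x. ?K x / (3 * l))"
    using l_pos by (intro smooth_on_divide[OF op Ksm smooth_on_const]) simp
  then have "smooth_on (overlap c d) (kappa c)"
    using smooth_on_cong[OF op, of "kappa c" "\<lambda>x. ?K x / (3 * l)"] eq by blast
  then show "\<exists>U. open U \<and> x \<in> U \<and> smooth_on U (kappa c)" using op x by blast
qed

end

end

section \<open>Normal sections and deformations\<close>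

text \<open>The vectors \<open>b i\<close> are the rows of the Gram matrix, and \<open>K u\<close>
  collects the coordinates of B(u, .). The form vdet(Ku, Kv, Kw) is the determinant of the rows
  times vdet(u, v, w). By Riesz representation \<open>K\<close> attains the standard basis, where
  the left side is 1, so the factor cannot vanish.\<close>

lemma bilinear_coordinates_nonzero:
  fixes B :: "real ^ 3 \<Rightarrow> real ^ 3 \<Rightarrow> real"
  defines "b \<equiv> \<lambda>i. \<chi> j. B (axis i 1) (axis j 1)"
  assumes B: "bilinear B" and pos: "\<And>v. v \<noteq> 0 \<Longrightarrow> B v v > 0"
  shows "vdet (b 1) (b 2) (b 3) \<noteq> 0"
    and "(\<And>w. B z w = a w) \<Longrightarrow> (\<chi> j. a (axis j 1)) = z $ 1 *\<^sub>R b 1 + z $ 2 *\<^sub>R b 2 + z $ 3 *\<^sub>R b 3"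
proof -
  have l1: "linear (\<lambda>z. B z w)" for w using B by (auto simp: bilinear_def)
  have comb: "(\<chi> j. B z (axis j 1)) = z $ 1 *\<^sub>R b 1 + z $ 2 *\<^sub>R b 2 + z $ 3 *\<^sub>R b 3" for z
  proof -
    have "B z w = z $ 1 * B (axis 1 1) w + z $ 2 * B (axis 2 1) w + z $ 3 * B (axis 3 1) w" for w
      by (subst axis_expansion_3[of z]) (simp only: linear_add[OF l1] linear_cmul[OF l1] real_scaleR_def)
    then show ?thesis by (simp add: b_def vec_eq_iff)
  qed
  show "(\<chi> j. a (axis j 1)) = z $ 1 *\<^sub>R b 1 + z $ 2 *\<^sub>R b 2 + z $ 3 *\<^sub>R b 3" if "\<And>w. B z w = a w"
    using comb[of z] unfolding that .
  define K where "K = (\<lambda>u :: real ^ 3. u $ 1 *\<^sub>R b 1 + u $ 2 *\<^sub>R b 2 + u $ 3 *\<^sub>R b 3)"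
  have K: "K (u + v) = K u + K v" "K (r *\<^sub>R u) = r *\<^sub>R K u" for u v r
    by (simp_all add: K_def algebra_simps)
  have "alternating3 (\<lambda>u v w. vdet (K u) (K v) (K w))"
  proof
    show "vdet (K (u + u')) (K v) (K w) = vdet (K u) (K v) (K w) + vdet (K u') (K v) (K w)" for u u' v w
      by (simp only: K vdet.add1)
    show "vdet (K (r *\<^sub>R u)) (K v) (K w) = r * vdet (K u) (K v) (K w)" for r u v w
      by (simp only: K vdet.scale1)
  qed (rule vdet.alt12 vdet.alt23)+
  note T = alternating3_eq_vdet[OF this]
  have K_axis: "K (axis 1 1) = b 1" "K (axis 2 1) = b 2" "K (axis 3 1) = b 3"
    by (simp_all add: K_def axis_def)
  have "\<exists>z. K z = axis j 1" for j
  proof -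
    have "linear (\<lambda>w :: real ^ 3. w $ j)" by (simp add: linear_iff)
    from bilinear_representation[OF B pos this] obtain z where "\<And>w. B z w = w $ j" by blast
    then have "K z = (\<chi> i. axis i 1 $ j)" using comb[of z] by (simp add: K_def)
    then have "K z = axis j 1" by (simp add: vec_eq_iff axis_def)
    then show ?thesis ..
  qed
  then obtain z where z: "\<And>j. K (z j) = axis j 1" by metis
  have "vdet (K (z 1)) (K (z 2)) (K (z 3)) = 1" unfolding z by (simp add: vdet_def axis_def)
  then show "vdet (b 1) (b 2) (b 3) \<noteq> 0" unfolding T[of "z 1"] K_axis by auto
qed

text \<open>\<open>bilinear_representation\<close> gives the vector at each point but no regularity.
  Cramer's rule writes it as a quotient of determinants of smooth functions, with the Gram
  determinant \<open>W\<close> as denominator.\<close>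

lemma smooth_bilinear_representation:
  fixes B :: "'a::euclidean_space \<Rightarrow> real ^ 3 \<Rightarrow> real ^ 3 \<Rightarrow> real"
  assumes S: "open S" and B: "\<And>x. x \<in> S \<Longrightarrow> bilinear (B x)" "\<And>x v. x \<in> S \<Longrightarrow> v \<noteq> 0 \<Longrightarrow> B x v v > 0"
    "\<And>v w. smooth_on S (\<lambda>x. B x v w)"
    and a: "\<And>x. x \<in> S \<Longrightarrow> linear (a x)" "\<And>v. smooth_on S (\<lambda>x. a x v)"
  shows "\<exists>Z. smooth_on S Z \<and> (\<forall>x\<in>S. \<forall>w. B x (Z x) w = a x w)"
proof -
  define b where "b = (\<lambda>x i. (\<chi> j. B x (axis i 1) (axis j 1)) :: real ^ 3)"
  define A where "A = (\<lambda>x. (\<chi> j. a x (axis j 1)) :: real ^ 3)"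
  define W where "W = (\<lambda>x. vdet (b x 1) (b x 2) (b x 3))"
  define Z where "Z = (\<lambda>x. (vdet (A x) (b x 2) (b x 3) / W x) *\<^sub>R axis 1 1 +
     (vdet (A x) (b x 3) (b x 1) / W x) *\<^sub>R axis 2 1 + (vdet (A x) (b x 1) (b x 2) / W x) *\<^sub>R (axis 3 1 :: real ^ 3))"
  have W: "W x \<noteq> 0" if "x \<in> S" for x
    unfolding W_def b_def by (rule bilinear_coordinates_nonzero(1)[OF B(1,2)[OF that]])
  have sm: "smooth_on S (\<lambda>x. b x i $ j)" "smooth_on S (\<lambda>x. A x $ j)" for i j
    using B(3) a(2) by (simp_all add: b_def A_def)
  have smdet: "smooth_on S (\<lambda>x. vdet (b x i) (b x j) (b x k))" "smooth_on S (\<lambda>x. vdet (A x) (b x j) (b x k))" for i j k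
    unfolding vdet_def by (intro smooth_on_add smooth_on_diff smooth_on_mult S sm)+
  have "smooth_on S Z"
    unfolding Z_def W_def
    by (intro smooth_on_add smooth_on_scaleR smooth_on_const smooth_on_divide smdet S) (use W in \<open>auto simp: W_def\<close>)
  moreover have "B x (Z x) w = a x w" if x: "x \<in> S" for x w
  proof -
    obtain z where z: "\<And>w. B x z w = a x w"
      using bilinear_representation[OF B(1,2)[OF x] a(1)[OF x]] x by blast
    have "A x = z $ 1 *\<^sub>R b x 1 + z $ 2 *\<^sub>R b x 2 + z $ 3 *\<^sub>R b x 3"
      unfolding A_def b_def by (rule bilinear_coordinates_nonzero(2)[OF B(1,2)[OF x] z]) (use x in auto)
    from vdet.frame[where a = "\<lambda>i. z $ i" and e = "b x", OF this] have "Z x = z $ 1 *\<^sub>R axis 1 1 + z $ 2 *\<^sub>R axis 2 1 + z $ 3 *\<^sub>R axis 3 1"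
      unfolding Z_def using W[OF x] by (simp add: W_def)
    then have "Z x = z" using axis_expansion_3[of z] by simp
    then show ?thesis using z by simp
  qed
  ultimately show ?thesis by blast
qed

lemma smooth_on_Pair:
  fixes f :: "'a::euclidean_space \<Rightarrow> 'b::euclidean_space" and k :: "'a \<Rightarrow> 'c::euclidean_space"
  assumes S: "open S" and f: "smooth_on S f" and k: "smooth_on S k"
  shows "smooth_on S (\<lambda>x. (f x, k x))"
proof -
  have b: "bounded_linear (\<lambda>u :: 'b. (u, 0 :: 'c))" "bounded_linear (\<lambda>u :: 'c. (0 :: 'b, u))"
    by (auto intro: bounded_linear_Pair bounded_linear_ident bounded_linear_zero)
  have "smooth_on S (\<lambda>x. (f x, 0) + (0, k x))"
    by (intro smooth_on_add[OF S] smooth_on_bounded_linear[OF b(1) S f] smooth_on_bounded_linear[OF b(2) S k])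
  then show ?thesis by simp
qed

section \<open>Normal sections and differentiability of the deformation\<close>

context lagrangian
begin

abbreviation "ns \<equiv> normal_section L M J g"

text \<open>With z the metric dual of \<alpha>, the vector -Jz is normal because L is Lagrangian,
  and \<omega>(-Jz, X) = g(z, X) because J^2 = -1. Normality fixes the products with a frame of L
  and \<alpha> those with its image under J; by the adapted frame this is the uniqueness that
  \<open>THE\<close> needs.\<close>

lemma normal_section_eq:
  assumes p: "p \<in> points L" and z: "z \<in> tangent_space L p"
    and eq: "\<And>X. X \<in> tangent_space L p \<Longrightarrow> h p z X = \<alpha> p X"
  shows "ns \<alpha> p = tscale (-1) (J p (incl L M p z))"
proof -
  note pM = p_in_M[OF p] and i = incl_in[OF p] and Ji = J_in[OF p_in_M[OF p] incl_in[OF p]]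
  let ?s = "tscale (-1) (J p (incl L M p z))"
  have s: "?s \<in> tangent_space M p" by (rule tangent_scale[OF pM Ji])
  have Js: "J p ?s = incl L M p z"
    by (simp add: J_scale[OF pM Ji] J_J[OF pM i]) (simp add: tscale_def)
  have s1: "g p ?s (incl L M p X) = 0" if "X \<in> tangent_space L p" for X
    using omega_incl[OF p z that] by (simp add: g_scale[OF pM i Ji] fundamental_form_def)
  have s2: "\<omega> p ?s (incl L M p X) = \<alpha> p X" if "X \<in> tangent_space L p" for X
    using eq[OF that] by (simp only: fundamental_form_def Js induced_metric_def)
  obtain e where "oriented_frame L h vol p e" using oriented_frame_exists[OF p] by blast
  then have e: "e i \<in> tangent_space L p" "h p (e i) (e j) = (if i = j then 1 else 0)" for i j
    by (auto simp: oriented_frame_def)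
  have uniq: "v = ?s" if v: "v \<in> normal_space L M g p"
    and w: "\<forall>X\<in>tangent_space L p. \<omega> p v (incl L M p X) = \<alpha> p X" for v
  proof (rule E6_parseval(2)[OF p e])
    have vM: "v \<in> tangent_space M p" and v0: "\<And>X. X \<in> tangent_space L p \<Longrightarrow> g p v (incl L M p X) = 0"
      using v by (auto simp: normal_space_def)
    show "v \<in> tangent_space M p" by fact
    show "?s \<in> tangent_space M p" by fact
    have "g p v (J p (incl L M p X)) = g p ?s (J p (incl L M p X))" if "X \<in> tangent_space L p" for X
    proof -
      have "g p (J p v) (incl L M p X) = g p (J p ?s) (incl L M p X)"
        using w that s2[OF that] by (simp add: fundamental_form_def)
      then show ?thesis using J_skew[OF pM vM i] J_skew[OF pM s i] by simp
    qed
    then show "g p v (E6 p e a) = g p ?s (E6 p e a)" for a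
      by (simp add: E6_def[OF p e] s1 v0 e)
  qed
  show ?thesis
    unfolding normal_section_def
  proof (rule the_equality)
    show "?s \<in> normal_space L M g p \<and> (\<forall>X\<in>tangent_space L p. \<omega> p ?s (incl L M p X) = \<alpha> p X)"
      using s s1 s2 by (simp add: normal_space_def)
  qed (use uniq in blast)
qed

lemma covector_representation:
  assumes c: "c \<in> L" and a: "\<And>x. x \<in> cimg c \<Longrightarrow> linear (a x)" "\<And>v. smooth_on (cimg c) (\<lambda>x. a x v)"
  shows "\<exists>Z. smooth_on (cimg c) Z \<and> (\<forall>x\<in>cimg c. \<forall>w. local_metric L h c x (Z x) w = a x w)"
proof -
  interpret chart: metric_chart L h c by (rule h_chart[OF c])
  show ?thesis
    by (rule smooth_bilinear_representation[OF chart.op chart.G_bilinear chart.G_pos chart.G_smooth a])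
qed

lemma normal_section_chart:
  assumes \<alpha>: "\<alpha> \<in> one_forms L" and c: "c \<in> L" and d: "d \<in> M"
  shows "smooth_on (overlap c d) (\<lambda>x. ns \<alpha> (cinv c x) d)"
    and "x \<in> cimg c \<Longrightarrow> ns \<alpha> (cinv c x) \<in> tangent_space M (cinv c x)"
proof -
  interpret chart: almost_hermitian_chart M J g d using d by unfold_locales
  note op = overlap_open[OF c d] and sm = emb_smooth[OF c d] and im = emb_image[OF c d]
  have "linear (\<lambda>w. \<alpha> (cinv c x) (cfield L c w x))" if x: "x \<in> cimg c" for x
  proof -
    have "linear_on_tangent L (cinv c x) (\<alpha> (cinv c x))" using \<alpha> L_pt[OF c x] by (simp add: one_forms_def)
    then show ?thesis
      unfolding linear_iff cfield_def linear_on_tangent_def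
      by (simp add: tvec_add[OF L cinv_charts_at[OF L c x]] tvec_scale[OF L cinv_charts_at[OF L c x]]
          tvec_in[OF L cinv_charts_at[OF L c x]])
  qed
  moreover have "smooth_on (cimg c) (\<lambda>x. \<alpha> (cinv c x) (cfield L c v x))" for v
    using \<alpha> c by (simp add: one_forms_def)
  ultimately obtain Z where Z: "smooth_on (cimg c) Z"
    "\<And>x w. x \<in> cimg c \<Longrightarrow> local_metric L h c x (Z x) w = \<alpha> (cinv c x) (cfield L c w x)"
    using covector_representation[OF c, of "\<lambda>x w. \<alpha> (cinv c x) (cfield L c w x)"] by blast
  have s: "ns \<alpha> (cinv c x) = tscale (-1) (J (cinv c x) (incl L M (cinv c x) (cfield L c (Z x) x)))"
    if x: "x \<in> cimg c" for x
  proof (rule normal_section_eq[OF L_pt[OF c x] cfield_in[OF L c x]])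
    fix X assume X: "X \<in> tangent_space L (cinv c x)"
    have "cfield L c (X c) x = X" unfolding cfield_def by (rule tvec_of_tangent[OF X cinv_charts_at[OF L c x]])
    then show "h (cinv c x) (cfield L c (Z x) x) X = \<alpha> (cinv c x) X"
      using Z(2)[OF x, of "X c"] by (simp add: local_metric_def)
  qed
  show "ns \<alpha> (cinv c x) \<in> tangent_space M (cinv c x)" if x: "x \<in> cimg c"
  proof -
    note q = L_pt[OF c x]
    show ?thesis unfolding s[OF x] by (intro tangent_scale[OF p_in_M[OF q]] J_in[OF p_in_M[OF q]] incl_in[OF q])
  qed
  let ?D = "\<lambda>x. frechet_derivative (emb c d) (at x)"
  have Dsm: "smooth_on (overlap c d) (\<lambda>x. ?D x (Z x))"
  proof (rule smooth_on_linear_eval[OF op _ smooth_on_frechet[OF sm]])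
    show "linear (?D x)" if "x \<in> overlap c d" for x
      by (rule linear_frechet_derivative[OF smooth_on_differentiable[OF sm that]])
    show "smooth_on (overlap c d) Z" using overlapD(1)[OF c d] by (intro smooth_on_subset[OF Z(1)]) blast
  qed
  have Jsm: "smooth_on (overlap c d) (\<lambda>x. chart.Jc (emb c d x) (?D x (Z x)))"
  proof (rule smooth_on_linear_eval[OF op _ _ Dsm])
    show "linear (chart.Jc (emb c d x))" if "x \<in> overlap c d" for x
      by (rule chart.Jc_linear[OF overlapD(4)[OF c d that]])
    show "smooth_on (overlap c d) (\<lambda>x. chart.Jc (emb c d x) v)" for v
      by (rule smooth_on_compose[OF op chart.op im sm chart.Jc_smooth])
  qed
  have "ns \<alpha> (cinv c x) d = - chart.Jc (emb c d x) (?D x (Z x))" if x: "x \<in> overlap c d" for x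
    using chart.J_cfield[OF overlapD(4)[OF c d x], of "?D x (Z x)"]
    by (simp add: s[OF overlapD(1)[OF c d x]] incl_cfield[OF c d x] overlapD(5)[OF c d x]
        cfield_apply[OF M d overlapD(4)[OF c d x]])
  then show "smooth_on (overlap c d) (\<lambda>x. ns \<alpha> (cinv c x) d)"
    using smooth_on_cong[OF op, of "\<lambda>x. ns \<alpha> (cinv c x) d" "\<lambda>x. - chart.Jc (emb c d x) (?D x (Z x))"]
      smooth_on_minus[OF op Jsm] by blast
qed

text \<open>Smoothness of \<open>E\<close> is available in tangent bundle coordinates over one chart
  \<open>b\<close> of M. Near \<open>p\<close> the deformation is the composite of \<open>E\<close>
  with \<psi>, the section in these coordinates, and the preimage \<open>N\<close> of the open set
  \<open>W\<close> is the required neighbourhood.\<close>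

lemma deformation_mdifferentiable:
  assumes \<alpha>: "\<alpha> \<in> one_forms L" and E: "exponential_map M g D E"
    and D: "\<forall>p\<in>points L. (p, ns \<alpha> p) \<in> D" and p: "p \<in> points L"
  shows "mdifferentiable L M (\<lambda>p. E (p, ns \<alpha> p)) p"
  unfolding mdifferentiable_def
proof (intro conjI ballI p)
  let ?u = "\<lambda>p. E (p, ns \<alpha> p)"
  \<comment> \<open>The end point t = 1 of the geodesic is the image point, which therefore lies in
    M.\<close>
  have "geodesic M g (\<lambda>t. E (p, tscale t (ns \<alpha> p)))"
    using E D p unfolding exponential_map_def by blast
  then have "E (p, tscale 1 (ns \<alpha> p)) \<in> points M" unfolding geodesic_def by (force simp: image_subset_iff)
  then show "?u p \<in> points M" by (simp add: tscale_def)
  fix c d assume c: "c \<in> charts_at L p" and d: "d \<in> charts_at M (?u p)"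
  define b where "b = chart_at M p"
  have b: "b \<in> charts_at M p" unfolding b_def by (rule chart_at_in[OF p_in_M[OF p]])
  note cs = charts_atD[OF c] charts_atD[OF d] charts_atD[OF b]
  have cL: "c \<in> L" and bM: "b \<in> M" and dM: "d \<in> M" using cs by auto
  define Ec where "Ec = (\<lambda>(x, w). E (cinv b x, cfield M b w x))"
  define W where "W = {(x, w). x \<in> cimg b \<and> (cinv b x, cfield M b w x) \<in> D} \<inter> Ec -` cdom d"
  have W: "open W" "smooth_on W (cmap d \<circ> Ec)"
    using E bM dM unfolding exponential_map_def W_def Ec_def Let_def by blast+
  define \<psi> where "\<psi> = (\<lambda>x. (emb c b x, ns \<alpha> (cinv c x) b))"
  note op = overlap_open[OF cL bM]
  have psi: "smooth_on (overlap c b) \<psi>"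
    unfolding \<psi>_def by (intro smooth_on_Pair op emb_smooth[OF cL bM] normal_section_chart[OF \<alpha> cL bM])
  have Ec: "Ec (\<psi> x) = ?u (cinv c x)" "\<psi> x \<in> W \<longleftrightarrow> ?u (cinv c x) \<in> cdom d" if x: "x \<in> overlap c b" for x
  proof -
    note ov = overlapD[OF cL bM x]
    have "b \<in> charts_at M (cinv c x)" using bM ov by (simp add: charts_at_def)
    then have "cfield M b (ns \<alpha> (cinv c x) b) (emb c b x) = ns \<alpha> (cinv c x)"
      unfolding cfield_def ov(5) by (rule tvec_of_tangent[OF normal_section_chart(2)[OF \<alpha> cL bM ov(1)]])
    then show "Ec (\<psi> x) = ?u (cinv c x)" "\<psi> x \<in> W \<longleftrightarrow> ?u (cinv c x) \<in> cdom d"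
      using D ov by (auto simp: Ec_def \<psi>_def W_def)
  qed
  define N where "N = overlap c b \<inter> \<psi> -` W"
  have N: "open N"
    unfolding N_def using continuous_open_preimage[OF smooth_on_continuous[OF psi] op W(1)] .
  have x: "cmap c p \<in> overlap c b" using cs by (auto simp: overlap_def)
  have cx: "cinv c (cmap c p) = p" using cs by (simp add: cinv_cmap[OF L])
  have xN: "cmap c p \<in> N" unfolding N_def using x Ec(2)[OF x] cs by (simp add: cx)
  have "?u (cinv c x) \<in> cdom d" if "x \<in> N" for x using that Ec(2)[of x] unfolding N_def by blast
  moreover have "N \<subseteq> cimg c" using overlapD(1)[OF cL bM] unfolding N_def by blast
  ultimately show "\<exists>N. open N \<and> cmap c p \<in> N \<and> N \<subseteq> cimg c \<and> (\<forall>x\<in>N. ?u (cinv c x) \<in> cdom d)"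
    using N xN by blast
  have "smooth_on N (\<lambda>x. (cmap d \<circ> Ec) (\<psi> x))"
    by (rule smooth_on_compose[OF N W(1) _ smooth_on_subset[OF psi] W(2)]) (auto simp: N_def)
  from smooth_on_differentiable[OF this xN]
  have "(\<lambda>x. (cmap d \<circ> Ec) (\<psi> x)) differentiable (at (cmap c p))" .
  then show "(cmap d \<circ> ?u \<circ> cinv c) differentiable (at (cmap c p))"
    by (subst differentiable_cong_open[OF N xN]) (auto simp: N_def Ec(1))
qed

text \<open>Both properties pass from \<omega> to the pull-back point by point, through the linear
  differential; they are what the locale \<open>lagrangian_harmonic\<close> asks of F apart from the
  equations.\<close>

lemma F_map_form:
  assumes \<alpha>: "\<alpha> \<in> one_forms L" and E: "exponential_map M g D E"
    and D: "\<forall>p\<in>points L. (p, ns \<alpha> p) \<in> D" and p: "p \<in> points L"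
  shows "bilinear_form_at L (F_map L M J g E \<alpha>) p"
    and "X \<in> tangent_space L p \<Longrightarrow> Y \<in> tangent_space L p \<Longrightarrow> F_map L M J g E \<alpha> p X Y = - F_map L M J g E \<alpha> p Y X"
proof -
  define u where "u = (\<lambda>p. E (p, ns \<alpha> p))"
  have u: "mdifferentiable L M u p" unfolding u_def by (rule deformation_mdifferentiable[OF assms])
  have uM: "u p \<in> points M" using u by (simp add: mdifferentiable_def)
  note du = differential_in[where u = u and p = p and A = L, OF M uM]
  have F: "F_map L M J g E \<alpha> p X Y = \<omega> (u p) (differential L M u p X) (differential L M u p Y)"
    if "X \<in> tangent_space L p" "Y \<in> tangent_space L p" for X Y
    using p that by (simp add: F_map_def pullback2_def ext2_def u_def)
  have om: "\<omega> (u p) V (tadd W W') = \<omega> (u p) V W + \<omega> (u p) V W'" "\<omega> (u p) V (tscale r W) = r * \<omega> (u p) V W"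
    "\<omega> (u p) (tadd W W') V = \<omega> (u p) W V + \<omega> (u p) W' V" "\<omega> (u p) (tscale r W) V = r * \<omega> (u p) W V"
    if "V \<in> tangent_space M (u p)" "W \<in> tangent_space M (u p)" "W' \<in> tangent_space M (u p)" for V W W' r
    using omega_bilinear[OF uM] that by (auto simp: bilinear_form_at_def linear_on_tangent_def)
  show "bilinear_form_at L (F_map L M J g E \<alpha>) p"
    unfolding bilinear_form_at_def linear_on_tangent_def
    by (simp add: F L_add[OF p] L_scale[OF p] differential_add[OF L M u] differential_scale[OF L M u] om[OF du du du])
  show "F_map L M J g E \<alpha> p X Y = - F_map L M J g E \<alpha> p Y X"
    if "X \<in> tangent_space L p" "Y \<in> tangent_space L p"
    unfolding F[OF that] F[OF that(2,1)] by (rule omega_alt[OF uM du du])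
qed

end

section \<open>The Laplace equation\<close>

lemma continuous_on_linear_eval:
  fixes \<psi> :: "'a::topological_space \<Rightarrow> 'b::euclidean_space" and b :: "'a \<Rightarrow> 'b \<Rightarrow> 'c::real_normed_vector"
  assumes "\<And>x. x \<in> S \<Longrightarrow> linear (b x)" "\<And>v. continuous_on S (\<lambda>x. b x v)" "continuous_on S \<psi>"
  shows "continuous_on S (\<lambda>x. b x (\<psi> x))"
proof -
  have "continuous_on S (\<lambda>x. \<Sum>i\<in>Basis. (\<psi> x \<bullet> i) *\<^sub>R b x i)"
    using assms by (intro continuous_intros) auto
  then show ?thesis
    by (rule continuous_on_eq) (rule linear_Basis_sum[OF assms(1), symmetric])
qed

lemma continuous_on_bilinear_eval:
  fixes \<psi> :: "'a::topological_space \<Rightarrow> 'b::euclidean_space" and \<xi> :: "'a \<Rightarrow> 'd::euclidean_space"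
    and b :: "'a \<Rightarrow> 'b \<Rightarrow> 'd \<Rightarrow> 'c::real_normed_vector"
  assumes "\<And>x. x \<in> S \<Longrightarrow> bilinear (b x)" "\<And>v w. continuous_on S (\<lambda>x. b x v w)"
    "continuous_on S \<psi>" "continuous_on S \<xi>"
  shows "continuous_on S (\<lambda>x. b x (\<psi> x) (\<xi> x))"
proof (rule continuous_on_linear_eval[OF _ _ assms(4)])
  show "linear (b x (\<psi> x))" if "x \<in> S" for x using assms(1)[OF that] by (simp add: bilinear_def)
  show "continuous_on S (\<lambda>x. b x (\<psi> x) w)" for w
    by (rule continuous_on_linear_eval[OF _ assms(2,3)]) (use assms(1) in \<open>simp add: bilinear_def\<close>)
qed

text \<open>Extreme values of g(v, v) on the compact product of \<open>K\<close> with the unit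
  sphere, extended to all vectors by homogeneity.\<close>

lemma (in metric_chart) G_bounds:
  assumes K: "compact K" "K \<subseteq> cimg c"
  shows "\<exists>m>0. \<exists>C>0. \<forall>y\<in>K. \<forall>v. m * (norm v)\<^sup>2 \<le> G y v v \<and> G y v v \<le> C * (norm v)\<^sup>2"
proof (cases "K = {}")
  case True
  then show ?thesis by (auto intro!: gt_ex)
next
  case False
  let ?Q = "K \<times> sphere (0::'e) 1"
  have Q: "compact ?Q" using K by (simp add: compact_Times)
  obtain u :: 'e where "norm u = 1" using vector_choose_size[of 1] by auto
  then have ne: "?Q \<noteq> {}" using False by auto
  have cont: "continuous_on ?Q (\<lambda>z. G (fst z) (snd z) (snd z))"
  proof (rule continuous_on_bilinear_eval[where b = "\<lambda>z. G (fst z)"])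
    show "bilinear (G (fst z))" if "z \<in> ?Q" for z using that K by (intro G_bilinear) auto
    show "continuous_on ?Q (\<lambda>z. G (fst z) v w)" for v w
      by (rule continuous_on_compose2[OF smooth_on_continuous[OF G_smooth]]) (use K in \<open>auto intro!: continuous_intros\<close>)
  qed (intro continuous_intros)+
  obtain z1 where z1: "z1 \<in> ?Q" "\<And>z. z \<in> ?Q \<Longrightarrow> G (fst z1) (snd z1) (snd z1) \<le> G (fst z) (snd z) (snd z)"
    using continuous_attains_inf[OF Q ne cont] by blast
  obtain z2 where z2: "z2 \<in> ?Q" "\<And>z. z \<in> ?Q \<Longrightarrow> G (fst z) (snd z) (snd z) \<le> G (fst z2) (snd z2) (snd z2)"
    using continuous_attains_sup[OF Q ne cont] by blast
  have pos: "G (fst z) (snd z) (snd z) > 0" if "z \<in> ?Q" for z using that K by (intro G_pos) auto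
  have "G (fst z1) (snd z1) (snd z1) * (norm v)\<^sup>2 \<le> G y v v \<and> G y v v \<le> G (fst z2) (snd z2) (snd z2) * (norm v)\<^sup>2"
    if y: "y \<in> K" for y v
  proof (cases "v = 0")
    case True
    have "G y 0 0 = 0" using G_bilinear[of y] y K by (auto simp: bilinear_def linear_0)
    then show ?thesis using True by simp
  next
    case False
    let ?u = "(1 / norm v) *\<^sub>R v"
    have "(y, ?u) \<in> ?Q" using y False by simp
    note z1(2)[OF this] z2(2)[OF this]
    moreover have "G y ?u ?u = G y v v / (norm v)\<^sup>2"
    proof -
      have l: "linear (\<lambda>z. G y z w)" "linear (G y w)" for w using G_bilinear[of y] y K by (auto simp: bilinear_def)
      show ?thesis by (simp add: linear_cmul[OF l(1)] linear_cmul[OF l(2)] power2_eq_square)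
    qed
    ultimately show ?thesis using False by (simp add: field_simps)
  qed
  then show ?thesis using pos[OF z1(1)] pos[OF z2(1)] by blast
qed

lemma alternating2_eqI:
  fixes b b' :: "'a::real_vector \<Rightarrow> 'a \<Rightarrow> real" and e :: "3 \<Rightarrow> 'a"
  assumes b: "bilinear b" "\<And>v w. b v w = - b w v" and b': "bilinear b'" "\<And>v w. b' v w = - b' w v"
    and v: "v = a 1 *\<^sub>R e 1 + a 2 *\<^sub>R e 2 + a 3 *\<^sub>R e 3" and w: "w = a' 1 *\<^sub>R e 1 + a' 2 *\<^sub>R e 2 + a' 3 *\<^sub>R e 3"
    and eq: "b (e 2) (e 3) = b' (e 2) (e 3)" "b (e 3) (e 1) = b' (e 3) (e 1)" "b (e 1) (e 2) = b' (e 1) (e 2)"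
  shows "b v w = b' v w"
proof -
  have *: "B v w = (a 2 * a' 3 - a 3 * a' 2) * B (e 2) (e 3) + (a 3 * a' 1 - a 1 * a' 3) * B (e 3) (e 1) +
     (a 1 * a' 2 - a 2 * a' 1) * B (e 1) (e 2)" if B: "bilinear B" and alt: "\<And>v w. B v w = - B w v" for B
  proof -
    have l1: "linear (\<lambda>z. B z w)" and l2: "linear (B z)" for z w using B by (auto simp: bilinear_def)
    have z: "B u u = 0" for u using alt[of u u] by simp
    have "B (e 3) (e 2) = - B (e 2) (e 3)" "B (e 1) (e 3) = - B (e 3) (e 1)" "B (e 2) (e 1) = - B (e 1) (e 2)"
      by (rule alt)+
    then show ?thesis
      unfolding v w
      by (simp add: linear_add[OF l1] linear_add[OF l2] linear_cmul[OF l1] linear_cmul[OF l2] z algebra_simps)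
  qed
  show ?thesis unfolding *[OF b] *[OF b'] eq ..
qed

lemma d0_chart:
  assumes A: "smooth_manifold A" and f: "smooth_fun A f" and c: "c \<in> charts_at A p" and X: "X \<in> tangent_space A p"
  shows "d0 A f p X = frechet_derivative (\<lambda>x. f (cinv c x)) (at (cmap c p)) (X c)"
proof -
  define c0 where "c0 = chart_at A p"
  have c0: "c0 \<in> charts_at A p" using c charts_at_points c0_def chart_at_in by metis
  note cs = charts_atD[OF c] charts_atD[OF c0]
  have "((\<lambda>x. f (cinv c x)) has_derivative frechet_derivative (\<lambda>x. f (cinv c x)) (at (cmap c p)))
      (at ((cmap c \<circ> cinv c0) (cmap c0 p)))"
    using f cs by (simp add: cinv_cmap[OF A])
      (intro smooth_on_has_derivative[of "cimg c"]; auto simp: smooth_fun_def)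
  from diff_chain_at[OF has_derivative_transition[OF A c0 c] this]
  have 1: "((\<lambda>x. f (cinv c x)) \<circ> (cmap c \<circ> cinv c0) has_derivative
     frechet_derivative (\<lambda>x. f (cinv c x)) (at (cmap c p)) \<circ> coord_change c0 c p) (at (cmap c0 p))" .
  have "(f \<circ> cinv c0 has_derivative
     frechet_derivative (\<lambda>x. f (cinv c x)) (at (cmap c p)) \<circ> coord_change c0 c p) (at (cmap c0 p))"
    by (rule has_derivative_transform_within_open[OF 1 open_overlap[OF A, of c0 c]])
      (use cs in \<open>auto simp: cinv_cmap[OF A]\<close>)
  from frechet_derivative_eqI[OF this] show ?thesis
    by (simp only: d0_def Let_def c0_def[symmetric] comp_apply tangent_space_change[OF X c0 c])
qed

text \<open>The two equations for an abstract 2-form. Regularity is imposed on \<open>f\<close>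
  alone; that of \<open>F\<close> is derived from the first equation through
  \<open>F_chart\<close>.\<close>

locale lagrangian_harmonic = lagrangian M J g L l
  for M :: "('m::{t2_space, second_countable_topology}, real ^ 6) atlas" and J g L l +
  fixes F :: "('m, real ^ 3) form2" and f :: "'m \<Rightarrow> real"
  assumes F_bilinear: "\<And>p. p \<in> points L \<Longrightarrow> bilinear_form_at L F p"
    and F_alt: "\<And>p X Y. p \<in> points L \<Longrightarrow> X \<in> tangent_space L p \<Longrightarrow> Y \<in> tangent_space L p \<Longrightarrow> F p X Y = - F p Y X"
    and f: "smooth_fun L f"
    and star_F: "\<And>p X. p \<in> points L \<Longrightarrow> X \<in> tangent_space L p \<Longrightarrow> hodge2 L h vol F p X + d0 L f p X = 0"
    and star_dF: "\<And>p. p \<in> points L \<Longrightarrow> hodge3 L h vol (d2 L F) p = 0"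
begin

text \<open>The same \<open>SOME\<close> term as in \<open>hodge2\<close> and \<open>hodge3\<close>,
  so that both stars unfold to values in this frame.\<close>

definition frame :: "'m \<Rightarrow> 3 \<Rightarrow> ('m, real ^ 3) tv" where
  "frame p = (SOME e. oriented_frame L h vol p e)"

lemma frame: 
  assumes "p \<in> points L"
  shows "frame p i \<in> tangent_space L p" "h p (frame p i) (frame p j) = (if i = j then 1 else 0)"
    "vol p (frame p 1) (frame p 2) (frame p 3) = 1"
proof -
  have o: "oriented_frame L h vol p (frame p)"
    unfolding frame_def by (rule someI_ex[OF oriented_frame_exists[OF assms]])
  then show "frame p i \<in> tangent_space L p" "h p (frame p i) (frame p j) = (if i = j then 1 else 0)"
    by (auto simp: oriented_frame_def)
  show "vol p (frame p 1) (frame p 2) (frame p 3) = 1" by (rule oriented_frame_vol[OF assms o])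
qed

lemma F_frame:
  assumes p: "p \<in> points L"
  shows "F p (frame p 2) (frame p 3) = - d0 L f p (frame p 1)"
    "F p (frame p 3) (frame p 1) = - d0 L f p (frame p 2)"
    "F p (frame p 1) (frame p 2) = - d0 L f p (frame p 3)"
    "d2 L F p (frame p 1) (frame p 2) (frame p 3) = 0"
  using star_F[OF p frame(1)[OF p], of 1] star_F[OF p frame(1)[OF p], of 2] star_F[OF p frame(1)[OF p], of 3] star_dF[OF p]
  by (simp_all add: hodge2_def hodge3_def Let_def frame_def[symmetric] frame(2)[OF p])

section \<open>The first equation solved for F in a chart of L\<close>

context
  fixes c assumes c: "c \<in> L"
begin

interpretation chart: metric_chart L h c by (rule h_chart[OF c])

abbreviation "fc \<equiv> \<lambda>x. f (cinv c x)"
abbreviation "Df \<equiv> \<lambda>x. frechet_derivative fc (at x)"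

lemma fc_smooth: "smooth_on (cimg c) fc"
  using f c by (simp add: smooth_fun_def)

lemma Df_linear: "x \<in> cimg c \<Longrightarrow> linear (Df x)"
  by (rule linear_frechet_derivative[OF smooth_on_differentiable[OF fc_smooth]])

definition grad :: "real ^ 3 \<Rightarrow> real ^ 3" where
  "grad = (SOME Z. smooth_on (cimg c) Z \<and> (\<forall>x\<in>cimg c. \<forall>w. local_metric L h c x (Z x) w = Df x w))"

lemma grad: "smooth_on (cimg c) grad" "x \<in> cimg c \<Longrightarrow> chart.G x (grad x) w = Df x w"
proof -
  have "smooth_on (cimg c) grad \<and> (\<forall>x\<in>cimg c. \<forall>w. local_metric L h c x (grad x) w = Df x w)"
    unfolding grad_def
    by (rule someI_ex[OF covector_representation[OF c Df_linear smooth_on_frechet[OF fc_smooth]]])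
  then show "smooth_on (cimg c) grad" "x \<in> cimg c \<Longrightarrow> chart.G x (grad x) w = Df x w" by blast+
qed

definition fr :: "real ^ 3 \<Rightarrow> 3 \<Rightarrow> real ^ 3" where
  "fr x i = frame (cinv c x) i c"

context
  fixes x assumes x: "x \<in> cimg c"
begin

lemma cfield_fr: "cfield L c (fr x i) x = frame (cinv c x) i"
  unfolding fr_def cfield_def
  by (rule tvec_of_tangent[OF frame(1)[OF L_pt[OF c x]] cinv_charts_at[OF L c x]])

lemma fr_orthonormal: "chart.G x (fr x i) (fr x j) = (if i = j then 1 else 0)"
  by (simp add: local_metric_def cfield_fr frame(2)[OF L_pt[OF c x]])

lemma fr_vol: "kappa c x * vdet (fr x 1) (fr x 2) (fr x 3) = 1"
  using vol_chart[OF c x, of "fr x 1" "fr x 2" "fr x 3"] frame(3)[OF L_pt[OF c x]] by (simp add: cfield_fr)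

lemma kappa_nonzero: "kappa c x \<noteq> 0"
  using fr_vol by auto

lemma fr_expansion: "v = (\<Sum>i\<in>UNIV. chart.G x v (fr x i) *\<^sub>R fr x i)"
  by (rule orthonormal_expansion[OF chart.G_bilinear[OF x] chart.G_pos[OF x]]) (simp_all add: fr_orthonormal)

lemma fr_expansion3: "v = chart.G x v (fr x 1) *\<^sub>R fr x 1 + chart.G x v (fr x 2) *\<^sub>R fr x 2 + chart.G x v (fr x 3) *\<^sub>R fr x 3"
  using fr_expansion[of v] by (simp add: sum_3)

text \<open>In an oriented orthonormal frame vol(v, e2, e3) is the coefficient g(v, e1), and
  cyclically; this is Cramer's rule with determinant 1.\<close>

lemma vdet_fr:
  "kappa c x * vdet v (fr x 2) (fr x 3) = chart.G x v (fr x 1)"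
  "kappa c x * vdet v (fr x 3) (fr x 1) = chart.G x v (fr x 2)"
  "kappa c x * vdet v (fr x 1) (fr x 2) = chart.G x v (fr x 3)"
proof -
  have 1: "kappa c x * (a * vdet (fr x 1) (fr x 2) (fr x 3)) = a" for a
    using fr_vol by (simp add: mult.left_commute)
  note vdet.frame[where a = "\<lambda>i. chart.G x v (fr x i)" and e = "fr x", OF fr_expansion3[of v]]
  then show "kappa c x * vdet v (fr x 2) (fr x 3) = chart.G x v (fr x 1)"
    "kappa c x * vdet v (fr x 3) (fr x 1) = chart.G x v (fr x 2)"
    "kappa c x * vdet v (fr x 1) (fr x 2) = chart.G x v (fr x 3)"
    by (simp_all only: 1)
qed

lemma d0_fr: "d0 L f (cinv c x) (frame (cinv c x) i) = Df x (fr x i)"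
  using d0_chart[OF L f cinv_charts_at[OF L c x] frame(1)[OF L_pt[OF c x]], of i]
  by (simp add: cmap_cinv[OF L c x] fr_def)

text \<open>\<open>*F = - df\<close> solved for \<open>F\<close>: \<open>F = - vol (grad f, \<cdot>, \<cdot>)\<close>.\<close>

lemma F_chart: "local_metric L F c x v w = - kappa c x * vdet (grad x) v w"
proof (rule alternating2_eqI[OF _ _ _ _ fr_expansion3[of v] fr_expansion3[of w]])
  note q = L_pt[OF c x]
  show "bilinear (local_metric L F c x)" by (rule bilinear_local_metric[OF L c x F_bilinear[OF q]])
  show "local_metric L F c x v w = - local_metric L F c x w v" for v w
    unfolding local_metric_def by (intro F_alt q cfield_in[OF L c x])
  show "bilinear (\<lambda>v w. - kappa c x * vdet (grad x) v w)"
    by (auto simp: bilinear_def linear_iff vdet.add2 vdet.add3 vdet.scale2 vdet.scale3 algebra_simps)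
  show "- kappa c x * vdet (grad x) v w = - (- kappa c x * vdet (grad x) w v)" for v w
    using vdet.alt23[of "grad x" v w] by simp
qed (simp_all add: local_metric_def cfield_fr F_frame[OF L_pt[OF c x]] d0_fr
    vdet_fr grad(2)[OF x, symmetric] flip: mult_minus_left) 

end

end

end

section \<open>The Laplace equation in a chart and the local maximum principle for f\<close>

context lagrangian_harmonic
begin

context
  fixes c assumes c: "c \<in> L"
begin

interpretation chart: metric_chart L h c by (rule h_chart[OF c])

abbreviation "DH \<equiv> \<lambda>x u v w. frechet_derivative (\<lambda>y. local_metric L h c y v w) (at x) u"
abbreviation "Dk \<equiv> \<lambda>x. frechet_derivative (kappa c) (at x)"
abbreviation "D2f \<equiv> \<lambda>x u. frechet_derivative (\<lambda>y. Df c y u) (at x) u"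

text \<open>The first order coefficient of the Laplace operator in the frame \<open>e\<close>.\<close>

definition drift :: "real ^ 3 \<Rightarrow> (3 \<Rightarrow> real ^ 3) \<Rightarrow> real ^ 3" where
  "drift x e = (\<Sum>k\<in>UNIV. (Dk x (e k) / kappa c x) *\<^sub>R e k) -
     (\<Sum>m\<in>UNIV. (\<Sum>k\<in>UNIV. DH x (e k) (e m) (e k)) *\<^sub>R e m)"

text \<open>With F = - vol(Z, ., .) and Z = grad f, the equation dF = 0 says that the trace of DZ
  plus the logarithmic derivative of \<open>kappa\<close> along Z vanishes. Differentiating g(Z, w)
  = df(w) replaces DZ by second derivatives of f; the derivatives of g that appear go into
  \<open>drift\<close>.\<close>

lemma laplace_equation:
  assumes x: "x \<in> cimg c"
  shows "(\<Sum>k\<in>UNIV. D2f x (fr c x k)) + Df c x (drift x (fr c x)) = 0"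
proof -
  define e where "e = fr c x"
  define Z where "Z = grad c"
  define Dz where "Dz = frechet_derivative Z (at x)"
  note op = chart.op
  have Z: "(Z has_derivative Dz) (at x)"
    unfolding Z_def Dz_def by (rule smooth_on_has_derivative[OF grad(1)[OF c] x])
  have GZ: "chart.G y (Z y) w = Df c y w" if "y \<in> cimg c" for y w
    unfolding Z_def by (rule grad(2)[OF c that])
  have k: "(kappa c has_derivative Dk x) (at x)" by (rule smooth_on_has_derivative[OF kappa_smooth[OF c] x])
  have lf: "linear (Df c x)" by (rule Df_linear[OF c x])
  let ?b = "\<lambda>y v w. - kappa c y * vdet (Z y) v w"
  have b: "((\<lambda>y. ?b y v w) has_derivative (\<lambda>u. - (kappa c x * vdet (Dz u) v w) - Dk x u * vdet (Z x) v w)) (at x)" for v w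
  proof -
    have "bounded_linear (\<lambda>u. vdet u v w)"
      unfolding linear_conv_bounded_linear[symmetric] by (rule linearI) (simp_all add: vdet.add1 vdet.scale1)
    from has_derivative_mult[OF has_derivative_minus[OF k] bounded_linear.has_derivative[OF this Z]]
    show ?thesis by (rule has_derivative_eq_rhs) (simp add: fun_eq_iff)
  qed
  have eqF: "local_metric L F c y v w = ?b y v w" if "y \<in> cimg c" for y v w
    unfolding Z_def by (rule F_chart[OF c that])
  have "0 = d2 L F (cinv c x) (frame (cinv c x) 1) (frame (cinv c x) 2) (frame (cinv c x) 3)"
    using F_frame(4)[OF L_pt[OF c x]] by simp
  also have "\<dots> = ext_deriv2 (local_metric L F c) (cmap c (cinv c x))
      (frame (cinv c x) 1 c) (frame (cinv c x) 2 c) (frame (cinv c x) 3 c)"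
  proof (intro d2_chart[OF L cinv_charts_at[OF L c x]] frame(1)[OF L_pt[OF c x]] F_bilinear F_alt)
    fix v w
    \<comment> \<open>The differentiability of F comes from the formula \<open>eqF\<close>, whose
      right side is differentiable by \<open>b\<close>.\<close>
    have "(\<lambda>y. local_metric L F c y v w) differentiable (at x)"
      by (rule differentiableI, rule has_derivative_transform_within_open[OF b op x]) (rule eqF[symmetric])
    then show "(\<lambda>y. local_metric L F c y v w) differentiable (at (cmap c (cinv c x)))"
      by (simp add: cmap_cinv[OF L c x])
  qed
  also have "\<dots> = ext_deriv2 (local_metric L F c) x (e 1) (e 2) (e 3)"
    by (simp add: cmap_cinv[OF L c x] e_def fr_def[OF c])
  also have "\<dots> = ext_deriv2 ?b x (e 1) (e 2) (e 3)"
    by (simp only: ext_deriv2_cong_open[OF op x eqF])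
  finally have 0: "ext_deriv2 ?b x (e 1) (e 2) (e 3) = 0" by simp
  have kn: "kappa c x \<noteq> 0" by (rule kappa_nonzero[OF c x])
  note vd = vdet_fr[OF c x, folded e_def]
  have vd': "vdet v (e 2) (e 3) = chart.G x v (e 1) / kappa c x"
    "vdet v (e 1) (e 3) = - (chart.G x v (e 2) / kappa c x)"
    "vdet v (e 1) (e 2) = chart.G x v (e 3) / kappa c x" for v
    using vd[of v] kn vdet.alt23[of v "e 1" "e 3"] by (auto simp: field_simps)
  \<comment> \<open>Each of the three terms of dF contains one diagonal entry of DZ and one
    derivative of \<open>kappa\<close>; \<open>vd'\<close> turns the determinants into metric
    products over \<open>kappa\<close>.\<close>
  have sum0: "(\<Sum>k\<in>UNIV. chart.G x (Dz (e k)) (e k)) + (\<Sum>k\<in>UNIV. Dk x (e k) / kappa c x * Df c x (e k)) = 0"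
    using 0 unfolding ext_deriv2_def frechet_derivative_eqI[OF b]
    unfolding vd' GZ[OF x] sum_3 using kn by simp
  have D2: "frechet_derivative (\<lambda>y. Df c y w) (at x) u = DH x u (Z x) w + chart.G x (Dz u) w" for u w
  proof -
    have "((\<lambda>y. chart.G y (Z y) w) has_derivative (\<lambda>u. DH x u (Z x) w + chart.G x (Dz u) w)) (at x)"
      using chart.G_bilinear
      by (intro has_derivative_linear_eval[OF op x, of "\<lambda>x v. chart.G x v w"] chart.G_differentiable[OF x] Z)
        (auto simp: bilinear_def)
    from frechet_derivative_eqI[OF this]
    have "frechet_derivative (\<lambda>y. chart.G y (Z y) w) (at x) u = DH x u (Z x) w + chart.G x (Dz u) w"
      by (rule fun_cong)
    moreover have "frechet_derivative (\<lambda>y. chart.G y (Z y) w) (at x) = frechet_derivative (\<lambda>y. Df c y w) (at x)"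
      by (rule frechet_derivative_cong_open[OF op x GZ])
    ultimately show ?thesis by simp
  qed
  have "Z x = (\<Sum>m\<in>UNIV. Df c x (e m) *\<^sub>R e m)"
    using fr_expansion[OF c x, of "Z x"] by (simp add: GZ[OF x] e_def)
  then have DHZ: "DH x u (Z x) w = (\<Sum>m\<in>UNIV. Df c x (e m) * DH x u (e m) w)" for u w
    by (simp add: linear_sum[OF chart.G_derivative_linear(2)[OF x]] linear_cmul[OF chart.G_derivative_linear(2)[OF x]])
  have "Df c x (drift x e) = (\<Sum>k\<in>UNIV. Dk x (e k) / kappa c x * Df c x (e k)) -
     (\<Sum>m\<in>UNIV. (\<Sum>k\<in>UNIV. DH x (e k) (e m) (e k)) * Df c x (e m))"
    unfolding drift_def by (simp add: linear_diff[OF lf] linear_sum[OF lf] linear_cmul[OF lf])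
  moreover have "(\<Sum>m\<in>UNIV. (\<Sum>k\<in>UNIV. DH x (e k) (e m) (e k)) * Df c x (e m)) = (\<Sum>k\<in>UNIV. DH x (e k) (Z x) (e k))"
    unfolding DHZ sum_distrib_right by (subst sum.swap) (simp add: mult.commute)
  moreover have "(\<Sum>k\<in>UNIV. D2f x (e k)) = (\<Sum>k\<in>UNIV. DH x (e k) (Z x) (e k)) + (\<Sum>k\<in>UNIV. chart.G x (Dz (e k)) (e k))"
    unfolding D2 by (simp add: sum.distrib)
  ultimately show ?thesis using sum0 unfolding e_def[symmetric] by linarith
qed

text \<open>The frame may jump from point to point, so compactness is not applied to x alone.
  \<open>drift\<close> is continuous as a function of the pair of point and frame, and all pairs
  that occur lie in a compact set.\<close>

lemma drift_bounded:
  assumes K: "compact K" "K \<subseteq> cimg c"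
  shows "\<exists>B. \<forall>x\<in>K. norm (drift x (fr c x)) \<le> B"
proof -
  obtain m C where m: "m > 0" "\<And>y v. y \<in> K \<Longrightarrow> m * (norm v)\<^sup>2 \<le> chart.G y v v"
    using chart.G_bounds[OF K] by blast
  \<comment> \<open>A frame vector e satisfies m |e|^2 \<le> g(e, e) = 1; a triple of them has norm
    at most the sum of the three norms.\<close>
  let ?Q = "K \<times> cball (0 :: (real ^ 3) ^ 3) (3 * sqrt (1 / m))"
  have Q: "compact ?Q" using K by (simp add: compact_Times)
  have fstQ: "fst z \<in> cimg c" if "z \<in> ?Q" for z using that K by auto
  have comp: "continuous_on ?Q (\<lambda>z. k (fst z))" if "smooth_on (cimg c) k" for k :: "real ^ 3 \<Rightarrow> real"
    by (rule continuous_on_compose2[OF smooth_on_continuous[OF that]]) (use K in \<open>auto intro!: continuous_intros\<close>)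
  have e: "continuous_on ?Q (\<lambda>z. snd z $ k)" for k by (intro continuous_intros)
  have Dk: "continuous_on ?Q (\<lambda>z. Dk (fst z) (snd z $ k))" for k
  proof (rule continuous_on_linear_eval[OF _ _ e])
    show "linear (Dk (fst z))" if "z \<in> ?Q" for z
      by (rule linear_frechet_derivative[OF smooth_on_differentiable[OF kappa_smooth[OF c] fstQ[OF that]]])
    show "continuous_on ?Q (\<lambda>z. Dk (fst z) v)" for v
      by (rule comp[OF smooth_on_frechet[OF kappa_smooth[OF c]]])
  qed
  have DH1: "continuous_on ?Q (\<lambda>z. DH (fst z) (snd z $ k) v w)" for k v w
    by (rule continuous_on_linear_eval[OF chart.G_derivative_linear(1)[OF fstQ] comp[OF smooth_on_frechet[OF chart.G_smooth]] e])
  have DH2: "continuous_on ?Q (\<lambda>z. DH (fst z) (snd z $ k) (snd z $ j) w)" for k j w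
    by (rule continuous_on_linear_eval[OF chart.G_derivative_linear(2)[OF fstQ] DH1 e])
  have lin3: "linear (\<lambda>w. DH x u v w)" if "x \<in> cimg c" for x u v
    using chart.G_derivative_linear(2)[OF that, of v u] chart.G_derivative_linear(3)[OF that, of v _ u] by simp
  have DH3: "continuous_on ?Q (\<lambda>z. DH (fst z) (snd z $ k) (snd z $ j) (snd z $ i))" for k j i
    by (rule continuous_on_linear_eval[OF lin3[OF fstQ] DH2 e])
  have "continuous_on ?Q (\<lambda>z. drift (fst z) (\<lambda>k. snd z $ k))"
    unfolding drift_def
    by (rule continuous_on_diff[OF continuous_on_sum[OF continuous_on_scaleR[OF
          continuous_on_divide[OF Dk comp[OF kappa_smooth[OF c]]] e]]
        continuous_on_sum[OF continuous_on_scaleR[OF continuous_on_sum[OF DH3] e]]])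
      (rule ballI, rule kappa_nonzero[OF c fstQ])
  then have "compact ((\<lambda>z. drift (fst z) (\<lambda>k. snd z $ k)) ` ?Q)" by (rule compact_continuous_image[OF _ Q])
  from compact_imp_bounded[OF this]
  obtain B where "\<forall>v\<in>(\<lambda>z. drift (fst z) (\<lambda>k. snd z $ k)) ` ?Q. norm v \<le> B"
    unfolding bounded_iff ..
  then have B: "norm (drift (fst z) (\<lambda>k. snd z $ k)) \<le> B" if "z \<in> ?Q" for z
    using that by blast
  have "norm (drift x (fr c x)) \<le> B" if x: "x \<in> K" for x
  proof -
    have xc: "x \<in> cimg c" using x K by blast
    define v where "v = (\<chi> k. fr c x k)"
    have "norm (fr c x k) \<le> sqrt (1 / m)" for k
    proof (rule real_le_rsqrt)
      show "(norm (fr c x k))\<^sup>2 \<le> 1 / m"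
        using m(2)[OF x, of "fr c x k"] m(1) fr_orthonormal[OF c xc, of k k] by (simp add: field_simps)
    qed
    then have "(\<Sum>k\<in>UNIV. norm (v $ k)) \<le> (\<Sum>k\<in>(UNIV :: 3 set). sqrt (1 / m))"
      unfolding v_def by (intro sum_mono) simp
    then have "norm v \<le> 3 * sqrt (1 / m)"
      using L2_set_le_sum[of UNIV "\<lambda>k. norm (v $ k)"] by (simp add: norm_vec_def)
    then have "norm (drift x (\<lambda>k. v $ k)) \<le> B" using B[of "(x, v)"] x by simp
    then show ?thesis by (simp add: v_def)
  qed
  then show ?thesis by blast
qed

lemma maximum_locally_constant:
  assumes y0: "y0 \<in> cimg c" and max: "\<And>x. x \<in> cimg c \<Longrightarrow> fc c x \<le> fc c y0"
  shows "\<exists>r>0. \<forall>x\<in>ball y0 r. x \<in> cimg c \<and> fc c x = fc c y0"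
proof -
  obtain r0 where r0: "r0 > 0" "cball y0 r0 \<subseteq> cimg c" using chart.op y0 open_contains_cball by blast
  let ?K = "cball y0 r0"
  have bc: "x \<in> cimg c" "x \<in> ?K" if "x \<in> ball y0 r0" for x using that r0(2) by (auto intro!: subsetD[OF r0(2)])
  obtain m C where m: "m > 0" "\<And>y v. y \<in> ?K \<Longrightarrow> m * (norm v)\<^sup>2 \<le> chart.G y v v"
    and C: "C > 0" "\<And>y v. y \<in> ?K \<Longrightarrow> chart.G y v v \<le> C * (norm v)\<^sup>2"
    using chart.G_bounds[OF compact_cball r0(2)] by blast
  obtain B where B: "\<And>x. x \<in> ?K \<Longrightarrow> norm (drift x (fr c x)) \<le> B"
    using drift_bounded[OF compact_cball r0(2)] by blast
  \<comment> \<open>Pairing v with its frame expansion, Cauchy-Schwarz and Parseval give |v|^4 \<le>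
    g(v, v) S \<le> C |v|^2 S for the sum S on the right. This is the ellipticity constant 1 /
    C.\<close>
  have ell: "(1 / C) * (norm v)\<^sup>2 \<le> (\<Sum>i\<in>UNIV. (v \<bullet> fr c x i)\<^sup>2)" if x: "x \<in> ball y0 r0" for x v
  proof (cases "v = 0")
    case False
    let ?S = "\<Sum>i\<in>UNIV. (v \<bullet> fr c x i)\<^sup>2"
    have "v \<bullet> v = v \<bullet> (\<Sum>i\<in>UNIV. chart.G x v (fr c x i) *\<^sub>R fr c x i)"
      using fr_expansion[OF c bc(1)[OF x], of v] by simp
    also have "\<dots> = (\<Sum>i\<in>UNIV. chart.G x v (fr c x i) * (v \<bullet> fr c x i))" by (simp add: inner_sum_right)
    finally have "(v \<bullet> v)\<^sup>2 \<le> (\<Sum>i\<in>UNIV. (chart.G x v (fr c x i))\<^sup>2) * ?S"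
      using Cauchy_Schwarz_ineq_sum[of "\<lambda>i. chart.G x v (fr c x i)" "\<lambda>i. v \<bullet> fr c x i" UNIV] by simp
    also have "(\<Sum>i\<in>UNIV. (chart.G x v (fr c x i))\<^sup>2) = chart.G x v v"
      using orthonormal_parseval[OF chart.G_bilinear chart.G_pos _ _ fr_orthonormal[OF c], of x UNIV v v] bc[OF x]
      by (simp add: power2_eq_square)
    also have "chart.G x v v * ?S \<le> C * (norm v)\<^sup>2 * ?S"
      using C(2)[OF bc(2)[OF x]] by (intro mult_right_mono sum_nonneg) auto
    finally have "(norm v)\<^sup>2 * (norm v)\<^sup>2 \<le> (norm v)\<^sup>2 * (C * ?S)"
      by (simp add: power2_norm_eq_inner power2_eq_square[of "v \<bullet> v"] mult_ac)
    moreover have "(norm v)\<^sup>2 > 0" using False by simp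
    ultimately have "(norm v)\<^sup>2 \<le> C * ?S" by (rule mult_left_le_imp_le)
    then show ?thesis using C(1) by (simp add: field_simps)
  qed (simp add: sum_nonneg)
  have fr_bd: "norm (fr c x i) \<le> max B (sqrt (1 / m))" if x: "x \<in> ball y0 r0" for x i
  proof -
    have "norm (fr c x i) \<le> sqrt (1 / m)"
    proof (rule real_le_rsqrt)
      show "(norm (fr c x i))\<^sup>2 \<le> 1 / m"
        using m(2)[OF bc(2)[OF x], of "fr c x i"] m(1) fr_orthonormal[OF c bc(1)[OF x], of i i] by (simp add: field_simps)
    qed
    then show ?thesis by simp
  qed
  have "\<exists>r>0. \<forall>x\<in>ball y0 r. x \<in> ball y0 r0 \<and> fc c x = fc c y0"
  proof (rule strong_maximum_principle_local[where \<theta> = "1 / C" and C = "max B (sqrt (1 / m))" and e = "fr c"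
        and I = UNIV and \<beta> = "\<lambda>x. drift x (fr c x)"])
    show "smooth_on (ball y0 r0) (fc c)"
      using bc by (intro smooth_on_subset[OF fc_smooth[OF c]]) auto
    show "norm (drift x (fr c x)) \<le> max B (sqrt (1 / m))" if "x \<in> ball y0 r0" for x
      using B[OF bc(2)[OF that]] by simp
  qed (use r0 C ell fr_bd max bc laplace_equation in auto)
  then show ?thesis using bc by blast
qed

end

section \<open>From charts to the manifold: the set of maximum points is open and closed\<close>

lemma f_constant:
  shows "\<exists>C. \<forall>p\<in>points L. f p = C"
proof (cases "points L = {}")
  case False
  have chart_cont: "continuous_on (cdom c) f" if c: "c \<in> L" for c
  proof -
    have hom: "homeomorphism (cdom c) (cimg c) (cmap c) (cinv c)"
      using L c unfolding smooth_manifold_def by blast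
    have "continuous_on (cdom c) (\<lambda>q. f (cinv c (cmap c q)))"
      using continuous_on_compose2[OF smooth_on_continuous[OF fc_smooth[OF c]] homeomorphism_cont1[OF hom]] by blast
    then show ?thesis by (rule continuous_on_eq) (simp add: cinv_cmap[OF L c])
  qed
  have opc: "openin (top_of_set (points L)) (cdom c)" if "c \<in> L" for c
    using L that unfolding smooth_manifold_def by blast
  have cont: "continuous_on (points L) f"
    unfolding continuous_on_eq_continuous_within
  proof
    fix q assume "q \<in> points L"
    then obtain c where c: "c \<in> L" "q \<in> cdom c" by (auto simp: points_def)
    obtain T where T: "open T" "cdom c = points L \<inter> T" using opc[OF c(1)] by (auto simp: openin_open)
    have "at q within points L = at q within cdom c"
      using c T by (intro at_within_nhd[of q T]) auto
    then show "continuous (at q within points L) f"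
      using chart_cont[OF c(1)] c(2) by (simp add: continuous_on_eq_continuous_within)
  qed
  obtain p where p: "p \<in> points L" "\<And>q. q \<in> points L \<Longrightarrow> f q \<le> f p"
    using continuous_attains_sup[OF L_compact False cont] by blast
  define P where "P = {q \<in> points L. f q = f p}"
  have "openin (top_of_set (points L)) P"
  proof (subst openin_subopen, intro ballI)
    fix q assume q: "q \<in> P"
    then obtain c where c: "c \<in> L" "q \<in> cdom c" by (auto simp: P_def points_def)
    have hom: "homeomorphism (cdom c) (cimg c) (cmap c) (cinv c)"
      using L c unfolding smooth_manifold_def by blast
    have max: "f (cinv c x) \<le> f (cinv c (cmap c q))" if "x \<in> cimg c" for x
      using q p(2)[OF L_pt[OF c(1) that]] by (simp add: cinv_cmap[OF L c] P_def)
    obtain r where r: "r > 0" "\<And>x. x \<in> ball (cmap c q) r \<Longrightarrow> x \<in> cimg c \<and> f (cinv c x) = f (cinv c (cmap c q))"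
      using maximum_locally_constant[OF c(1) _ max] c(2) by blast
    let ?T = "cdom c \<inter> cmap c -` ball (cmap c q) r"
    have "openin (top_of_set (cdom c)) ?T"
      by (rule continuous_openin_preimage_gen[OF homeomorphism_cont1[OF hom]]) simp
    then have "openin (top_of_set (points L)) ?T" using opc[OF c(1)] openin_trans by blast
    moreover have "q \<in> ?T" using c r by simp
    moreover have "?T \<subseteq> P"
    proof
      fix q' assume q': "q' \<in> ?T"
      then have "f (cinv c (cmap c q')) = f (cinv c (cmap c q))" using r(2)[of "cmap c q'"] by simp
      then have "f q' = f q" using q' c cinv_cmap[OF L c(1)] by simp
      then show "q' \<in> P" using q q' c by (auto simp: P_def points_def)
    qed
    ultimately show "\<exists>T. openin (top_of_set (points L)) T \<and> q \<in> T \<and> T \<subseteq> P" by blast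
  qed
  moreover have "closedin (top_of_set (points L)) P"
    unfolding P_def by (rule continuous_closedin_preimage_constant[OF cont])
  moreover have "P \<noteq> {}" using p by (auto simp: P_def)
  ultimately have "P = points L" using L_connected unfolding connected_clopen by blast
  then show ?thesis unfolding P_def by blast
qed simp

end

section \<open>Functions of mean zero\<close>

text \<open>As \<open>k\<close> vanishes off a compact subset of \<open>S\<close>, its extension by
  zero is continuous on the whole space. This makes \<open>k\<close> integrable on the open set
  \<open>S\<close>, so a zero value of \<open>integral\<close> is a true integral and not the
  default for nonintegrable functions.\<close>

lemma compact_support_integral:
  fixes k :: "'a::euclidean_space \<Rightarrow> real"
  assumes S: "open S" and K: "compact K" "K \<subseteq> S" and k: "continuous_on S k" "\<And>x. x \<in> S - K \<Longrightarrow> k x = 0"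
    and pos: "\<And>x. x \<in> S \<Longrightarrow> k x \<ge> 0"
  shows "integral S k \<ge> 0" and "integral S k = 0 \<Longrightarrow> x \<in> S \<Longrightarrow> k x = 0"
proof -
  define k' where "k' = (\<lambda>x. if x \<in> S then k x else 0)"
  have "continuous_on S k'" using k(1) by (simp add: k'_def cong: continuous_on_cong)
  moreover have "continuous_on (- K) k'"
  proof -
    have "k' x = 0" if "x \<in> - K" for x using that k(2) by (auto simp: k'_def)
    then show ?thesis using continuous_on_cong[of "- K" "- K" k' "\<lambda>x. 0"] by simp
  qed
  ultimately have "continuous_on (S \<union> - K) k'"
    using S K(1) by (intro continuous_on_open_Un) (auto simp: compact_imp_closed open_Compl)
  moreover have "S \<union> - K = UNIV" using K(2) by auto
  ultimately have cont: "continuous_on UNIV k'" by simp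
  have main: "\<exists>i. (k has_integral i) S \<and> i \<ge> 0 \<and> (i = 0 \<longrightarrow> x \<in> S \<longrightarrow> k x = 0)" for x
  proof -
    \<comment> \<open>The box has to contain \<open>x\<close> besides \<open>K\<close>, because the
      vanishing result for nonnegative continuous integrands concerns points of the box.\<close>
    have "bounded (insert x K)" using K(1) compact_imp_bounded by simp
    then obtain a where a: "insert x K \<subseteq> box (- a) a" using bounded_subset_box_symmetric by metis
    then have x: "x \<in> cbox (- a) a" "box (- a) a \<noteq> {}" using box_subset_cbox by blast+
    have contb: "continuous_on (cbox (- a) a) k'" using cont continuous_on_subset by blast
    define i where "i = integral (cbox (- a) a) k'"
    have i: "(k' has_integral i) (cbox (- a) a)"
      unfolding i_def by (rule integrable_integral[OF integrable_continuous[OF contb]])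
    have k'pos: "k' y \<ge> 0" for y using pos by (simp add: k'_def)
    have "k' y = 0" if "y \<notin> cbox (- a) a" for y
      using that a box_subset_cbox[of "- a" a] k(2) by (auto simp: k'_def)
    then have "(k' has_integral i) UNIV" by (rule has_integral_on_superset[OF i]) auto
    then have "(k has_integral i) S" unfolding k'_def by (simp add: has_integral_restrict_UNIV)
    moreover have "i \<ge> 0" by (rule has_integral_nonneg[OF i k'pos])
    moreover have "k x = 0" if "i = 0" "x \<in> S"
    proof -
      have "k' x = 0"
        using has_integral_0_cbox_imp_0[OF contb _ _ x(2) x(1)] k'pos i that by simp
      then show ?thesis using that by (simp add: k'_def)
    qed
    ultimately show ?thesis by blast
  qed
  show "integral S k \<ge> 0" using main[of undefined] integral_unique by blast
  show "k x = 0" if "integral S k = 0" "x \<in> S" using main[of x] that integral_unique by blast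
qed

text \<open>For the matrix P whose rows form an orthonormal basis, P G P^T = 1, hence det G (det
  P)^2 = 1.\<close>

lemma gram_det_pos:
  fixes B :: "real ^ 3 \<Rightarrow> real ^ 3 \<Rightarrow> real"
  assumes B: "bilinear B" and sym: "\<And>v w. B v w = B w v" and pos: "\<And>v. v \<noteq> 0 \<Longrightarrow> B v v > 0"
  shows "det (\<chi> j k. B (axis j 1) (axis k 1)) > 0"
proof -
  have l1: "linear (\<lambda>z. B z w)" and l2: "linear (B z)" for z w using B by (auto simp: bilinear_def)
  obtain e :: "3 \<Rightarrow> real ^ 3" where e: "\<forall>i j. B (e i) (e j) = (if i = j then 1 else 0)"
    using gram_schmidt_3[OF B sym pos] by blast
  define P :: "real ^ 3 ^ 3" where "P = (\<chi> i. e i)"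
  define G :: "real ^ 3 ^ 3" where "G = (\<chi> j k. B (axis j 1) (axis k 1))"
  have ex: "v = (\<Sum>i\<in>UNIV. v $ i *\<^sub>R axis i 1)" for v :: "real ^ 3"
    using axis_expansion_3[of v] by (simp add: sum_3)
  have B_G: "B v w = (\<Sum>l\<in>UNIV. (\<Sum>k\<in>UNIV. v $ k * G $ k $ l) * w $ l)" for v w
  proof -
    have "B v w = B v (\<Sum>l\<in>UNIV. w $ l *\<^sub>R axis l 1)" using ex[of w] by simp
    also have "\<dots> = (\<Sum>l\<in>UNIV. w $ l * B v (axis l 1))" by (simp add: linear_sum[OF l2] linear_cmul[OF l2])
    also have "\<dots> = (\<Sum>l\<in>UNIV. w $ l * B (\<Sum>k\<in>UNIV. v $ k *\<^sub>R axis k 1) (axis l 1))" using ex[of v] by simp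
    also have "\<dots> = (\<Sum>l\<in>UNIV. (\<Sum>k\<in>UNIV. v $ k * G $ k $ l) * w $ l)"
      by (simp add: linear_sum[OF l1] linear_cmul[OF l1] G_def mult.commute)
    finally show ?thesis .
  qed
  have "P ** G ** transpose P = mat 1"
    unfolding vec_eq_iff
  proof (intro allI)
    fix i j
    have "(P ** G ** transpose P) $ i $ j = B (e i) (e j)"
      unfolding B_G by (simp add: matrix_matrix_mult_def transpose_def P_def)
    then show "(P ** G ** transpose P) $ i $ j = mat 1 $ i $ j" using e by (simp add: mat_def)
  qed
  then have "det (P ** G ** transpose P) = 1" by (simp add: det_I)
  then have "det G * (det P)\<^sup>2 = 1" by (simp add: det_mul det_transpose power2_eq_square mult_ac)
  then show ?thesis
    unfolding G_def[symmetric] by (metis mult_le_0_iff not_less not_one_le_zero zero_le_power2)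
qed

context lagrangian
begin

text \<open>The integral is C times a sum of nonnegative integrals of partition functions against
  the volume density. If C is nonzero they all vanish, so by continuity every partition function
  vanishes at \<open>p\<close>, against their sum being 1.\<close>

lemma constant_mean_zero:
  assumes int: "has_volume_integral L h f 0" and const: "\<And>p. p \<in> points L \<Longrightarrow> f p = C" and p: "p \<in> points L"
  shows "C = 0"
proof (rule ccontr)
  assume "C \<noteq> 0"
  obtain N :: nat and c \<rho> where
    \<rho>: "\<And>i. i < N \<Longrightarrow> c i \<in> L" "\<And>i. i < N \<Longrightarrow> smooth_fun L (\<rho> i)"
      "\<And>i q. i < N \<Longrightarrow> q \<in> points L \<Longrightarrow> \<rho> i q \<ge> 0"
      "\<And>i. i < N \<Longrightarrow> \<exists>K. compact K \<and> K \<subseteq> cdom (c i) \<and> (\<forall>p\<in>points L - K. \<rho> i p = 0)"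
    and one: "(\<Sum>i<N. \<rho> i p) = 1"
    and I: "0 = (\<Sum>i<N. integral (cimg (c i)) (\<lambda>x. \<rho> i (cinv (c i) x) * f (cinv (c i) x) *
               sqrt (det (\<chi> j k. local_metric L h (c i) x (axis j 1) (axis k 1)))))"
    using int p unfolding has_volume_integral_def by blast
  define w where "w = (\<lambda>i x. \<rho> i (cinv (c i) x) * sqrt (det (\<chi> j k. local_metric L h (c i) x (axis j 1) (axis k 1))))"
  have w: "integral (cimg (c i)) (w i) \<ge> 0"
    "integral (cimg (c i)) (w i) = 0 \<Longrightarrow> x \<in> cimg (c i) \<Longrightarrow> w i x = 0"
    and det_pos: "x \<in> cimg (c i) \<Longrightarrow> det (\<chi> j k. local_metric L h (c i) x (axis j 1) (axis k 1)) > 0"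
    if i: "i < N" for i x
  proof -
    note ci = \<rho>(1)[OF i]
    interpret chart: metric_chart L h "c i" by (rule h_chart[OF ci])
    show dp: "det (\<chi> j k. local_metric L h (c i) x (axis j 1) (axis k 1)) > 0" if "x \<in> cimg (c i)" for x
      using gram_det_pos[OF chart.G_bilinear[OF that] chart.G_sym[OF that] chart.G_pos[OF that]] .
    obtain K where K: "compact K" "K \<subseteq> cdom (c i)" "\<And>p. p \<in> points L - K \<Longrightarrow> \<rho> i p = 0"
      using \<rho>(4)[OF i] by blast
    have hom: "homeomorphism (cdom (c i)) (cimg (c i)) (cmap (c i)) (cinv (c i))"
      using L ci unfolding smooth_manifold_def by blast
    have 1: "compact (cmap (c i) ` K)"
      by (rule compact_continuous_image[OF continuous_on_subset[OF homeomorphism_cont1[OF hom] K(2)] K(1)])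
    have 2: "cmap (c i) ` K \<subseteq> cimg (c i)" using K(2) by blast
    have Gc: "continuous_on (cimg (c i)) (\<lambda>x. chart.G x v w)" for v w
      by (rule smooth_on_continuous[OF chart.G_smooth])
    have "smooth_on (cimg (c i)) (\<lambda>x. \<rho> i (cinv (c i) x))" using \<rho>(2)[OF i] ci by (simp add: smooth_fun_def)
    from smooth_on_continuous[OF this]
    have 3: "continuous_on (cimg (c i)) (w i)"
      unfolding w_def det_3 by (auto intro!: continuous_intros Gc)
    have 4: "w i x = 0" if "x \<in> cimg (c i) - cmap (c i) ` K" for x
    proof -
      have "cinv (c i) x \<notin> K"
      proof
        assume "cinv (c i) x \<in> K"
        then have "cmap (c i) (cinv (c i) x) \<in> cmap (c i) ` K" by (rule imageI)
        then show False using that cmap_cinv[OF L ci, of x] by simp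
      qed
      then show ?thesis using that K(3)[of "cinv (c i) x"] L_pt[OF ci, of x] by (simp add: w_def)
    qed
    have 5: "w i x \<ge> 0" if "x \<in> cimg (c i)" for x
      unfolding w_def using \<rho>(3)[OF i L_pt[OF ci that]] dp[OF that] by simp
    note supp = compact_support_integral[OF chart.op 1 2 3 4 5]
    show "integral (cimg (c i)) (w i) \<ge> 0" by (rule supp(1))
    show "w i x = 0" if "integral (cimg (c i)) (w i) = 0" "x \<in> cimg (c i)" for x by (rule supp(2)[OF _ _ that])
  qed
  have "integral (cimg (c i)) (\<lambda>x. \<rho> i (cinv (c i) x) * f (cinv (c i) x) *
               sqrt (det (\<chi> j k. local_metric L h (c i) x (axis j 1) (axis k 1)))) = C * integral (cimg (c i)) (w i)"
    if i: "i < N" for i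
  proof -
    have "integral (cimg (c i)) (\<lambda>x. \<rho> i (cinv (c i) x) * f (cinv (c i) x) *
               sqrt (det (\<chi> j k. local_metric L h (c i) x (axis j 1) (axis k 1)))) =
        integral (cimg (c i)) (\<lambda>x. C * w i x)"
      by (rule integral_cong) (simp add: w_def const[OF L_pt[OF \<rho>(1)[OF i]]])
    then show ?thesis by simp
  qed
  then have "C * (\<Sum>i<N. integral (cimg (c i)) (w i)) = 0"
    using I by (simp add: sum_distrib_left)
  then have "(\<Sum>i<N. integral (cimg (c i)) (w i)) = 0" using \<open>C \<noteq> 0\<close> by simp
  then have zero: "integral (cimg (c i)) (w i) = 0" if "i < N" for i
    using that w(1) by (subst (asm) sum_nonneg_eq_0_iff) auto
  have "\<rho> i p = 0" if i: "i < N" for i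
  proof (cases "p \<in> cdom (c i)")
    case True
    have "w i (cmap (c i) p) = 0" using w(2)[OF i zero[OF i], of "cmap (c i) p"] True by simp
    then show ?thesis
      using det_pos[OF i, of "cmap (c i) p"] True by (simp add: w_def cinv_cmap[OF L \<rho>(1)[OF i]])
  next
    case False
    then show ?thesis using \<rho>(4)[OF i] p by blast
  qed
  then show False using one by simp
qed

end

lemma (in lagrangian_harmonic) F_zero:
  assumes f0: "f = (\<lambda>p. 0)" and p: "p \<in> points L" and X: "X \<in> tangent_space L p" and Y: "Y \<in> tangent_space L p"
  shows "F p X Y = 0"
proof -
  define c where "c = chart_at L p"
  have cp: "c \<in> charts_at L p" using p by (simp add: c_def chart_at_in)
  from charts_atD[OF this] have c: "c \<in> L" and x: "cmap c p \<in> cimg c" by auto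
  interpret chart: metric_chart L h c by (rule h_chart[OF c])
  have "grad c (cmap c p) = 0"
  proof (rule ccontr)
    assume "grad c (cmap c p) \<noteq> 0"
    from chart.G_pos[OF x this] show False unfolding grad(2)[OF c x] by (simp add: f0)
  qed
  then have "local_metric L F c (cmap c p) (X c) (Y c) = 0"
    using F_chart[OF c x, of "X c" "Y c"] by (simp add: vdet_def)
  then show ?thesis by (simp add: local_metric_apply[OF L cp X Y])
qed

theorem proposition4p5:
  fixes M :: "('m::{t2_space, second_countable_topology}, real ^ 6) atlas"
    and L :: "('m, real ^ 3) atlas"
    and J :: "('m, real ^ 6) endo"
    and g :: "('m, real ^ 6) metric"
    and l :: real
    and D :: "('m \<times> ('m, real ^ 6) tv) set"
    and E :: "'m \<times> ('m, real ^ 6) tv \<Rightarrow> 'm"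
    and \<alpha> :: "('m, real ^ 3) form1"
    and f :: "'m \<Rightarrow> real"
  assumes "strict_nearly_kaehler M J g"
    and "constant_type M J g l"
    and "closed_lagrangian L M J g"
    and "exponential_map M g D E"
    and "\<alpha> \<in> one_forms L"
    and "\<forall>p\<in>points L. (p, normal_section L M J g \<alpha> p) \<in> D"
    and "f \<in> mean_zero_functions L (induced_metric L M g)"
  shows "F_hat L M J g l E (\<alpha>, f) = ((\<lambda>p X. 0), (\<lambda>p. 0)) \<longleftrightarrow>
         F_map L M J g E \<alpha> = (\<lambda>p X Y. 0) \<and> f = (\<lambda>p. 0)"
proof
  let ?F = "F_map L M J g E \<alpha>" and ?h = "induced_metric L M g" and ?vol = "vol_form L M J g l"
  have nk: "nearly_kaehler M J g" using assms(1) by (simp add: strict_nearly_kaehler_def)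
  interpret lagrangian M J g L l
    using nk assms(2,3) by unfold_locales (auto simp: nearly_kaehler_def)
  have fm: "smooth_fun L f" "ext0 L f = f" "has_volume_integral L ?h f 0"
    using assms(7) by (auto simp: mean_zero_functions_def smooth_functions_def)
  assume hat: "F_hat L M J g l E (\<alpha>, f) = ((\<lambda>p X. 0), (\<lambda>p. 0))"
  have 1: "ext1 L (\<lambda>p X. hodge2 L ?h ?vol ?F p X + d0 L f p X) = (\<lambda>p X. 0)"
    and 2: "ext0 L (\<lambda>p. - (1 / 3) * hodge3 L ?h ?vol (d2 L ?F) p) = (\<lambda>p. 0)"
    using hat by (simp_all add: F_hat_def Let_def)
  have "hodge2 L ?h ?vol ?F p X + d0 L f p X = 0" if "p \<in> points L" "X \<in> tangent_space L p" for p X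
    using fun_cong[OF fun_cong[OF 1, of p], of X] that by (simp add: ext1_def)
  moreover have "hodge3 L ?h ?vol (d2 L ?F) p = 0" if "p \<in> points L" for p
    using fun_cong[OF 2, of p] that by (simp add: ext0_def)
  ultimately interpret lagrangian_harmonic M J g L l ?F f
    using fm(1) F_map_form[OF assms(5,4,6)] by unfold_locales blast+
  obtain C where C: "\<And>p. p \<in> points L \<Longrightarrow> f p = C" using f_constant by blast
  have f0: "f = (\<lambda>p. 0)"
  proof
    fix p
    show "f p = 0"
    proof (cases "p \<in> points L")
      case True
      then show ?thesis using C constant_mean_zero[OF fm(3) C] by simp
    next
      case False
      then show ?thesis using fun_cong[OF fm(2), of p] by (simp add: ext0_def)
    qed
  qed
  moreover have "?F = (\<lambda>p X Y. 0)"
  proof (intro ext)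
    fix p X Y
    show "?F p X Y = 0"
    proof (cases "p \<in> points L \<and> X \<in> tangent_space L p \<and> Y \<in> tangent_space L p")
      case True
      then show ?thesis using F_zero[OF f0] by blast
    next
      case False
      then show ?thesis unfolding F_map_def pullback2_def ext2_def by auto
    qed
  qed
  ultimately show "?F = (\<lambda>p X Y. 0) \<and> f = (\<lambda>p. 0)" by blast
next
  assume "F_map L M J g E \<alpha> = (\<lambda>p X Y. 0) \<and> f = (\<lambda>p. 0)"
  then have F0: "F_map L M J g E \<alpha> = (\<lambda>p X Y. 0)" and f0: "f = (\<lambda>p. 0)" by blast+
  show "F_hat L M J g l E (\<alpha>, f) = ((\<lambda>p X. 0), (\<lambda>p. 0))"
    unfolding F_hat_def prod.case Let_def F0 f0
    \<comment> \<open>Whichever frames and charts \<open>SOME\<close> selects, only values and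
      derivatives of zero functions remain.\<close>
    by (simp add: hodge2_def hodge3_def d2_def d0_def ext1_def ext0_def Let_def o_def)
qed

end
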